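(* Let $n\ge 1$ and let $F$ be a continuous function on $\mathbb{R}^{2n}=\mathbb{R}^n\times\mathbb{R}^n$. Suppose there exist $M>0$ and a family $(\varepsilon_j)_{1\le j\le n}$ of nonnegative real numbers such that: (a) $|F(x,\xi)|\le M$ for all $(x,\xi)\in\mathbb{R}^{2n}$; (b) for every multi-index $(\alpha,\beta)\in I_2(\{1,\dots,n\})$, the derivative $\partial_x^\alpha\partial_\xi^\beta F$ is well defined, continuous and bounded on $\mathbb{R}^{2n}$ and, if $(\alpha,\beta)\neq 0$, $$|\partial_x^{\alpha}\partial_\xi^{\beta}F(x,\xi)|\le M\prod_{j\in S(\alpha,\beta)}\varepsilon_j^{\alpha_j+\beta_j}\qquad\text{for all }(x,\xi)\in\mathbb{R}^{2n}.$$ Then the operator $Op_h^{weyl}(F)$ is bounded in $L^2(\mathbb{R}^n)$ and, if $0<h\le 1$, $$\|Op_h^{weyl}(F)\|_{\mathcal{L}(L^2(\mathbb{R}^n))}\le M\prod_{j=1}^n\left(1+225\pi K_2\sqrt{h}\,\varepsilon_j\right),\qquad K_2=\sup_{j\le n}\max(1,\varepsilon_j^3).$$ If condition (b) holds for every multi-index $(\alpha,\beta)\in I_4(\{1,\dots,n\})$, then (for $0<h\le 1$) $$\|Op_h^{weyl}(F)\|_{\mathcal{L}(L^2(\mathbb{R}^n))}\le M\prod_{j=1}^n\left(1+225\pi K_4 h\,\varepsilon_j^2\right),\qquad K_4=\sup_{j\le n}\max(1,\varepsilon_j^6).$$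
   Context: For $m\ge1$, $I_m(\{1,\dots,n\})$ is the set of multi-indices $(\alpha,\beta)\in\mathbb{N}^n\times\mathbb{N}^n$ with $0\le\alpha_j\le m$ and $0\le\beta_j\le m$ for all $j\le n$. For a multi-index $(\alpha,\beta)\ne0$, $S(\alpha,\beta)=\{j:\alpha_j+\beta_j\ge1\}$. For $h>0$, the Weyl operator $Op_h^{weyl}(F)$ is formally $$(Op_h^{weyl}(F)\varphi)(x)=(2\pi h)^{-n}\int_{\mathbb{R}^{2n}}e^{\frac{i}{h}(x-y)\cdot\xi}F\left(\frac{x+y}{2},\xi\right)\varphi(y)\,dy\,d\xi,\qquad\varphi\in\mathcal{S}(\mathbb{R}^n).$$ Precisely, it is defined through its quadratic form: for $\varphi,\psi\in\mathcal{S}(\mathbb{R}^n)$, $$\langle Op_h^{weyl}(F)\varphi,\psi\rangle=(2\pi h)^{-n}\int_{\mathbb{R}^{3n}}e^{\frac{i}{h}(u-v)\cdot t}F\left(\frac{u+v}{2},t\right)\varphi(v)\overline{\psi(u)}\,du\,dv\,dt,$$ an oscillatory integral, where one integrates first in $(u,v)$ (absolutely convergent for each $t$) and then in $t$ (the result is integrable, as integration by parts with $\partial_u-\partial_v$ shows). Boundedness in $L^2(\mathbb{R}^n)$ means that this form extends to a bounded operator. The scalar product is linear in the first variable. *)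

theory Defs
  imports "HOL-Analysis.Analysis"
begin

section \<open>Iterated partial derivatives\<close>

text \<open>
  \<open>has_iterated_partial F ds G\<close>: \<open>G\<close> is the result of differentiating \<open>F\<close> successively along the
  vectors in \<open>ds\<close> (the last entry of \<open>ds\<close> first), and every derivative involved exists at every
  point. Being a relation, it assigns no value where a derivative fails to exist.
\<close>

inductive has_iterated_partial ::
    "('a::euclidean_space \<Rightarrow> complex) \<Rightarrow> 'a list \<Rightarrow> ('a \<Rightarrow> complex) \<Rightarrow> bool"
  for F where
  "has_iterated_partial F [] F"
| "has_iterated_partial F ds G \<Longrightarrow>
    (\<And>p. ((\<lambda>t::real. G (p + t *\<^sub>R b)) has_vector_derivative G' p) (at 0)) \<Longrightarrow>
    has_iterated_partial F (b # ds) G'"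

text \<open>
  \<open>has_multi_partial F \<alpha> \<beta> G\<close>: the derivative \<open>\<partial>\<^sub>x\<^sup>\<alpha> \<partial>\<^sub>\<xi>\<^sup>\<beta> F\<close> is well defined, independently of the
  order of the differentiations, and equals \<open>G\<close>. The coordinate directions of \<open>x\<^sub>j\<close> and \<open>\<xi>\<^sub>j\<close> are
  \<open>(axis j 1, 0)\<close> and \<open>(0, axis j 1)\<close>; together they make up \<open>Basis\<close>.
\<close>

definition has_multi_partial ::
    "((real^'n) \<times> (real^'n) \<Rightarrow> complex) \<Rightarrow> ('n \<Rightarrow> nat) \<Rightarrow> ('n \<Rightarrow> nat)
      \<Rightarrow> ((real^'n) \<times> (real^'n) \<Rightarrow> complex) \<Rightarrow> bool" where
  "has_multi_partial F \<alpha> \<beta> G \<longleftrightarrow>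
    (\<forall>ds. set ds \<subseteq> Basis \<and>
        (\<forall>j. count_list ds (axis j 1, 0) = \<alpha> j \<and> count_list ds (0, axis j 1) = \<beta> j)
      \<longrightarrow> has_iterated_partial F ds G)"

definition multi_indices :: "nat \<Rightarrow> (('n \<Rightarrow> nat) \<times> ('n \<Rightarrow> nat)) set" where
  "multi_indices m = {(\<alpha>, \<beta>). \<forall>j. \<alpha> j \<le> m \<and> \<beta> j \<le> m}"

definition index_support :: "('n \<Rightarrow> nat) \<Rightarrow> ('n \<Rightarrow> nat) \<Rightarrow> 'n set" where
  "index_support \<alpha> \<beta> = {j. \<alpha> j + \<beta> j \<ge> 1}"

definition symbol_derivative_bounds ::
    "nat \<Rightarrow> real \<Rightarrow> ('n \<Rightarrow> real) \<Rightarrow> ((real^'n) \<times> (real^'n) \<Rightarrow> complex) \<Rightarrow> bool" where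
  "symbol_derivative_bounds m M \<epsilon> F \<longleftrightarrow>
    (\<forall>(\<alpha>, \<beta>) \<in> multi_indices m. \<exists>G. has_multi_partial F \<alpha> \<beta> G \<and>
      continuous_on UNIV G \<and> bounded (range G) \<and>
      ((\<alpha>, \<beta>) \<noteq> (\<lambda>_. 0, \<lambda>_. 0) \<longrightarrow>
        (\<forall>x \<xi>. norm (G (x, \<xi>)) \<le> M * (\<Prod>j\<in>index_support \<alpha> \<beta>. \<epsilon> j ^ (\<alpha> j + \<beta> j)))))"


section \<open>Schwartz functions\<close>

definition schwartz :: "('a::euclidean_space \<Rightarrow> complex) \<Rightarrow> bool" where
  "schwartz \<phi> \<longleftrightarrow>
    (\<forall>ds. set ds \<subseteq> Basis \<longrightarrow>
      (\<exists>G. has_iterated_partial \<phi> ds G \<and> continuous_on UNIV G \<and>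
        (\<forall>k::nat. bounded (range (\<lambda>x. norm x ^ k *\<^sub>R G x)))))"


section \<open>Bounded operators in $L^2$\<close>

text \<open>
  Elements of $L^2$ are represented by square integrable functions, with equality almost everywhere
  in place of equality of classes.
\<close>

definition L2_fun :: "('a::euclidean_space \<Rightarrow> complex) \<Rightarrow> bool" where
  "L2_fun f \<longleftrightarrow> f \<in> borel_measurable lborel \<and> integrable lborel (\<lambda>x. (norm (f x))\<^sup>2)"

definition L2_inner :: "('a::euclidean_space \<Rightarrow> complex) \<Rightarrow> ('a \<Rightarrow> complex) \<Rightarrow> complex" where
  "L2_inner f g = (LINT x|lborel. f x * cnj (g x))"

definition L2_norm :: "('a::euclidean_space \<Rightarrow> complex) \<Rightarrow> real" where
  "L2_norm f = sqrt (LINT x|lborel. (norm (f x))\<^sup>2)"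

definition bounded_L2_operator ::
    "(('a::euclidean_space \<Rightarrow> complex) \<Rightarrow> ('a \<Rightarrow> complex)) \<Rightarrow> bool" where
  "bounded_L2_operator A \<longleftrightarrow>
    (\<forall>f. L2_fun f \<longrightarrow> L2_fun (A f)) \<and>
    (\<forall>f g. L2_fun f \<and> L2_fun g \<and> (AE x in lborel. f x = g x) \<longrightarrow> (AE x in lborel. A f x = A g x)) \<and>
    (\<forall>f g a b. L2_fun f \<and> L2_fun g \<longrightarrow>
      (AE x in lborel. A (\<lambda>y. a * f y + b * g y) x = a * A f x + b * A g x)) \<and>
    (\<exists>C. \<forall>f. L2_fun f \<longrightarrow> L2_norm (A f) \<le> C * L2_norm f)"

definition L2_opnorm :: "(('a::euclidean_space \<Rightarrow> complex) \<Rightarrow> ('a \<Rightarrow> complex)) \<Rightarrow> real" where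
  "L2_opnorm A = Sup {L2_norm (A f) | f. L2_fun f \<and> L2_norm f \<le> 1}"


section \<open>The Weyl operator\<close>

definition weyl_integrand ::
    "real \<Rightarrow> ((real^'n) \<times> (real^'n) \<Rightarrow> complex) \<Rightarrow> (real^'n \<Rightarrow> complex) \<Rightarrow> (real^'n \<Rightarrow> complex)
      \<Rightarrow> real^'n \<Rightarrow> (real^'n) \<times> (real^'n) \<Rightarrow> complex" where
  "weyl_integrand h F \<phi> \<psi> t = (\<lambda>(u, v).
     exp (\<i> * of_real (((u - v) \<bullet> t) / h)) * F ((1/2) *\<^sub>R (u + v), t) * \<phi> v * cnj (\<psi> u))"

text \<open>
  The integral is iterated, first in \<open>(u, v)\<close> and then in \<open>t\<close>. Both integrability conditions are
  part of the notion, because the Bochner integral of a non-integrable function is \<open>0\<close>.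
\<close>

definition has_weyl_form ::
    "real \<Rightarrow> ((real^'n) \<times> (real^'n) \<Rightarrow> complex) \<Rightarrow> (real^'n \<Rightarrow> complex) \<Rightarrow> (real^'n \<Rightarrow> complex)
      \<Rightarrow> complex \<Rightarrow> bool" where
  "has_weyl_form h F \<phi> \<psi> z \<longleftrightarrow>
    (\<forall>t. integrable lborel (weyl_integrand h F \<phi> \<psi> t)) \<and>
    integrable lborel (\<lambda>t. LINT p|lborel. weyl_integrand h F \<phi> \<psi> t p) \<and>
    z = of_real (1 / (2 * pi * h) ^ CARD('n)) *
          (LINT t|lborel. LINT p|lborel. weyl_integrand h F \<phi> \<psi> t p)"

text \<open>
  \<open>A\<close> is the bounded operator in $L^2$ extending the Weyl form. Such an \<open>A\<close> is unique up to equality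
  almost everywhere, since Schwartz functions are dense.
\<close>

definition is_bounded_weyl_operator ::
    "real \<Rightarrow> ((real^'n) \<times> (real^'n) \<Rightarrow> complex) \<Rightarrow> ((real^'n \<Rightarrow> complex) \<Rightarrow> (real^'n \<Rightarrow> complex))
      \<Rightarrow> bool" where
  "is_bounded_weyl_operator h F A \<longleftrightarrow>
    bounded_L2_operator A \<and>
    (\<forall>\<phi> \<psi>. schwartz \<phi> \<and> schwartz \<psi> \<longrightarrow> has_weyl_form h F \<phi> \<psi> (L2_inner (A \<phi>) \<psi>))"

end

theory Submission
  imports Defs "HOL-Probability.Probability"
begin

text \<open>
  Write \<open>n\<close> for the dimension and \<open>s = sqrt (h/2)\<close>. The theorem follows from the bound
  \<open>M * (\<Prod>j. (1 + h * (\<epsilon> j)\<^sup>2 / 2)\<^sup>2)\<close> for the operator norm (\<open>weyl_operator_exists\<close>), whose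
  factors are compared with the required ones in \<open>factor_le_sqrt\<close> and \<open>factor_le_linear\<close>.

  On Schwartz functions the Weyl form is \<open>(2 * pi * h)\<close> to the power \<open>-n\<close> times the integral over phase space
  of \<open>F\<close> against the cross-Wigner function \<open>W\<close> of \<open>\<phi>\<close> and \<open>\<psi>\<close>, and \<open>W\<close> is integrable
  (\<open>integrable_wigner\<close>, \<open>has_weyl_form_wigner\<close>). If \<open>F\<close> is first averaged with the Gaussian of
  standard deviation \<open>s\<close> in all \<open>2 * n\<close> coordinates of phase space, the averaging may be moved to \<open>W\<close>, and
  the averaged \<open>W\<close> factors: up to a phase and a constant, its value at \<open>p\<close> is \<open>V \<phi> p\<close> times the conjugate
  of \<open>V \<psi> p\<close>, where \<open>V\<close> is the Fourier transform with a Gaussian window. The Bessel inequality for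
  \<open>V\<close> and the Cauchy-Schwarz inequality then bound the form of an averaged symbol by its supremum
  times the two norms: this is the boundedness of anti-Wick operators. If the Gaussian is multiplied by
  a character \<open>exp (\<i> * (Y \<bullet> w))\<close>, the two factors are only shifted in opposite directions,
  so that the bound is the same for all \<open>Y\<close> (\<open>modulated_average_wigner_bound\<close>).

  It remains to remove the averaging, one coordinate \<open>b\<close> at a time. Let \<open>U r\<close> be the form
  with standard deviation \<open>r\<close> in the direction \<open>b\<close>. Gaussian integration by parts gives
  \<open>U' r = r * U2 r\<close>, where \<open>U2\<close> belongs to the second derivative of the symbol along \<open>b\<close>. For
  \<open>r \<le> s\<close> the Gaussian of width \<open>r\<close> is \<open>s / r\<close> times a mean of characters times the Gaussian of
  width \<open>s\<close>; hence \<open>U2 r\<close> is at most \<open>s / r\<close> times the bound \<open>D\<close> that holds at width \<open>s\<close>. The singular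
  factor cancels against \<open>r\<close>, and integrating from \<open>0\<close> to \<open>s\<close> yields
  \<open>\<bar>U 0\<bar> \<le> \<bar>U s\<bar> + s\<^sup>2 * D\<close>. As \<open>D\<close> carries the factor \<open>\<epsilon>\<^sup>2\<close>, every coordinate
  costs a factor \<open>1 + s\<^sup>2 * \<epsilon>\<^sup>2\<close> (\<open>pairing_bound\<close>); each \<open>j\<close> owns two coordinates.

  The operator is obtained from the bounded form by applying the Riesz representation theorem
  twice on the closure of the Schwartz space, first for the adjoint on Schwartz functions, then for the
  operator on all of $L^2$ (\<open>sesquilinear_form_operator\<close>).
\<close>

section \<open>Integration on Euclidean spaces\<close>

lemmas integral_eqI = Bochner_Integration.integral_cong[OF refl]

lemmas integrable_dominated = Bochner_Integration.integrable_bound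

lemma nn_integral_affine_euclidean:
  fixes g :: "'a::euclidean_space \<Rightarrow> ennreal"
  assumes [measurable]: "g \<in> borel_measurable borel" and c: "\<And>j. j \<in> Basis \<Longrightarrow> c j \<noteq> 0"
  shows "(\<integral>\<^sup>+x. g x \<partial>lborel)
    = (\<Prod>j\<in>Basis. \<bar>c j\<bar>) * (\<integral>\<^sup>+x. g (t + (\<Sum>j\<in>Basis. (c j * (x \<bullet> j)) *\<^sub>R j)) \<partial>lborel)"
  by (subst lborel_affine_euclidean[of c t, OF c])
     (auto simp add: nn_integral_density nn_integral_distr nn_integral_cmult prod_ennreal)

lemma integral_affine_euclidean:
  fixes f :: "'a::euclidean_space \<Rightarrow> 'b::{banach, second_countable_topology}"
  assumes f: "integrable lborel f" and c: "\<And>j. j \<in> Basis \<Longrightarrow> c j \<noteq> 0"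
  shows "integrable lborel (\<lambda>x. f (t + (\<Sum>j\<in>Basis. (c j * (x \<bullet> j)) *\<^sub>R j)))"
    and "(LBINT x. f x)
      = (\<Prod>j\<in>Basis. \<bar>c j\<bar>) *\<^sub>R (LBINT x. f (t + (\<Sum>j\<in>Basis. (c j * (x \<bullet> j)) *\<^sub>R j)))"
proof -
  have fm[measurable]: "f \<in> borel_measurable borel" using f by auto
  have P: "(\<Prod>j\<in>Basis. \<bar>c j\<bar>) > 0" using c by (intro prod_pos) auto
  have "(\<integral>\<^sup>+x. norm (f x) \<partial>lborel) < \<infinity>" using f by (simp add: integrable_iff_bounded)
  then show int: "integrable lborel (\<lambda>x. f (t + (\<Sum>j\<in>Basis. (c j * (x \<bullet> j)) *\<^sub>R j)))"
    unfolding integrable_iff_bounded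
    using P by (subst (asm) nn_integral_affine_euclidean[where c=c and t=t])
        (auto simp: c ennreal_mult_less_top)
  show "(LBINT x. f x)
      = (\<Prod>j\<in>Basis. \<bar>c j\<bar>) *\<^sub>R (LBINT x. f (t + (\<Sum>j\<in>Basis. (c j * (x \<bullet> j)) *\<^sub>R j)))"
    using P int by (subst lborel_affine_euclidean[of c t, OF c])
      (auto simp: integral_density integral_distr)
qed

lemma integrable_affine:
  fixes f :: "'a::euclidean_space \<Rightarrow> 'b::{banach, second_countable_topology}"
  assumes "integrable lborel f" "c \<noteq> 0"
  shows "integrable lborel (\<lambda>x. f (t + c *\<^sub>R x))"
  using integral_affine_euclidean(1)[OF assms(1), of "\<lambda>_. c" t] assms(2)
  by (simp add: scaleR_scaleR[symmetric] scaleR_sum_right[symmetric] euclidean_representation del: scaleR_scaleR)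

lemma integral_affine:
  fixes f :: "'a::euclidean_space \<Rightarrow> 'b::{banach, second_countable_topology}"
  assumes "integrable lborel f" "c \<noteq> 0"
  shows "(LBINT x. f (t + c *\<^sub>R x)) = (1 / \<bar>c\<bar> ^ DIM('a)) *\<^sub>R (LBINT x. f x)"
  using integral_affine_euclidean(2)[OF assms(1), of "\<lambda>_. c" t] assms(2)
  by (simp add: scaleR_scaleR[symmetric] scaleR_sum_right[symmetric] euclidean_representation del: scaleR_scaleR)
     simp

lemma nn_integral_affine:
  fixes g :: "'a::euclidean_space \<Rightarrow> ennreal"
  assumes "g \<in> borel_measurable borel" "c \<noteq> 0"
  shows "(\<integral>\<^sup>+x. g x \<partial>lborel) = ennreal (\<bar>c\<bar> ^ DIM('a)) * (\<integral>\<^sup>+x. g (t + c *\<^sub>R x) \<partial>lborel)"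
  using nn_integral_affine_euclidean[OF assms(1), of "\<lambda>_. c" t] assms(2) ennreal_power[of "\<bar>c\<bar>" "DIM('a)"]
  by (simp add: scaleR_scaleR[symmetric] scaleR_sum_right[symmetric] euclidean_representation del: scaleR_scaleR)

lemma integrable_translate:
  fixes f :: "'a::euclidean_space \<Rightarrow> 'b::{banach, second_countable_topology}"
  assumes "integrable lborel f"
  shows "integrable lborel (\<lambda>x. f (x + t))" "integrable lborel (\<lambda>x. f (x - t))" "integrable lborel (\<lambda>x. f (t - x))"
  using integrable_affine[OF assms, of 1 t] integrable_affine[OF assms, of 1 "-t"] integrable_affine[OF assms, of "-1" t]
  by (simp_all add: add.commute)

lemma integral_translate:
  fixes f :: "'a::euclidean_space \<Rightarrow> 'b::{banach, second_countable_topology}"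
  assumes "integrable lborel f"
  shows "(LBINT x. f (x + t)) = (LBINT x. f x)"
    "(LBINT x. f (x - t)) = (LBINT x. f x)" 
    "(LBINT x. f (t - x)) = (LBINT x. f x)"
  using integral_affine[OF assms, of 1 t] integral_affine[OF assms, of 1 "-t"] integral_affine[OF assms, of "-1" t]
  by (simp_all add: add.commute)

lemma nn_integral_translate:
  fixes g :: "'a::euclidean_space \<Rightarrow> ennreal"
  assumes "g \<in> borel_measurable borel"
  shows "(\<integral>\<^sup>+x. g (x + t) \<partial>lborel) = (\<integral>\<^sup>+x. g x \<partial>lborel)"
    "(\<integral>\<^sup>+x. g (x - t) \<partial>lborel) = (\<integral>\<^sup>+x. g x \<partial>lborel)" 
    "(\<integral>\<^sup>+x. g (t - x) \<partial>lborel) = (\<integral>\<^sup>+x. g x \<partial>lborel)"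
  using nn_integral_affine[OF assms, of 1 t] nn_integral_affine[OF assms, of 1 "-t"] nn_integral_affine[OF assms, of "-1" t]
  by (simp_all add: add.commute)

text \<open>
  Lebesgue measure is the product of one-dimensional Lebesgue measures along the basis; this is
  what reduces all Gaussian integrals below to the real line.
\<close>

lemma integrable_prod_Basis:
  fixes f :: "'a::euclidean_space \<Rightarrow> real \<Rightarrow> 'b::{real_normed_field, banach, second_countable_topology}"
  assumes f: "\<And>b. b \<in> Basis \<Longrightarrow> integrable lborel (f b)"
  shows "integrable lborel (\<lambda>x::'a. \<Prod>b\<in>Basis. f b (x \<bullet> b))"
    and "(LBINT x. (\<Prod>b\<in>Basis. f b (x \<bullet> b))) = (\<Prod>b\<in>Basis. LBINT t. f b t)"
proof -
  interpret product_sigma_finite "\<lambda>_::'a. lborel :: real measure"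
    by standard
  have [measurable]: "f b \<in> borel_measurable borel" if "b \<in> Basis" for b
    using f[OF that] by auto
  have m[measurable]: "(\<lambda>x::'a. \<Prod>b\<in>Basis. f b (x \<bullet> b)) \<in> borel_measurable borel"
    by (rule borel_measurable_prod) measurable
  have m2[measurable]: "(\<lambda>x::'a\<Rightarrow>real. \<Sum>b\<in>Basis. x b *\<^sub>R b) \<in> (\<Pi>\<^sub>M b\<in>Basis. lborel) \<rightarrow>\<^sub>M borel"
    by measurable
  have eq: "(\<Prod>b\<in>Basis. f b ((\<Sum>b\<in>Basis. x b *\<^sub>R b) \<bullet> b)) = (\<Prod>b\<in>Basis. f b (x b))" for x :: "'a \<Rightarrow> real"
    by (intro prod.cong refl) simp
  let ?P = "\<lambda>x::'a. \<Prod>b\<in>Basis. f b (x \<bullet> b)" and ?T = "\<lambda>x::'a\<Rightarrow>real. \<Sum>b\<in>Basis. x b *\<^sub>R b"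
  let ?PM = "\<Pi>\<^sub>M b\<in>(Basis::'a set). (lborel :: real measure)"
  have "integrable ?PM (\<lambda>x. ?P (?T x))"
    unfolding eq using product_integrable_prod[OF finite_Basis f] by simp
  then have "integrable (distr ?PM borel ?T) ?P"
    by (subst integrable_distr_eq[OF m2 m])
  then show "integrable lborel ?P"
    by (simp only: lborel_eq[symmetric])
  have "integral\<^sup>L lborel ?P = integral\<^sup>L (distr ?PM borel ?T) ?P"
    by (simp only: lborel_eq[symmetric])
  also have "\<dots> = (\<integral>x. ?P (?T x) \<partial>?PM)"
    by (rule integral_distr[OF m2 m])
  also have "\<dots> = (\<Prod>b\<in>Basis. LBINT t. f b t)"
    unfolding eq by (rule product_integral_prod[OF finite_Basis f])
  finally show "integral\<^sup>L lborel ?P = (\<Prod>b\<in>Basis. LBINT t. f b t)" .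
qed

lemma integrable_lborel_pair_mult:
  fixes f :: "'a::euclidean_space \<Rightarrow> complex" and g :: "'b::euclidean_space \<Rightarrow> complex"
  assumes "integrable lborel f" "integrable lborel g"
  shows "integrable lborel (\<lambda>(x, y). f x * g y)"
proof -
  have [measurable]: "f \<in> borel_measurable borel" "g \<in> borel_measurable borel" using assms by auto
  have "integrable (lborel \<Otimes>\<^sub>M lborel) (\<lambda>(x, y). f x * g y)"
    using assms by (intro lborel_pair.Fubini_integrable) (auto simp: norm_mult)
  then show ?thesis by (simp add: lborel_prod)
qed

lemma integrable_lborel_pairI:
  fixes f :: "'a::euclidean_space \<Rightarrow> 'b::euclidean_space \<Rightarrow> complex"
  assumes [measurable]: "(\<lambda>(x, y). f x y) \<in> borel_measurable borel"
    and "(\<integral>\<^sup>+x. \<integral>\<^sup>+y. ennreal (norm (f x y)) \<partial>lborel \<partial>lborel) < \<infinity>"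
  shows "integrable lborel (\<lambda>(x, y). f x y)"
proof -
  have [measurable]: "(\<lambda>(x, y). f x y) \<in> borel_measurable (lborel \<Otimes>\<^sub>M lborel)"
    using assms(1) by (simp add: lborel_prod)
  have "(\<integral>\<^sup>+p. ennreal (norm (case p of (x, y) \<Rightarrow> f x y)) \<partial>(lborel \<Otimes>\<^sub>M lborel)) 
    = (\<integral>\<^sup>+x. \<integral>\<^sup>+y. ennreal (norm (f x y)) \<partial>lborel \<partial>lborel)"
    by (subst lborel.nn_integral_fst[symmetric]) auto
  then have "integrable (lborel \<Otimes>\<^sub>M lborel) (\<lambda>(x, y). f x y)"
    using assms(2) by (intro integrableI_bounded) auto
  then show ?thesis by (simp add: lborel_prod)
qed

lemma lborel_Fubini:
  fixes f :: "'a::euclidean_space \<Rightarrow> 'b::euclidean_space \<Rightarrow> complex"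
  assumes "integrable lborel (\<lambda>(x, y). f x y)"
  shows "(LBINT x. LBINT y. f x y) = (LBINT y. LBINT x. f x y)"
    and "(LBINT x. LBINT y. f x y) = (LBINT p. (case p of (x, y) \<Rightarrow> f x y))"
    and "integrable lborel (\<lambda>x. LBINT y. f x y)"
    and "integrable lborel (\<lambda>y. LBINT x. f x y)"
proof -
  have i: "integrable (lborel \<Otimes>\<^sub>M lborel) (\<lambda>(x, y). f x y)"
    using assms by (simp add: lborel_prod)
  show "(LBINT x. LBINT y. f x y) = (LBINT y. LBINT x. f x y)"
    using lborel_pair.Fubini_integral[OF i] by simp
  show "(LBINT x. LBINT y. f x y) = (LBINT p. (case p of (x, y) \<Rightarrow> f x y))"
    using lborel_pair.integral_fst'[OF i] by (simp add: lborel_prod)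
  show "integrable lborel (\<lambda>x. LBINT y. f x y)"
    using lborel_pair.integrable_fst'[OF i] by simp
  show "integrable lborel (\<lambda>y. LBINT x. f x y)"
    using lborel_pair.integrable_snd[OF i] by simp
qed

text \<open>
  The integrability condition behind most exchanges of integrals below: the absolute value is dominated by
  a tensor product, the bounded factor \<open>K\<close> carrying the oscillation or the symbol.
\<close>

lemma lborel_Fubini_bounded:
  fixes K :: "'a::euclidean_space \<Rightarrow> 'b::euclidean_space \<Rightarrow> complex"
  assumes "integrable lborel f" "integrable lborel g" 
    and [measurable]: "(\<lambda>(x, y). K x y) \<in> borel_measurable borel"
    and K: "\<And>x y. norm (K x y) \<le> C"
  shows "integrable lborel (\<lambda>(x, y). K x y * f x * g y)"
proof (rule integrable_dominated)
  have [measurable]: "f \<in> borel_measurable borel" "g \<in> borel_measurable borel" using assms by auto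
  show "integrable lborel (\<lambda>p. complex_of_real C * (case p of (x, y) \<Rightarrow> f x * g y))"
    by (intro integrable_mult_right integrable_lborel_pair_mult assms)
  show "(\<lambda>(x, y). K x y * f x * g y) \<in> borel_measurable lborel"
  proof -
    have [measurable]: "(\<lambda>p. K (fst p) (snd p)) \<in> borel_measurable (borel \<Otimes>\<^sub>M borel)"
      using assms(3) by (simp add: split_beta' borel_prod)
    show ?thesis by (simp add: borel_prod[symmetric] split_beta')
  qed
  have "0 \<le> C" using K[of undefined undefined] norm_ge_zero order_trans by blast
  then show "AE p in lborel. norm (case p of (x, y) \<Rightarrow> K x y * f x * g y) 
      \<le> norm (complex_of_real C * (case p of (x, y) \<Rightarrow> f x * g y))"
    using K by (intro always_eventually) (auto simp: norm_mult mult.assoc intro!: mult_right_mono)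
qed

section \<open>Gaussians\<close>

lemma normal_density_char:
  assumes \<sigma>: "\<sigma> > 0"
  shows "integrable lborel (\<lambda>x. complex_of_real (normal_density 0 \<sigma> x) * exp (\<i> * of_real (t * x)))"
    and "(LBINT x. complex_of_real (normal_density 0 \<sigma> x) * exp (\<i> * of_real (t * x)))
      = exp (- of_real ((\<sigma> * t)\<^sup>2 / 2))"
proof -
  have int: "integrable lborel (\<lambda>x. complex_of_real (normal_density 0 \<sigma> x) * exp (\<i> * of_real (t * x)))"
    if "\<sigma> > 0" for \<sigma> t :: real
    by (rule integrable_dominated[OF integrable_normal_density[OF that, of 0]])
       (auto simp: norm_mult)
  show "integrable lborel (\<lambda>x. complex_of_real (normal_density 0 \<sigma> x) * exp (\<i> * of_real (t * x)))"
    by (rule int[OF \<sigma>])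
  have "(LBINT x. complex_of_real (normal_density 0 \<sigma> x) * exp (\<i> * of_real (t * x)))
    = \<bar>\<sigma>\<bar> *\<^sub>R (LBINT x. complex_of_real (normal_density 0 \<sigma> (0 + \<sigma> * x)) * exp (\<i> * of_real (t * (0 + \<sigma> * x))))"
    using \<sigma> by (intro lborel_integral_real_affine) auto
  also have "\<dots> = (LBINT x. complex_of_real (std_normal_density x) * exp (\<i> * of_real ((\<sigma> * t) * x)))"
    using \<sigma> unfolding integral_scaleR_right[symmetric]
    by (intro integral_eqI)
       (simp add: normal_density_def real_sqrt_mult power_mult_distrib scaleR_conv_of_real field_simps)
  also have "\<dots> = char std_normal_distribution (\<sigma> * t)"
    unfolding char_def by (subst integral_density) (auto simp: scaleR_conv_of_real)
  also have "\<dots> = exp (- of_real ((\<sigma> * t)\<^sup>2 / 2))"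
    unfolding char_std_normal_distribution by (simp add: exp_of_real[symmetric])
  finally show "(LBINT x. complex_of_real (normal_density 0 \<sigma> x) * exp (\<i> * of_real (t * x)))
      = exp (- of_real ((\<sigma> * t)\<^sup>2 / 2))" .
qed

lemma norm_sq_Basis: "(norm (z::'a::euclidean_space))\<^sup>2 = (\<Sum>b\<in>Basis. (z \<bullet> b)\<^sup>2)"
  unfolding power2_norm_eq_inner by (subst euclidean_inner) (simp add: power2_eq_square)

definition gauss :: "real \<Rightarrow> 'a::euclidean_space \<Rightarrow> real" where
  "gauss \<sigma> z = (\<Prod>b\<in>Basis. normal_density 0 \<sigma> (z \<bullet> b))"

lemma gauss_eq: "gauss \<sigma> (z::'a::euclidean_space) = (1 / sqrt (2 * pi * \<sigma>\<^sup>2)) ^ DIM('a) * exp (- (norm z)\<^sup>2 / (2 * \<sigma>\<^sup>2))"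
proof -
  show ?thesis
    by (simp add: norm_sq_Basis gauss_def normal_density_def prod.distrib prod_dividef power_one_over exp_sum[symmetric] 
        sum_negf[symmetric] sum_divide_distrib)
qed

lemma continuous_on_gauss [continuous_intros]:
  "continuous_on S f \<Longrightarrow> continuous_on S (\<lambda>x. gauss \<sigma> (f x))"
  unfolding gauss_eq divide_inverse by (intro continuous_intros) 

lemma borel_measurable_gauss [measurable]: "gauss \<sigma> \<in> borel_measurable borel"
  by (intro borel_measurable_continuous_onI continuous_intros)

lemma gauss_nonneg [simp]: "0 \<le> gauss \<sigma> z"
  unfolding gauss_def by (intro prod_nonneg) auto

lemma integrable_gauss:
  assumes "\<sigma> > 0" shows "integrable lborel (gauss \<sigma>)"
  unfolding gauss_def[abs_def] using integrable_prod_Basis(1)[of "\<lambda>_. normal_density 0 \<sigma>"] assms by simp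

lemma integral_gauss:
  assumes "\<sigma> > 0" shows "(LBINT z. gauss \<sigma> z) = 1"
  unfolding gauss_def[abs_def] using integrable_prod_Basis(2)[of "\<lambda>_. normal_density 0 \<sigma>"] assms by simp

lemma nn_integral_gauss:
  assumes "\<sigma> > 0" shows "(\<integral>\<^sup>+z. ennreal (gauss \<sigma> z) \<partial>lborel) = 1"
  by (subst nn_integral_eq_integral) (auto simp: integrable_gauss integral_gauss assms)

lemma integrable_of_real_gauss:
  assumes "\<sigma> > 0" shows "integrable lborel (\<lambda>z. complex_of_real (gauss \<sigma> z))"
  by (intro integrable_of_real integrable_gauss assms)

lemma gauss_char:
  fixes y :: "'a::euclidean_space"
  assumes "\<sigma> > 0"
  shows "integrable lborel (\<lambda>z. complex_of_real (gauss \<sigma> z) * exp (\<i> * of_real (y \<bullet> z)))"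
    and "(LBINT z. complex_of_real (gauss \<sigma> z) * exp (\<i> * of_real (y \<bullet> z)))
      = exp (- of_real (\<sigma>\<^sup>2 * (norm y)\<^sup>2 / 2))"
proof -
  let ?f = "\<lambda>b x. complex_of_real (normal_density 0 \<sigma> x) * exp (\<i> * of_real ((y \<bullet> b) * x))"
  have eq: "complex_of_real (gauss \<sigma> z) * exp (\<i> * of_real (y \<bullet> z)) = (\<Prod>b\<in>Basis. ?f b (z \<bullet> b))" for z
    by (simp add: gauss_def prod.distrib exp_sum[symmetric] euclidean_inner[of y z] sum_distrib_left)
  show "integrable lborel (\<lambda>z. complex_of_real (gauss \<sigma> z) * exp (\<i> * of_real (y \<bullet> z)))"
    unfolding eq by (rule integrable_prod_Basis(1)[OF normal_density_char(1)[OF assms]])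
  show "(LBINT z. complex_of_real (gauss \<sigma> z) * exp (\<i> * of_real (y \<bullet> z)))
      = exp (- of_real (\<sigma>\<^sup>2 * (norm y)\<^sup>2 / 2))"
    unfolding eq
    unfolding integrable_prod_Basis(2)[OF normal_density_char(1)[OF assms]] normal_density_char(2)[OF assms]
    by (simp add: exp_sum[symmetric] norm_sq_Basis power_mult_distrib sum_distrib_left sum_divide_distrib sum_negf)
qed

lemma integrable_gauss_moment:
  fixes b :: "'a::euclidean_space"
  assumes "b \<in> Basis" 
  shows "integrable lborel (\<lambda>z. (z \<bullet> b) * gauss 1 z)"
proof -
  have "(z \<bullet> b) * gauss 1 z = (\<Prod>c\<in>Basis. (if c = b then \<lambda>x. std_normal_density x * x ^ 1 else std_normal_density) (z \<bullet> c))" for z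
  proof -
    have "(\<Prod>c\<in>Basis. (if c = b then \<lambda>x. std_normal_density x * x ^ 1 else std_normal_density) (z \<bullet> c))
      = (\<Prod>c\<in>Basis. std_normal_density (z \<bullet> c) * (if c = b then z \<bullet> b else 1))"
      by (intro prod.cong) auto
    then show ?thesis using assms by (simp add: prod.distrib gauss_def)
  qed
  then show ?thesis
    using integrable_prod_Basis(1)[of "\<lambda>c. if c = b then \<lambda>x. std_normal_density x * x ^ 1 else std_normal_density"]
      integrable_std_normal_moment[of 1]
    by (simp add: integrable_std_normal_moment split: if_splits)
qed

section \<open>Partial derivatives and integration by parts\<close>

definition has_partial :: "'a::euclidean_space \<Rightarrow> ('a \<Rightarrow> complex) \<Rightarrow> ('a \<Rightarrow> complex) \<Rightarrow> bool" where
  "has_partial b G G' \<longleftrightarrow> (\<forall>p. ((\<lambda>t::real. G (p + t *\<^sub>R b)) has_vector_derivative G' p) (at 0))"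

lemma has_partial_line:
  assumes "has_partial b G G'"
  shows "((\<lambda>t. G (p + (t * c) *\<^sub>R b)) has_vector_derivative c *\<^sub>R G' (p + (t * c) *\<^sub>R b)) (at t within S)"
proof -
  have "((\<lambda>s. G ((p + (t * c) *\<^sub>R b) + s *\<^sub>R b)) has_vector_derivative G' (p + (t * c) *\<^sub>R b)) (at 0)"
    using assms unfolding has_partial_def by blast
  moreover have "((\<lambda>r. (r - t) * c) has_vector_derivative c) (at t within S)"
    by (auto intro!: derivative_eq_intros)
  ultimately have "((\<lambda>s. G ((p + (t * c) *\<^sub>R b) + s *\<^sub>R b)) \<circ> (\<lambda>r. (r - t) * c) has_vector_derivative c *\<^sub>R G' (p + (t * c) *\<^sub>R b)) (at t within S)"
    by (intro vector_diff_chain_within) (auto intro: has_vector_derivative_at_within)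
  moreover have "p + (t * c) *\<^sub>R b + ((r - t) * c) *\<^sub>R b = p + (r * c) *\<^sub>R b" for r
    by (simp add: algebra_simps)
  ultimately show ?thesis
    by (simp add: o_def)
qed

lemma has_partial_FTC:
  assumes "has_partial b G G'" "continuous_on UNIV G'" "0 \<le> r"
  shows "(LBINT t. indicator {0..r} t *\<^sub>R (c *\<^sub>R G' (p + (t * c) *\<^sub>R b))) = G (p + (r * c) *\<^sub>R b) - G p"
proof -
  have "(LBINT t. indicator {0..r} t *\<^sub>R (c *\<^sub>R G' (p + (t * c) *\<^sub>R b))) = G (p + (r * c) *\<^sub>R b) - G (p + (0 * c) *\<^sub>R b)"
  proof (rule integral_FTC_atLeastAtMost[OF assms(3)])
    show "((\<lambda>t. G (p + (t * c) *\<^sub>R b)) has_vector_derivative c *\<^sub>R G' (p + (x * c) *\<^sub>R b)) (at x within {0..r})" for x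
      by (rule has_partial_line[OF assms(1)])
    show "continuous_on {0..r} (\<lambda>t. c *\<^sub>R G' (p + (t * c) *\<^sub>R b))"
      by (rule continuous_on_scaleR[OF continuous_on_const continuous_on_compose2[OF assms(2)]])
         (auto intro!: continuous_intros)
  qed
  then show ?thesis by simp
qed

lemma borel_measurable_of_real_indicator_fst:
  "(\<lambda>p::real \<times> 'a::euclidean_space. complex_of_real (indicator {a..b} (fst p))) \<in> borel_measurable borel"
proof -
  have "(indicator {a..b} :: real \<Rightarrow> real) \<in> borel_measurable borel"
    by (rule borel_measurable_indicator) simp
  then have "(\<lambda>t. complex_of_real (indicator {a..b} t)) \<in> borel_measurable borel"
    by measurable
  then have "(\<lambda>p::real \<times> 'a. complex_of_real (indicator {a..b} (fst p))) \<in> borel_measurable (borel \<Otimes>\<^sub>M borel)"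
    by (rule measurable_compose[OF measurable_fst])
  then show ?thesis by (simp only: borel_prod)
qed

text \<open>
  The integral of \<open>f (x + b) - f x\<close> vanishes by translation invariance. Writing the difference as the
  integral of \<open>f'\<close> over the segment and exchanging the integrals gives the integral of \<open>f'\<close>.
\<close>

lemma integral_partial_eq_0:
  fixes f :: "'a::euclidean_space \<Rightarrow> complex"
  assumes f: "has_partial b f f'" "integrable lborel f" "integrable lborel f'" "continuous_on UNIV f'"
  shows "(LBINT x. f' x) = 0"
proof -
  have [measurable]: "f' \<in> borel_measurable borel" using borel_measurable_integrable[OF f(3)] by simp
  let ?K = "\<lambda>(t::real) (x::'a). complex_of_real (indicator {0..1} t) * f' (x + t *\<^sub>R b)"
  have int: "integrable lborel (\<lambda>(t, x). ?K t x)"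
  proof (rule integrable_lborel_pairI)
    show "(\<lambda>(t, x). ?K t x) \<in> borel_measurable borel"
      unfolding split_beta'
    proof (rule borel_measurable_times[OF borel_measurable_of_real_indicator_fst borel_measurable_continuous_onI])
      show "continuous_on UNIV (\<lambda>p::real \<times> 'a. f' (snd p + fst p *\<^sub>R b))"
        by (rule continuous_on_compose2[OF f(4)]) (auto intro!: continuous_intros)
    qed
    have "(\<integral>\<^sup>+t. \<integral>\<^sup>+x. ennreal (norm (?K t x)) \<partial>lborel \<partial>lborel) 
      = (\<integral>\<^sup>+t. indicator {0..1::real} t * (\<integral>\<^sup>+x. ennreal (norm (f' x)) \<partial>lborel) \<partial>lborel)"
    proof (rule nn_integral_cong)
      fix t :: real
      have "(\<integral>\<^sup>+x. ennreal (norm (?K t x)) \<partial>lborel) = (\<integral>\<^sup>+x. indicator {0..1::real} t * ennreal (norm (f' (x + t *\<^sub>R b))) \<partial>lborel)"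
        by (intro nn_integral_cong) (simp add: indicator_def)
      also have "\<dots> = indicator {0..1::real} t * (\<integral>\<^sup>+x. ennreal (norm (f' (x + t *\<^sub>R b))) \<partial>lborel)"
        by (rule nn_integral_cmult) measurable
      also have "(\<integral>\<^sup>+x. ennreal (norm (f' (x + t *\<^sub>R b))) \<partial>lborel) = (\<integral>\<^sup>+x. ennreal (norm (f' x)) \<partial>lborel)"
        by (rule nn_integral_translate(1)[of "\<lambda>x. ennreal (norm (f' x))"]) measurable
      finally show "(\<integral>\<^sup>+x. ennreal (norm (?K t x)) \<partial>lborel) = indicator {0..1::real} t * (\<integral>\<^sup>+x. ennreal (norm (f' x)) \<partial>lborel)" .
    qed
    also have "\<dots> < \<infinity>"
      using f(3) by (simp add: nn_integral_multc integrable_iff_bounded)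
    finally show "(\<integral>\<^sup>+t. \<integral>\<^sup>+x. ennreal (norm (?K t x)) \<partial>lborel \<partial>lborel) < \<infinity>" .
  qed
  have "(LBINT x. LBINT t. ?K t x) = (LBINT x. f (x + b) - f x)"
    using has_partial_FTC[OF f(1,4), of 1 1]
    by (intro integral_eqI) (simp add: scaleR_conv_of_real)
  also have "\<dots> = 0"
    using integrable_translate(1)[OF f(2), of b] integral_translate(1)[OF f(2), of b] f(2) by simp
  finally have "(LBINT t. LBINT x. ?K t x) = 0"
    unfolding lborel_Fubini(1)[OF int] .
  moreover have "(LBINT t. LBINT x. ?K t x) = (LBINT t. indicator {0..1::real} t *\<^sub>R (LBINT x. f' x))"
    using integral_translate(1)[OF f(3)]
    by (intro integral_eqI) (simp add: scaleR_conv_of_real)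
  moreover have "\<dots> = (LBINT x. f' x)" by simp
  ultimately show ?thesis by simp
qed

section \<open>The heat flow in one direction\<close>

text \<open>
  The family \<open>\<sigma>\<close> is indexed by the coordinate directions, so that one standard deviation can be
  changed while the others stay fixed; the value \<open>0\<close> means no averaging in that direction.
\<close>

definition stretch :: "('a::euclidean_space \<Rightarrow> real) \<Rightarrow> 'a \<Rightarrow> 'a" where
  "stretch \<sigma> z = (\<Sum>b\<in>Basis. (\<sigma> b * (z \<bullet> b)) *\<^sub>R b)"

text \<open>
  Solution of the heat equation with initial value \<open>G\<close>, at time \<open>(\<sigma> b)\<^sup>2 / 2\<close> in the direction \<open>b\<close>:
  the mean of \<open>G\<close> over a Gaussian centred at \<open>x\<close>. The integral is written over the standard Gaussian in order
  that \<open>\<sigma> b = 0\<close> makes sense.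
\<close>

definition heat :: "('a::euclidean_space \<Rightarrow> real) \<Rightarrow> ('a \<Rightarrow> complex) \<Rightarrow> 'a \<Rightarrow> complex" where
  "heat \<sigma> G x = (LBINT z. complex_of_real (gauss 1 z) * G (x + stretch \<sigma> z))"

lemma continuous_on_stretch [continuous_intros]:
  "continuous_on S f \<Longrightarrow> continuous_on S (\<lambda>x. stretch \<sigma> (f x))"
  unfolding stretch_def by (intro continuous_intros)

lemma inner_stretch: "stretch c w \<bullet> y = w \<bullet> stretch c y"
  unfolding stretch_def inner_sum_left inner_sum_right by (intro sum.cong) (auto simp: inner_commute)

lemma inner_stretch_Basis: "b \<in> Basis \<Longrightarrow> stretch c w \<bullet> b = c b * (w \<bullet> b)"
  unfolding stretch_def by simp

lemma stretch_upd:
  fixes z :: "'a::euclidean_space"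
  assumes "b \<in> Basis"
  shows "stretch (\<sigma>(b := r)) z = stretch (\<sigma>(b := 0)) z + (r * (z \<bullet> b)) *\<^sub>R b"
proof (rule euclidean_eqI)
  fix c :: 'a assume "c \<in> Basis"
  then show "stretch (\<sigma>(b := r)) z \<bullet> c = (stretch (\<sigma>(b := 0)) z + (r * (z \<bullet> b)) *\<^sub>R b) \<bullet> c"
    using assms by (auto simp: inner_stretch_Basis inner_add_left inner_Basis)
qed

lemma stretch_add_Basis:
  fixes z :: "'a::euclidean_space"
  assumes "b \<in> Basis"
  shows "stretch \<sigma> (z + t *\<^sub>R b) = stretch \<sigma> z + (t * \<sigma> b) *\<^sub>R b"
proof (rule euclidean_eqI)
  fix c :: 'a assume "c \<in> Basis"
  then show "stretch \<sigma> (z + t *\<^sub>R b) \<bullet> c = (stretch \<sigma> z + (t * \<sigma> b) *\<^sub>R b) \<bullet> c"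
    using assms by (auto simp: inner_stretch_Basis inner_add_left inner_Basis algebra_simps)
qed

lemma has_partial_gauss:
  fixes b :: "'a::euclidean_space"
  assumes "b \<in> Basis"
  shows "has_partial b (\<lambda>z. complex_of_real (gauss 1 z)) (\<lambda>z. - of_real ((z \<bullet> b) * gauss 1 z))"
  unfolding has_partial_def
proof
  fix p :: 'a
  let ?c = "(1 / sqrt (2 * pi)) ^ DIM('a)"
  have eq: "gauss 1 (p + t *\<^sub>R b) = ?c * exp (- ((norm p)\<^sup>2 + 2 * t * (p \<bullet> b) + t\<^sup>2) / 2)" for t
  proof -
    have "(norm (p + t *\<^sub>R b))\<^sup>2 = (norm p)\<^sup>2 + 2 * t * (p \<bullet> b) + t\<^sup>2"
      using assms by (simp add: power2_norm_eq_inner inner_add_left inner_add_right inner_commute[of b p] 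
          power2_eq_square[of t] distrib_left)
    then show ?thesis by (simp add: gauss_eq)
  qed
  have "((\<lambda>t. gauss 1 (p + t *\<^sub>R b)) has_real_derivative - (p \<bullet> b) * gauss 1 p) (at 0)"
    unfolding eq by (auto intro!: derivative_eq_intros simp: gauss_eq)
  then have "((\<lambda>t. complex_of_real (gauss 1 (p + t *\<^sub>R b))) has_vector_derivative of_real (- (p \<bullet> b) * gauss 1 p)) (at 0)"
    by (rule has_vector_derivative_of_real)
  then show "((\<lambda>t. complex_of_real (gauss 1 (p + t *\<^sub>R b))) has_vector_derivative - of_real ((p \<bullet> b) * gauss 1 p)) (at 0)"
    by simp
qed

lemma integrable_bounded_mult:
  fixes w :: "'a::euclidean_space \<Rightarrow> complex"
  assumes "integrable lborel w" "continuous_on UNIV K" "\<And>z. norm (K z) \<le> C"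
  shows "integrable lborel (\<lambda>z. w z * K z)"
proof (rule integrable_dominated)
  show "integrable lborel (\<lambda>z. complex_of_real C * w z)" using assms(1) by (rule integrable_mult_right)
  have "w \<in> borel_measurable borel" using borel_measurable_integrable[OF assms(1)] by simp
  moreover have "K \<in> borel_measurable borel" by (rule borel_measurable_continuous_onI[OF assms(2)])
  ultimately show "(\<lambda>z. w z * K z) \<in> borel_measurable lborel" by simp
  have "0 \<le> C" using order_trans[OF norm_ge_zero assms(3)] .
  then show "AE z in lborel. norm (w z * K z) \<le> norm (complex_of_real C * w z)"
    using assms(3) by (intro always_eventually) (auto simp: norm_mult mult.commute[of C] intro!: mult_left_mono)
qed

lemma integrable_gauss_moment_of_real:
  assumes "b \<in> Basis" 
  shows "integrable lborel (\<lambda>z. complex_of_real ((z \<bullet> b) * gauss 1 z))"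
  by (intro integrable_of_real integrable_gauss_moment assms)

text \<open>
  Multiplying the Gaussian by a coordinate is, up to sign, differentiating it; integration by parts moves
  the derivative to \<open>G\<close>, where the chain rule produces the factor \<open>\<sigma> b\<close>.
\<close>

lemma gauss_parts:
  fixes b :: "'a::euclidean_space"
  assumes b: "b \<in> Basis" and G: "has_partial b G G'" "continuous_on UNIV G" "continuous_on UNIV G'"
    "\<And>x. norm (G x) \<le> C" "\<And>x. norm (G' x) \<le> C'"
  shows "(LBINT z. of_real ((z \<bullet> b) * gauss 1 z) * G (x + stretch \<sigma> z)) = of_real (\<sigma> b) * heat \<sigma> G' x"
proof -
  let ?g = "\<lambda>z. complex_of_real (gauss 1 z)" and ?m = "\<lambda>z. complex_of_real ((z \<bullet> b) * gauss 1 z)"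
  have cG: "continuous_on UNIV (\<lambda>z. G (x + stretch \<sigma> z))" "continuous_on UNIV (\<lambda>z. G' (x + stretch \<sigma> z))"
    by (rule continuous_on_compose2[OF G(2)] continuous_on_compose2[OF G(3)], intro continuous_intros, simp)+
  have iG: "integrable lborel (\<lambda>z. ?m z * G (x + stretch \<sigma> z))" "integrable lborel (\<lambda>z. ?g z * G (x + stretch \<sigma> z))"
     "integrable lborel (\<lambda>z. ?g z * G' (x + stretch \<sigma> z))"
    using integrable_bounded_mult[OF integrable_gauss_moment_of_real[OF b] cG(1) G(4)]
        integrable_bounded_mult[OF integrable_of_real_gauss[of 1] cG(1) G(4)]
        integrable_bounded_mult[OF integrable_of_real_gauss[of 1] cG(2) G(5)] by simp_all
  let ?f' = "\<lambda>z. - (?m z * G (x + stretch \<sigma> z)) + of_real (\<sigma> b) * (?g z * G' (x + stretch \<sigma> z))"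
  have "(LBINT z. ?f' z) = 0"
  proof (rule integral_partial_eq_0)
    show "has_partial b (\<lambda>z. ?g z * G (x + stretch \<sigma> z)) ?f'"
      unfolding has_partial_def
    proof
      fix p
      have "((\<lambda>t. G ((x + stretch \<sigma> p) + (t * \<sigma> b) *\<^sub>R b)) has_vector_derivative \<sigma> b *\<^sub>R G' ((x + stretch \<sigma> p) + (0 * \<sigma> b) *\<^sub>R b)) (at 0)"
        by (rule has_partial_line[OF G(1)])
      then have 1: "((\<lambda>t. G (x + stretch \<sigma> (p + t *\<^sub>R b))) has_vector_derivative \<sigma> b *\<^sub>R G' (x + stretch \<sigma> p)) (at 0)"
        by (simp add: stretch_add_Basis[OF b] add.assoc)
      have 2: "((\<lambda>t. ?g (p + t *\<^sub>R b)) has_vector_derivative - ?m p) (at 0)"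
        using has_partial_gauss[OF b] unfolding has_partial_def by blast
      show "((\<lambda>t. ?g (p + t *\<^sub>R b) * G (x + stretch \<sigma> (p + t *\<^sub>R b))) has_vector_derivative ?f' p) (at 0)"
        using has_vector_derivative_mult[OF 2 1] by (simp add: scaleR_conv_of_real algebra_simps)
    qed
    show "integrable lborel (\<lambda>z. ?g z * G (x + stretch \<sigma> z))" by (rule iG)
    show "integrable lborel ?f'"
      by (intro Bochner_Integration.integrable_add integrable_minus integrable_mult_right iG)
    show "continuous_on UNIV ?f'"
      by (intro continuous_intros cG)
  qed
  moreover have "(LBINT z. ?f' z) = - (LBINT z. ?m z * G (x + stretch \<sigma> z)) + of_real (\<sigma> b) * heat \<sigma> G' x"
    unfolding heat_def integral_minus[symmetric] integral_mult_right_zero[symmetric]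
    by (intro Bochner_Integration.integral_add integrable_minus integrable_mult_right iG)
  ultimately show ?thesis by (simp add: algebra_simps)
qed

lemma norm_gauss_mean_le:
  fixes K :: "'a::euclidean_space \<Rightarrow> complex"
  assumes s: "s > 0" and K: "\<And>z. norm (K z) \<le> C"
  shows "norm (LBINT z. of_real (gauss s z) * K z) \<le> C"
proof -
  have "norm (LBINT z. of_real (gauss s z) * K z) \<le> (LBINT z. norm (of_real (gauss s z) * K z))"
    by (rule integral_norm_bound)
  also have "\<dots> \<le> (LBINT z. gauss s (z::'a) * C)"
  proof (rule integral_mono_AE')
    show "integrable lborel (\<lambda>z::'a. gauss s z * C)"
      by (intro integrable_mult_left integrable_gauss s)
    show "AE z in lborel. 0 \<le> gauss s (z::'a) * C"
      using order_trans[OF norm_ge_zero K] by simp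
  qed (auto simp: norm_mult intro!: mult_left_mono K always_eventually)
  also have "\<dots> = C" by (simp add: integral_gauss[OF s])
  finally show ?thesis .
qed

lemma norm_heat_le:
  fixes G :: "'a::euclidean_space \<Rightarrow> complex"
  assumes "\<And>x. norm (G x) \<le> C"
  shows "norm (heat \<sigma> G x) \<le> C"
  unfolding heat_def by (rule norm_gauss_mean_le) (simp_all add: assms)

lemma borel_measurable_pair_lborel:
  fixes f :: "'a::euclidean_space \<times> 'b::euclidean_space \<Rightarrow> 'c::topological_space"
  shows "f \<in> borel_measurable (borel \<Otimes>\<^sub>M lborel) \<longleftrightarrow> f \<in> borel_measurable borel"
  unfolding borel_prod[symmetric]
  by (intro arg_cong2[of _ _ _ _ "(\<in>)"] measurable_cong_sets sets_pair_measure_cong) simp_all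

lemma borel_measurable_heat_upd:
  fixes b :: "'a::euclidean_space"
  assumes b: "b \<in> Basis" and G: "continuous_on UNIV G"
  shows "(\<lambda>p. heat (\<sigma>(b := fst p)) G (snd p)) \<in> borel_measurable borel"
proof -
  have c: "continuous_on UNIV (\<lambda>q::(real \<times> 'a) \<times> 'a. G (snd (fst q) + (stretch (\<sigma>(b := 0)) (snd q) + (fst (fst q) * (snd q \<bullet> b)) *\<^sub>R b)))"
    by (rule continuous_on_compose2[OF G], intro continuous_intros) auto
  have "(\<lambda>q::(real \<times> 'a) \<times> 'a. complex_of_real (gauss 1 (snd q)) * G (snd (fst q) + (stretch (\<sigma>(b := 0)) (snd q) + (fst (fst q) * (snd q \<bullet> b)) *\<^sub>R b)))
    \<in> borel_measurable borel"
    by (rule borel_measurable_continuous_onI) (intro continuous_intros c)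
  then have "(\<lambda>(p, z). complex_of_real (gauss 1 z) * G (snd p + stretch (\<sigma>(b := fst p)) z)) \<in> borel_measurable (borel \<Otimes>\<^sub>M lborel)"
    by (subst stretch_upd[OF b]) (simp add: split_beta' borel_measurable_pair_lborel)
  then show ?thesis
    unfolding heat_def by (rule lborel.borel_measurable_lebesgue_integral)
qed

lemma borel_measurable_heat:
  fixes G :: "'a::euclidean_space \<Rightarrow> complex"
  assumes G: "continuous_on UNIV G"
  shows "heat \<sigma> G \<in> borel_measurable borel"
proof -
  obtain b :: 'a where b: "b \<in> Basis" using nonempty_Basis by blast
  have "(\<lambda>x. (\<sigma> b, x)) \<in> borel \<rightarrow>\<^sub>M borel" by (intro borel_measurable_continuous_onI continuous_intros)
  from measurable_compose[OF this borel_measurable_heat_upd[OF b G, of \<sigma>]] show ?thesis by simp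
qed

text \<open>
  The derivative of the average in \<open>r\<close> contains \<open>z \<bullet> b\<close> and the first derivative of \<open>G\<close>; a Gaussian integration by
  parts turns this into \<open>r\<close> times the average of the second derivative. This is the heat equation, in
  integrated form. Parametrising by the standard deviation rather than by time puts the factor \<open>r\<close> in the
  integrand, which later cancels a singularity \<open>1 / r\<close>.
\<close>

lemma heat_diff:
  fixes b :: "'a::euclidean_space"
  assumes b: "b \<in> Basis" and G: "has_partial b G G1" "has_partial b G1 G2" 
    "continuous_on UNIV G" "continuous_on UNIV G1" "continuous_on UNIV G2"
    "\<And>x. norm (G x) \<le> C" "\<And>x. norm (G1 x) \<le> C1" "\<And>x. norm (G2 x) \<le> C2"
    and s: "0 \<le> s"
  shows "heat (\<sigma>(b := s)) G x - heat (\<sigma>(b := 0)) G x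
    = (LBINT r. complex_of_real (indicator {0..s} r) * (of_real r * heat (\<sigma>(b := r)) G2 x))"
proof -
  let ?g = "\<lambda>z. complex_of_real (gauss 1 z)" and ?m = "\<lambda>z. complex_of_real ((z \<bullet> b) * gauss 1 z)"
  let ?I = "\<lambda>r. complex_of_real (indicator {0..s} r)"
  have c: "continuous_on UNIV (\<lambda>z. H (x + stretch \<sigma> z))" if "continuous_on UNIV H" for H :: "'a \<Rightarrow> complex" and \<sigma>
    by (rule continuous_on_compose2[OF that], intro continuous_intros, simp)
  have i: "integrable lborel (\<lambda>z. ?g z * G (x + stretch \<sigma> z))" for \<sigma>
    using integrable_bounded_mult[OF integrable_of_real_gauss[of 1] c[OF G(3)] G(6)] by simp
  have "integrable lborel (\<lambda>(r, z). G1 (x + stretch (\<sigma>(b := r)) z) * ?I r * ?m z)"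
  proof (rule lborel_Fubini_bounded[OF _ integrable_gauss_moment_of_real[OF b]])
    show "integrable lborel ?I" by (intro integrable_of_real integrable_real_indicator) (simp_all add: emeasure_lborel_Icc_eq)
    show "(\<lambda>(r, z). G1 (x + stretch (\<sigma>(b := r)) z)) \<in> borel_measurable borel"
      unfolding split_beta' by (subst stretch_upd[OF b], rule borel_measurable_continuous_onI)
        (rule continuous_on_compose2[OF G(4)], intro continuous_intros, auto)
  qed (rule G(7))
  note F = lborel_Fubini[OF this]
  have "heat (\<sigma>(b := s)) G x - heat (\<sigma>(b := 0)) G x 
    = (LBINT z. ?g z * (G (x + stretch (\<sigma>(b := s)) z) - G (x + stretch (\<sigma>(b := 0)) z)))"
    unfolding heat_def by (simp only: right_diff_distrib Bochner_Integration.integral_diff[OF i i])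
  also have "\<dots> = (LBINT z. LBINT r. G1 (x + stretch (\<sigma>(b := r)) z) * ?I r * ?m z)"
  proof (rule integral_eqI)
    fix z :: 'a
    have FTC: "G (x + stretch (\<sigma>(b := s)) z) - G (x + stretch (\<sigma>(b := 0)) z)
      = (LBINT r. indicator {0..s} r *\<^sub>R ((z \<bullet> b) *\<^sub>R G1 (x + stretch (\<sigma>(b := 0)) z + (r * (z \<bullet> b)) *\<^sub>R b)))"
      using has_partial_FTC[OF G(1,4) s, of "z \<bullet> b" "x + stretch (\<sigma>(b := 0)) z"]
      by (subst stretch_upd[OF b]) (simp add: add.assoc)
    have "?g z * (G (x + stretch (\<sigma>(b := s)) z) - G (x + stretch (\<sigma>(b := 0)) z)) = (LBINT r. ?g z * (indicator {0..s} r *\<^sub>R ((z \<bullet> b) *\<^sub>R G1 (x + stretch (\<sigma>(b := 0)) z + (r * (z \<bullet> b)) *\<^sub>R b))))"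
      unfolding FTC by (rule integral_mult_right_zero[symmetric])
    also have "\<dots> = (LBINT r. G1 (x + stretch (\<sigma>(b := r)) z) * ?I r * ?m z)"
    proof (rule integral_eqI)
      fix r
      have "x + stretch (\<sigma>(b := r)) z = x + stretch (\<sigma>(b := 0)) z + (r * (z \<bullet> b)) *\<^sub>R b"
        by (subst stretch_upd[OF b]) (simp add: add.assoc)
      then show "?g z * (indicator {0..s} r *\<^sub>R ((z \<bullet> b) *\<^sub>R G1 (x + stretch (\<sigma>(b := 0)) z + (r * (z \<bullet> b)) *\<^sub>R b)))
        = G1 (x + stretch (\<sigma>(b := r)) z) * ?I r * ?m z"
        by (simp add: scaleR_conv_of_real add.assoc)
    qed
    finally show "?g z * (G (x + stretch (\<sigma>(b := s)) z) - G (x + stretch (\<sigma>(b := 0)) z))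
      = (LBINT r. G1 (x + stretch (\<sigma>(b := r)) z) * ?I r * ?m z)" .
  qed
  also have "\<dots> = (LBINT r. LBINT z. G1 (x + stretch (\<sigma>(b := r)) z) * ?I r * ?m z)"
    by (rule F(1)[symmetric])
  also have "\<dots> = (LBINT r. ?I r * (of_real r * heat (\<sigma>(b := r)) G2 x))"
  proof (rule integral_eqI)
    fix r
    have "(LBINT z. G1 (x + stretch (\<sigma>(b := r)) z) * ?I r * ?m z) = (LBINT z. ?I r * (?m z * G1 (x + stretch (\<sigma>(b := r)) z)))"
      by (simp only: ac_simps)
    also have "\<dots> = ?I r * (LBINT z. ?m z * G1 (x + stretch (\<sigma>(b := r)) z))"
      by (rule integral_mult_right_zero)
    also have "(LBINT z. ?m z * G1 (x + stretch (\<sigma>(b := r)) z)) = of_real r * heat (\<sigma>(b := r)) G2 x"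
      using gauss_parts[OF b G(2,4,5,7,8), where x=x and \<sigma>="\<sigma>(b := r)"] by simp
    finally show "(LBINT z. G1 (x + stretch (\<sigma>(b := r)) z) * ?I r * ?m z) = ?I r * (of_real r * heat (\<sigma>(b := r)) G2 x)" .
  qed
  finally show ?thesis .
qed

section \<open>Pairings with a smoothed symbol\<close>

text \<open>
  Symbols that can be differentiated twice along any subset of the directions in the list, each such direction
  \<open>b\<close> costing a factor \<open>(\<epsilon> b)\<^sup>2\<close> in the supremum. The recursion is the one that the
  induction over the coordinates needs. The first derivative enters in a Gaussian integration by
  parts, which asks for its boundedness.
\<close>

fun smooth_symbol :: "('a::euclidean_space \<Rightarrow> real) \<Rightarrow> 'a list \<Rightarrow> real \<Rightarrow> ('a \<Rightarrow> complex) \<Rightarrow> bool" where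
  "smooth_symbol \<epsilon> [] N G \<longleftrightarrow> continuous_on UNIV G \<and> (\<forall>x. norm (G x) \<le> N)"
| "smooth_symbol \<epsilon> (b # bs) N G \<longleftrightarrow> smooth_symbol \<epsilon> bs N G \<and>
    (\<exists>G1 G2. has_partial b G G1 \<and> has_partial b G1 G2 \<and> continuous_on UNIV G1 \<and> bounded (range G1) \<and>
      smooth_symbol \<epsilon> bs (N * (\<epsilon> b)\<^sup>2) G2)"

lemma smooth_symbolD:
  assumes "smooth_symbol \<epsilon> bs N G"
  shows "continuous_on UNIV G" "norm (G x) \<le> N"
  using assms by (induction bs) auto

definition smoothed_pairing :: "('a::euclidean_space \<Rightarrow> real) \<Rightarrow> ('a \<Rightarrow> complex) \<Rightarrow> ('a \<Rightarrow> complex) \<Rightarrow> complex" where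
  "smoothed_pairing \<sigma> G L = (LBINT x. heat \<sigma> G x * L x)"

lemma integrable_heat_mult:
  fixes L :: "'a::euclidean_space \<Rightarrow> complex"
  assumes L: "integrable lborel L" and G: "continuous_on UNIV G" "\<And>x. norm (G x) \<le> C"
  shows "integrable lborel (\<lambda>x. heat \<sigma> G x * L x)"
proof (rule integrable_dominated)
  show "integrable lborel (\<lambda>x. complex_of_real C * L x)" by (rule integrable_mult_right[OF L])
  show "(\<lambda>x. heat \<sigma> G x * L x) \<in> borel_measurable lborel"
    using borel_measurable_heat[OF G(1)] borel_measurable_integrable[OF L] by simp
  show "AE x in lborel. norm (heat \<sigma> G x * L x) \<le> norm (complex_of_real C * L x)"
    using norm_heat_le[OF G(2)] order_trans[OF norm_ge_zero G(2)] 
    by (intro always_eventually) (auto simp: norm_mult intro!: mult_right_mono)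
qed

text \<open>
  The heat equation paired with \<open>L\<close>. The bound is asked for \<open>r\<close> times the pairing, because
  the pairing itself is controlled by \<open>D / r\<close> only.
\<close>

lemma smoothed_pairing_diff:
  fixes b :: "'a::euclidean_space"
  assumes b: "b \<in> Basis" and G: "has_partial b G G1" "has_partial b G1 G2" 
    "continuous_on UNIV G" "continuous_on UNIV G1" "continuous_on UNIV G2"
    "\<And>x. norm (G x) \<le> C" "\<And>x. norm (G1 x) \<le> C1" "\<And>x. norm (G2 x) \<le> C2"
    and s: "0 \<le> s" and L: "integrable lborel L"
    and bound: "\<And>r. 0 < r \<Longrightarrow> r \<le> s \<Longrightarrow> r * norm (smoothed_pairing (\<sigma>(b := r)) G2 L) \<le> D" and D: "0 \<le> D"
  shows "norm (smoothed_pairing (\<sigma>(b := s)) G L - smoothed_pairing (\<sigma>(b := 0)) G L) \<le> s * D"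
proof -
  let ?I = "\<lambda>r. complex_of_real (indicator {0..s} r)"
  let ?Ir = "\<lambda>r. complex_of_real (r * indicator {0..s} r)"
  let ?h = "\<lambda>r x. heat (\<sigma>(b := r)) G2 x"
  have "integrable lborel (\<lambda>r::real. indicator {0..s} r *\<^sub>R r)"
    by (rule borel_integrable_compact) (auto intro: continuous_intros)
  then have "integrable lborel ?Ir" by (intro integrable_of_real) (simp add: mult.commute)
  then have "integrable lborel (\<lambda>(r, x). ?h r x * ?Ir r * L x)"
  proof (rule lborel_Fubini_bounded[OF _ L])
    show "(\<lambda>(r, x). ?h r x) \<in> borel_measurable borel"
      unfolding split_beta' by (rule borel_measurable_heat_upd[OF b G(5)])
    show "norm (?h r x) \<le> C2" for r x by (rule norm_heat_le[OF G(8)])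
  qed
  note F = lborel_Fubini[OF this]
  have "smoothed_pairing (\<sigma>(b := s)) G L - smoothed_pairing (\<sigma>(b := 0)) G L 
     = (LBINT x. heat (\<sigma>(b := s)) G x * L x - heat (\<sigma>(b := 0)) G x * L x)"
    unfolding smoothed_pairing_def
    by (rule Bochner_Integration.integral_diff[symmetric]) (rule integrable_heat_mult[OF L G(3,6)])+
  also have "\<dots> = (LBINT x. LBINT r. ?h r x * ?Ir r * L x)"
  proof (rule integral_eqI)
    fix x
    have "heat (\<sigma>(b := s)) G x * L x - heat (\<sigma>(b := 0)) G x * L x = (heat (\<sigma>(b := s)) G x - heat (\<sigma>(b := 0)) G x) * L x"
      by (simp add: left_diff_distrib)
    also have "\<dots> = (LBINT r. ?I r * (of_real r * ?h r x) * L x)"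
      unfolding heat_diff[OF b G s] by (rule integral_mult_left_zero[symmetric])
    also have "\<dots> = (LBINT r. ?h r x * ?Ir r * L x)"
      by (rule integral_eqI) simp
    finally show "heat (\<sigma>(b := s)) G x * L x - heat (\<sigma>(b := 0)) G x * L x = (LBINT r. ?h r x * ?Ir r * L x)" .
  qed
  also have "\<dots> = (LBINT r. LBINT x. ?h r x * ?Ir r * L x)" by (rule F(1)[symmetric])
  also have "\<dots> = (LBINT r. ?Ir r * smoothed_pairing (\<sigma>(b := r)) G2 L)"
  proof (rule integral_eqI)
    fix r
    have "(LBINT x. ?h r x * ?Ir r * L x) = (LBINT x. ?Ir r * (?h r x * L x))"
      by (simp only: ac_simps)
    also have "\<dots> = ?Ir r * smoothed_pairing (\<sigma>(b := r)) G2 L"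
      unfolding smoothed_pairing_def by (rule integral_mult_right_zero)
    finally show "(LBINT x. ?h r x * ?Ir r * L x) = ?Ir r * smoothed_pairing (\<sigma>(b := r)) G2 L" .
  qed
  finally have eq: "smoothed_pairing (\<sigma>(b := s)) G L - smoothed_pairing (\<sigma>(b := 0)) G L 
    = (LBINT r. ?Ir r * smoothed_pairing (\<sigma>(b := r)) G2 L)" .
  have "norm (LBINT r. ?Ir r * smoothed_pairing (\<sigma>(b := r)) G2 L)
    \<le> (LBINT r. norm (?Ir r * smoothed_pairing (\<sigma>(b := r)) G2 L))"
    by (rule integral_norm_bound)
  also have "\<dots> \<le> (LBINT r. indicator {0..s} r * D)"
  proof (rule integral_mono_AE')
    show "integrable lborel (\<lambda>r. indicator {0..s} r * D)"
      by (intro integrable_mult_left integrable_real_indicator) (simp_all add: emeasure_lborel_Icc_eq)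
    show "AE r in lborel. norm (?Ir r * smoothed_pairing (\<sigma>(b := r)) G2 L) \<le> indicator {0..s} r * D"
      using bound D by (intro always_eventually) (auto simp: norm_mult indicator_def abs_mult order.order_iff_strict[of 0])
    show "AE r in lborel. 0 \<le> indicator {0..s} r * D" using D by simp
  qed
  also have "\<dots> = s * D" using s by simp
  finally show ?thesis unfolding eq .
qed

section \<open>Narrow Gaussians as superpositions of modulated wide ones\<close>

text \<open>
  A quotient of centred Gaussians of widths \<open>\<sigma> b \<le> s\<close> is \<open>exp (- (c b * t)\<^sup>2 / 2)\<close> up to
  the factor \<open>s / \<sigma> b\<close>, and this is the characteristic function of a Gaussian. So the narrow
  Gaussian is \<open>s / \<sigma> b\<close> times a mean of modulated Gaussians of width \<open>s\<close>. The loss \<open>s / \<sigma> b\<close> is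
  compensated by the factor \<open>r\<close> in \<open>heat_diff\<close>.
\<close>

lemma heat_eq_mixture:
  fixes G :: "'a::euclidean_space \<Rightarrow> complex"
  assumes \<sigma>: "\<And>b. b \<in> Basis \<Longrightarrow> 0 < \<sigma> b \<and> \<sigma> b \<le> s" and G: "continuous_on UNIV G" "\<And>x. norm (G x) \<le> C"
  defines "c \<equiv> (\<lambda>b. sqrt (1 / (\<sigma> b)\<^sup>2 - 1 / s\<^sup>2))"
  shows "heat \<sigma> G x = of_real (\<Prod>b\<in>Basis. s / \<sigma> b) * 
    (LBINT y. of_real (gauss 1 y) * (LBINT w. of_real (gauss s w) * exp (\<i> * of_real (stretch c y \<bullet> w)) * G (x + w)))"
proof -
  obtain b0 :: 'a where "b0 \<in> Basis" using nonempty_Basis by blast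
  then have s: "s > 0" using \<sigma>[of b0] by auto
  let ?P = "\<Prod>b\<in>Basis. s / \<sigma> b"
  let ?f = "\<lambda>w::'a. complex_of_real (\<Prod>b\<in>Basis. normal_density 0 (\<sigma> b) (w \<bullet> b)) * G (x + w)"
  have st: "stretch \<sigma> z = 0 + (\<Sum>j\<in>Basis. (\<sigma> j * (z \<bullet> j)) *\<^sub>R j)" for z unfolding stretch_def by simp
  have cG: "continuous_on UNIV (\<lambda>w. G (x + w))"
    by (rule continuous_on_compose2[OF G(1)], intro continuous_intros, simp)
  have "integrable lborel (\<lambda>w::'a. complex_of_real (\<Prod>b\<in>Basis. normal_density 0 (\<sigma> b) (w \<bullet> b)))"
    using \<sigma> by (intro integrable_of_real integrable_prod_Basis integrable_normal_density) auto
  then have if': "integrable lborel ?f"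
    by (rule integrable_bounded_mult[OF _ cG G(2)])
  have nd: "\<sigma> b * normal_density 0 (\<sigma> b) (\<sigma> b * t) = normal_density 0 1 t" if "b \<in> Basis" for b t
    using \<sigma>[OF that] by (simp add: normal_density_def real_sqrt_mult power_mult_distrib field_simps)
  have "heat \<sigma> G x = (LBINT z. (\<Prod>j\<in>Basis. \<bar>\<sigma> j\<bar>) *\<^sub>R ?f (stretch \<sigma> z))"
    unfolding heat_def
  proof (rule integral_eqI)
    fix z :: 'a
    have "(\<Prod>j\<in>Basis. \<bar>\<sigma> j\<bar>) * (\<Prod>b\<in>Basis. normal_density 0 (\<sigma> b) (stretch \<sigma> z \<bullet> b)) = gauss 1 z"
      unfolding prod.distrib[symmetric] gauss_def
    proof (rule prod.cong[OF refl])
      fix b :: 'a assume "b \<in> Basis"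
      then show "\<bar>\<sigma> b\<bar> * normal_density 0 (\<sigma> b) (stretch \<sigma> z \<bullet> b) = normal_density 0 1 (z \<bullet> b)"
        using \<sigma>[of b] nd[of b "z \<bullet> b"] by (simp add: inner_stretch_Basis)
    qed
    then show "complex_of_real (gauss 1 z) * G (x + stretch \<sigma> z) = (\<Prod>j\<in>Basis. \<bar>\<sigma> j\<bar>) *\<^sub>R ?f (stretch \<sigma> z)"
      by (simp only: scaleR_conv_of_real of_real_mult[symmetric] mult.assoc[symmetric])
  qed
  also have "\<dots> = (LBINT w. ?f w)"
    unfolding st using integral_affine_euclidean(2)[OF if', of \<sigma> 0] \<sigma> by (simp add: order.strict_iff_order)
  also have "\<dots> = (LBINT w. of_real ?P * (LBINT y. exp (\<i> * of_real (stretch c y \<bullet> w)) * (of_real (gauss s w) * G (x + w)) * of_real (gauss 1 y)))"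
  proof (rule integral_eqI)
    fix w :: 'a
    have nd: "normal_density 0 (\<sigma> b) t = s / \<sigma> b * normal_density 0 s t * exp (- ((c b * t)\<^sup>2 / 2))" if "b \<in> Basis" for b t
    proof -
      have "(c b)\<^sup>2 = 1 / (\<sigma> b)\<^sup>2 - 1 / s\<^sup>2"
        unfolding c_def using \<sigma>[OF that] s by (intro real_sqrt_pow2) (simp add: field_simps power_mono)
      then have "- t\<^sup>2 / (2 * (\<sigma> b)\<^sup>2) = - t\<^sup>2 / (2 * s\<^sup>2) + - ((c b * t)\<^sup>2 / 2)"
        by (simp add: power_mult_distrib) (simp add: field_simps)
      then have "exp (- t\<^sup>2 / (2 * (\<sigma> b)\<^sup>2)) = exp (- t\<^sup>2 / (2 * s\<^sup>2)) * exp (- ((c b * t)\<^sup>2 / 2))"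
        by (simp only: exp_add)
      then show ?thesis
        unfolding normal_density_def using \<sigma>[OF that] s by (simp add: real_sqrt_mult field_simps)
    qed
    have "(\<Prod>b\<in>Basis. normal_density 0 (\<sigma> b) (w \<bullet> b)) = ?P * gauss s w * exp (- (norm (stretch c w))\<^sup>2 / 2)"
    proof -
      have "(\<Prod>b\<in>Basis. normal_density 0 (\<sigma> b) (w \<bullet> b)) 
        = (\<Prod>b\<in>Basis. s / \<sigma> b * normal_density 0 s (w \<bullet> b) * exp (- ((c b * (w \<bullet> b))\<^sup>2 / 2)))"
        by (intro prod.cong refl nd)
      also have "\<dots> = ?P * gauss s w * exp (\<Sum>b\<in>Basis. - ((c b * (w \<bullet> b))\<^sup>2 / 2))"
        unfolding prod.distrib gauss_def by (simp add: exp_sum)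
      also have "(\<Sum>b\<in>Basis. - ((c b * (w \<bullet> b))\<^sup>2 / 2)) = - (norm (stretch c w))\<^sup>2 / 2"
        by (simp add: norm_sq_Basis inner_stretch_Basis sum_divide_distrib sum_negf)
      finally show ?thesis .
    qed
    then have "?f w = of_real (?P * gauss s w) * G (x + w) * exp (- of_real (1\<^sup>2 * (norm (stretch c w))\<^sup>2 / 2))"
      by (simp add: exp_of_real[symmetric])
    also have "\<dots> = of_real (?P * gauss s w) * G (x + w) * (LBINT y. of_real (gauss 1 y) * exp (\<i> * of_real (stretch c w \<bullet> y)))"
      by (subst gauss_char(2)) simp_all
    also have "\<dots> = of_real ?P * (LBINT y. (of_real (gauss s w) * G (x + w)) * (of_real (gauss 1 y) * exp (\<i> * of_real (stretch c w \<bullet> y))))"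
      by (simp only: integral_mult_right_zero of_real_mult mult.assoc)
    finally show "?f w = of_real ?P * (LBINT y. exp (\<i> * of_real (stretch c y \<bullet> w)) * (of_real (gauss s w) * G (x + w)) * of_real (gauss 1 y))"
      by (simp only: inner_stretch inner_commute[of w] ac_simps)
  qed
  also have "\<dots> = of_real ?P * (LBINT w. LBINT y. exp (\<i> * of_real (stretch c y \<bullet> w)) * (of_real (gauss s w) * G (x + w)) * of_real (gauss 1 y))"
    by (rule integral_mult_right_zero)
  also have "(LBINT w. LBINT y. exp (\<i> * of_real (stretch c y \<bullet> w)) * (of_real (gauss s w) * G (x + w)) * of_real (gauss 1 y))
    = (LBINT y. LBINT w. exp (\<i> * of_real (stretch c y \<bullet> w)) * (of_real (gauss s w) * G (x + w)) * of_real (gauss 1 y))"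
  proof (rule lborel_Fubini(1)[OF lborel_Fubini_bounded])
    show "integrable lborel (\<lambda>w. of_real (gauss s w) * G (x + w))"
      by (rule integrable_bounded_mult[OF integrable_of_real_gauss[OF s] cG G(2)])
    show "integrable lborel (\<lambda>y::'a. complex_of_real (gauss 1 y))" by (rule integrable_of_real_gauss) simp
    show "(\<lambda>(w, y). exp (\<i> * complex_of_real (stretch c y \<bullet> w))) \<in> borel_measurable borel"
      unfolding split_beta' by (rule borel_measurable_continuous_onI) (intro continuous_intros)
    show "norm (exp (\<i> * complex_of_real (stretch c y \<bullet> w))) \<le> 1" for w y by simp
  qed
  also have "\<dots> = (LBINT y. of_real (gauss 1 y) * (LBINT w. of_real (gauss s w) * exp (\<i> * of_real (stretch c y \<bullet> w)) * G (x + w)))"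
    unfolding integral_mult_right_zero[symmetric] by (simp only: ac_simps)
  finally show ?thesis .
qed

text \<open>
  The Gaussian mean of \<open>G\<close> with an additional character. The parameter \<open>y\<close> will be integrated out, so estimates
  have to be uniform in it.
\<close>

definition modulated_average :: "real \<Rightarrow> 'a::euclidean_space \<Rightarrow> ('a \<Rightarrow> complex) \<Rightarrow> 'a \<Rightarrow> complex" where
  "modulated_average s y G x = (LBINT w. of_real (gauss s w) * exp (\<i> * of_real (y \<bullet> w)) * G (x + w))"

lemma norm_modulated_average_le:
  fixes G :: "'a::euclidean_space \<Rightarrow> complex"
  assumes "s > 0" "\<And>x. norm (G x) \<le> C"
  shows "norm (modulated_average s y G x) \<le> C"
  unfolding modulated_average_def mult.assoc by (rule norm_gauss_mean_le) (simp_all add: assms norm_mult)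

lemma smoothed_pairing_mixture_bound:
  fixes G L :: "'a::euclidean_space \<Rightarrow> complex"
  assumes \<sigma>: "\<And>b. b \<in> Basis \<Longrightarrow> 0 < \<sigma> b \<and> \<sigma> b \<le> s" and G: "continuous_on UNIV G" "\<And>x. norm (G x) \<le> C"
    and L: "integrable lborel L"
    and K: "\<And>y. norm (LBINT x. modulated_average s y G x * L x) \<le> K"
  shows "norm (smoothed_pairing \<sigma> G L) \<le> K * (\<Prod>b\<in>Basis. s / \<sigma> b)"
proof -
  obtain b0 :: 'a where "b0 \<in> Basis" using nonempty_Basis by blast
  then have s: "s > 0" using \<sigma>[of b0] by auto
  define c where "c = (\<lambda>b. sqrt (1 / (\<sigma> b)\<^sup>2 - 1 / s\<^sup>2))"
  let ?P = "\<Prod>b\<in>Basis. s / \<sigma> b"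
  have P: "?P > 0" using \<sigma> s by (intro prod_pos) auto
  let ?m = "\<lambda>y x. modulated_average s (stretch c y) G x"
  have "smoothed_pairing \<sigma> G L = (LBINT x. of_real ?P * (LBINT y. ?m y x * L x * of_real (gauss 1 y)))"
    unfolding smoothed_pairing_def
  proof (rule integral_eqI)
    fix x
    have "heat \<sigma> G x = of_real ?P * (LBINT y. of_real (gauss 1 y) * ?m y x)"
      unfolding modulated_average_def c_def by (rule heat_eq_mixture[OF \<sigma> G])
    then have "heat \<sigma> G x * L x = of_real ?P * ((LBINT y. of_real (gauss 1 y) * ?m y x) * L x)"
      by (simp only: mult.assoc)
    also have "(LBINT y. of_real (gauss 1 y) * ?m y x) * L x = (LBINT y. of_real (gauss 1 y) * ?m y x * L x)"
      by (rule integral_mult_left_zero[symmetric])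
    finally show "heat \<sigma> G x * L x = of_real ?P * (LBINT y. ?m y x * L x * of_real (gauss 1 y))"
      by (simp only: ac_simps)
  qed
  also have "\<dots> = of_real ?P * (LBINT x. LBINT y. ?m y x * L x * of_real (gauss 1 y))"
    by (rule integral_mult_right_zero)
  also have "(LBINT x. LBINT y. ?m y x * L x * of_real (gauss 1 y)) = (LBINT y. LBINT x. ?m y x * L x * of_real (gauss 1 y))"
  proof (rule lborel_Fubini(1)[OF lborel_Fubini_bounded[OF L]])
    show "integrable lborel (\<lambda>y::'a. complex_of_real (gauss 1 y))" by (rule integrable_of_real_gauss) simp
    show "norm (?m y x) \<le> C" for x y by (rule norm_modulated_average_le[OF s G(2)])
    have c: "continuous_on UNIV (\<lambda>q::('a \<times> 'a) \<times> 'a. G (fst (fst q) + snd q))"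
      by (rule continuous_on_compose2[OF G(1)], intro continuous_intros, simp)
    have "(\<lambda>q::('a \<times> 'a) \<times> 'a. complex_of_real (gauss s (snd q)) * exp (\<i> * of_real (stretch c (snd (fst q)) \<bullet> snd q)) * G (fst (fst q) + snd q))
      \<in> borel_measurable borel"
      by (rule borel_measurable_continuous_onI) (intro continuous_intros c)
    then have "(\<lambda>(p, w). complex_of_real (gauss s w) * exp (\<i> * of_real (stretch c (snd p) \<bullet> w)) * G (fst p + w)) \<in> borel_measurable (borel \<Otimes>\<^sub>M lborel)"
      by (simp add: split_beta' borel_measurable_pair_lborel)
    then show "(\<lambda>(x, y). ?m y x) \<in> borel_measurable borel"
      unfolding modulated_average_def split_beta' by (rule lborel.borel_measurable_lebesgue_integral[unfolded split_beta'])
  qed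
  also have "\<dots> = (LBINT y. (LBINT x. ?m y x * L x) * of_real (gauss 1 y))"
    by (simp only: integral_mult_left_zero)
  finally have eq: "smoothed_pairing \<sigma> G L = of_real ?P * (LBINT y. (LBINT x. ?m y x * L x) * of_real (gauss 1 y))" .
  have "norm (LBINT y. (LBINT x. ?m y x * L x) * of_real (gauss 1 y)) \<le> K"
    unfolding mult.commute[of _ "of_real _"] by (rule norm_gauss_mean_le) (simp_all add: K)
  then have "norm (complex_of_real ?P) * norm (LBINT y. (LBINT x. ?m y x * L x) * of_real (gauss 1 y)) \<le> ?P * K"
    using P unfolding norm_of_real by (intro mult_mono) auto
  then show ?thesis unfolding eq norm_mult by (simp only: mult.commute[of K])
qed

section \<open>Removing the smoothing coordinate by coordinate\<close>

text \<open>
  Induction over the list of the directions in which the averaging has been removed. If the first direction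
  \<open>b\<close> is still averaged with width \<open>r\<close>, the induction hypothesis has the factor \<open>s / r\<close>; it is used for \<open>G\<close>
  at \<open>r = s\<close>, where this factor is \<open>1\<close>, and for the second derivative at all \<open>r\<close> in between.
\<close>

lemma smoothed_pairing_bound:
  fixes L :: "'a::euclidean_space \<Rightarrow> complex"
  assumes s: "s > 0" and L: "integrable lborel L" and P: "0 \<le> P"
    and mod: "\<And>G N y. continuous_on UNIV G \<Longrightarrow> (\<And>x. norm (G x) \<le> N) \<Longrightarrow> 
      norm (LBINT x. modulated_average s y G x * L x) \<le> N * P"
  shows "distinct bs \<Longrightarrow> set bs \<subseteq> Basis \<Longrightarrow> smooth_symbol \<epsilon> bs N G \<Longrightarrow> (\<And>b. b \<in> set bs \<Longrightarrow> \<sigma> b = 0) \<Longrightarrow>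
    (\<And>b. b \<in> Basis - set bs \<Longrightarrow> 0 < \<sigma> b \<and> \<sigma> b \<le> s) \<Longrightarrow>
    norm (smoothed_pairing \<sigma> G L) \<le> N * P * (\<Prod>b\<in>set bs. 1 + s\<^sup>2 * (\<epsilon> b)\<^sup>2) * (\<Prod>b\<in>Basis - set bs. s / \<sigma> b)"
proof (induction bs arbitrary: N G \<sigma>)
  case Nil
  then show ?case
    using smoothed_pairing_mixture_bound[OF _ _ _ L mod, of \<sigma> G N N] by simp
next
  case (Cons b bs)
  have b: "b \<in> Basis" "b \<notin> set bs" using Cons.prems by auto
  from Cons.prems(3) obtain G1 G2 where sG: "smooth_symbol \<epsilon> bs N G"
    and G: "has_partial b G G1" "has_partial b G1 G2" "continuous_on UNIV G1" "bounded (range G1)"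
      "smooth_symbol \<epsilon> bs (N * (\<epsilon> b)\<^sup>2) G2" by auto
  from G(4) obtain C1 where C1: "\<And>x. norm (G1 x) \<le> C1" unfolding bounded_iff by auto
  let ?A = "\<Prod>b\<in>set bs. 1 + s\<^sup>2 * (\<epsilon> b)\<^sup>2" and ?B = "\<Prod>c\<in>Basis - set (b # bs). s / \<sigma> c"
  define Q where "Q = P * ?A * ?B"
  \<comment> \<open>setting the width of \<open>b\<close> to \<open>r\<close> only adds the factor \<open>s / r\<close>\<close>
  have B: "(\<Prod>c\<in>Basis - set bs. s / (\<sigma>(b := r)) c) = s / r * ?B" for r
  proof -
    have "(\<Prod>c\<in>Basis - set bs. s / (\<sigma>(b := r)) c) = (\<Prod>c\<in>insert b (Basis - set (b # bs)). s / (\<sigma>(b := r)) c)"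
      using b by (intro prod.cong) auto
    also have "\<dots> = s / r * (\<Prod>c\<in>Basis - set (b # bs). s / (\<sigma>(b := r)) c)"
      by (subst prod.insert) auto
    also have "(\<Prod>c\<in>Basis - set (b # bs). s / (\<sigma>(b := r)) c) = ?B"
      by (rule prod.cong) auto
    finally show ?thesis .
  qed
  have N: "0 \<le> N" by (rule order_trans[OF norm_ge_zero smooth_symbolD(2)[OF sG, of undefined]])
  have "0 \<le> ?B" using Cons.prems(5) s by (intro prod_nonneg) (auto simp: less_imp_le)
  moreover have "0 \<le> ?A" by (intro prod_nonneg) simp
  ultimately have Q: "0 \<le> Q" unfolding Q_def using P by simp
  have IH: "norm (smoothed_pairing (\<sigma>(b := r)) H L) \<le> N' * Q * (s / r)" 
    if "0 < r" "r \<le> s" "smooth_symbol \<epsilon> bs N' H" for r H N'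
  proof -
    have "norm (smoothed_pairing (\<sigma>(b := r)) H L) \<le> N' * P * ?A * (\<Prod>c\<in>Basis - set bs. s / (\<sigma>(b := r)) c)"
      using that Cons.prems b by (intro Cons.IH) (auto split: if_splits)
    then show ?thesis unfolding B Q_def by (simp add: mult_ac)
  qed
  have "norm (smoothed_pairing (\<sigma>(b := s)) G L - smoothed_pairing (\<sigma>(b := 0)) G L) \<le> s * (s * (N * (\<epsilon> b)\<^sup>2 * Q))"
  proof (rule smoothed_pairing_diff[OF b(1) G(1,2) smooth_symbolD(1)[OF sG] G(3) smooth_symbolD(1)[OF G(5)] 
      smooth_symbolD(2)[OF sG] C1 smooth_symbolD(2)[OF G(5)] less_imp_le[OF s] L])
    show "r * norm (smoothed_pairing (\<sigma>(b := r)) G2 L) \<le> s * (N * (\<epsilon> b)\<^sup>2 * Q)" if "0 < r" "r \<le> s" for r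
      using mult_left_mono[OF IH[OF that G(5)], of r] that by (simp add: mult_ac)
    show "0 \<le> s * (N * (\<epsilon> b)\<^sup>2 * Q)" using N Q s by simp
  qed
  moreover have "norm (smoothed_pairing (\<sigma>(b := s)) G L) \<le> N * Q"
    using IH[OF s order_refl sG] s by simp
  moreover have "\<sigma>(b := 0) = \<sigma>" using Cons.prems(4) by auto
  ultimately have "norm (smoothed_pairing \<sigma> G L) \<le> N * Q + s * (s * (N * (\<epsilon> b)\<^sup>2 * Q))"
    using norm_triangle_ineq3[of "smoothed_pairing (\<sigma>(b := s)) G L" "smoothed_pairing \<sigma> G L"] by (simp add: abs_le_iff)
  also have "\<dots> = N * P * ((1 + s\<^sup>2 * (\<epsilon> b)\<^sup>2) * ?A) * ?B"
    by (simp add: Q_def power2_eq_square algebra_simps)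
  also have "(1 + s\<^sup>2 * (\<epsilon> b)\<^sup>2) * ?A = (\<Prod>b\<in>set (b # bs). 1 + s\<^sup>2 * (\<epsilon> b)\<^sup>2)"
    using b by simp
  finally show ?case .
qed

theorem pairing_bound:
  fixes L :: "'a::euclidean_space \<Rightarrow> complex"
  assumes s: "s > 0" and L: "integrable lborel L" and P: "0 \<le> P"
    and mod: "\<And>G N y. continuous_on UNIV G \<Longrightarrow> (\<And>x. norm (G x) \<le> N) \<Longrightarrow> 
      norm (LBINT x. modulated_average s y G x * L x) \<le> N * P"
    and bs: "distinct bs" "set bs = Basis" and G: "smooth_symbol \<epsilon> bs N G"
  shows "norm (LBINT x. G x * L x) \<le> N * P * (\<Prod>b\<in>Basis. 1 + s\<^sup>2 * (\<epsilon> b)\<^sup>2)"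
proof -
  have "heat (\<lambda>_. 0) G = G"
    by (rule ext) (simp add: heat_def stretch_def integral_gauss)
  then show ?thesis
    using smoothed_pairing_bound[OF s L P mod bs(1) _ G, of "\<lambda>_. 0"] bs(2) by (simp add: smoothed_pairing_def)
qed

section \<open>Square integrable functions\<close>

abbreviation lc :: "complex \<Rightarrow> ('a \<Rightarrow> complex) \<Rightarrow> complex \<Rightarrow> ('a \<Rightarrow> complex) \<Rightarrow> 'a \<Rightarrow> complex" where
  "lc a f b g \<equiv> (\<lambda>x. a * f x + b * g x)"

lemma L2_fun_measurable: "L2_fun f \<Longrightarrow> f \<in> borel_measurable borel"
  unfolding L2_fun_def by simp

lemma L2_fun_integrable: "L2_fun f \<Longrightarrow> integrable lborel (\<lambda>x. (norm (f x))\<^sup>2)"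
  unfolding L2_fun_def by simp

lemma norm_lc_sq_le: "(norm (a * u + b * v))\<^sup>2 \<le> 2 * (norm a)\<^sup>2 * (norm u)\<^sup>2 + 2 * (norm b)\<^sup>2 * (norm (v::complex))\<^sup>2"
proof -
  have "(norm (a * u + b * v))\<^sup>2 \<le> (norm (a * u) + norm (b * v))\<^sup>2"
    by (intro power_mono norm_triangle_ineq) simp
  also have "\<dots> \<le> 2 * (norm (a * u))\<^sup>2 + 2 * (norm (b * v))\<^sup>2"
    using zero_le_power2[of "norm (a * u) - norm (b * v)"] by (simp add: power2_eq_square algebra_simps)
  finally show ?thesis by (simp add: norm_mult power_mult_distrib)
qed

lemma L2_fun_lc:
  assumes "L2_fun f" "L2_fun g"
  shows "L2_fun (lc a f b g)"
  unfolding L2_fun_def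
proof
  have [measurable]: "f \<in> borel_measurable borel" "g \<in> borel_measurable borel"
    using assms by (auto intro: L2_fun_measurable)
  show "lc a f b g \<in> borel_measurable lborel" by simp
  show "integrable lborel (\<lambda>x. (norm (a * f x + b * g x))\<^sup>2)"
  proof (rule integrable_dominated)
    show "integrable lborel (\<lambda>x. 2 * (norm a)\<^sup>2 * (norm (f x))\<^sup>2 + 2 * (norm b)\<^sup>2 * (norm (g x))\<^sup>2)"
      by (intro Bochner_Integration.integrable_add integrable_mult_right L2_fun_integrable assms)
    show "(\<lambda>x. (norm (a * f x + b * g x))\<^sup>2) \<in> borel_measurable lborel" by measurable
    show "AE x in lborel. norm ((norm (a * f x + b * g x))\<^sup>2) \<le> norm (2 * (norm a)\<^sup>2 * (norm (f x))\<^sup>2 + 2 * (norm b)\<^sup>2 * (norm (g x))\<^sup>2)"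
      by (intro always_eventually allI) (simp add: norm_lc_sq_le)
  qed
qed

lemma L2_integrable_mult:
  assumes "L2_fun f" "L2_fun g"
  shows "integrable lborel (\<lambda>x. f x * cnj (g x))"
proof (rule integrable_dominated)
  have [measurable]: "f \<in> borel_measurable borel" "g \<in> borel_measurable borel"
    using assms by (auto intro: L2_fun_measurable)
  show "integrable lborel (\<lambda>x. (norm (f x))\<^sup>2 + (norm (g x))\<^sup>2)"
    by (intro Bochner_Integration.integrable_add L2_fun_integrable assms)
  have "(\<lambda>x. cnj (g x)) \<in> borel_measurable lborel"
    by (rule measurable_compose[OF _ borel_measurable_continuous_onI[of cnj]]) (auto intro: continuous_intros)
  then show "(\<lambda>x. f x * cnj (g x)) \<in> borel_measurable lborel" by simp
  have "norm u * norm v \<le> (norm u)\<^sup>2 + (norm v)\<^sup>2" for u v :: complex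
  proof -
    have "0 \<le> (norm u - norm v)\<^sup>2 + (norm u)\<^sup>2 + (norm v)\<^sup>2" by simp
    then show ?thesis by (simp add: power2_eq_square algebra_simps)
  qed
  then show "AE x in lborel. norm (f x * cnj (g x)) \<le> norm ((norm (f x))\<^sup>2 + (norm (g x))\<^sup>2)"
    by (intro always_eventually allI) (simp add: norm_mult)
qed

lemma integral_mult_lc:
  fixes f g k :: "'a::euclidean_space \<Rightarrow> complex"
  assumes "integrable lborel (\<lambda>s. f s * g s)" "integrable lborel (\<lambda>s. f s * k s)"
  shows "(LBINT s. f s * (c * g s + d * k s)) = c * (LBINT s. f s * g s) + d * (LBINT s. f s * k s)"
proof -
  have "(LBINT s. f s * (c * g s + d * k s)) = (LBINT s. c * (f s * g s) + d * (f s * k s))"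
    by (simp only: distrib_left mult.left_commute)
  also have "\<dots> = c * (LBINT s. f s * g s) + d * (LBINT s. f s * k s)"
    unfolding integral_mult_right_zero[symmetric] by (intro Bochner_Integration.integral_add integrable_mult_right assms)
  finally show ?thesis .
qed

lemma L2_inner_lc_left:
  assumes "L2_fun f" "L2_fun g" "L2_fun k"
  shows "L2_inner (lc a f b g) k = a * L2_inner f k + b * L2_inner g k"
proof -
  have "L2_inner (lc a f b g) k = (LINT x|lborel. a * (f x * cnj (k x)) + b * (g x * cnj (k x)))"
    unfolding L2_inner_def by (rule integral_eqI) (auto simp: algebra_simps)
  also have "\<dots> = a * L2_inner f k + b * L2_inner g k"
    unfolding L2_inner_def integral_mult_right_zero[symmetric]
    by (intro Bochner_Integration.integral_add integrable_mult_right L2_integrable_mult assms)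
  finally show ?thesis .
qed

lemma L2_inner_commute: "L2_inner g f = cnj (L2_inner f g)"
proof -
  have "L2_inner g f = (LINT x|lborel. cnj (f x * cnj (g x)))"
    unfolding L2_inner_def by (intro integral_eqI) (simp add: mult.commute)
  also have "\<dots> = cnj (L2_inner f g)"
    unfolding L2_inner_def by (rule Bochner_Integration.integral_cnj)
  finally show ?thesis .
qed

lemma L2_inner_lc_right:
  assumes "L2_fun f" "L2_fun g" "L2_fun k"
  shows "L2_inner k (lc a f b g) = cnj a * L2_inner k f + cnj b * L2_inner k g"
  using L2_inner_lc_left[OF assms, of a b] L2_inner_commute[of "lc a f b g" k] 
    L2_inner_commute[of f k] L2_inner_commute[of g k]
  by (metis complex_cnj_add complex_cnj_mult L2_inner_commute)

lemma L2_norm_nonneg [simp]: "0 \<le> L2_norm f"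
  unfolding L2_norm_def by simp

lemma L2_norm_sq: "(L2_norm f)\<^sup>2 = (LINT x|lborel. (norm (f x))\<^sup>2)"
  unfolding L2_norm_def by simp

lemma L2_norm_sq_nn:
  assumes "L2_fun f"
  shows "(\<integral>\<^sup>+x. ennreal ((norm (f x))\<^sup>2) \<partial>lborel) = ennreal ((L2_norm f)\<^sup>2)"
  unfolding L2_norm_sq by (rule nn_integral_eq_integral[OF L2_fun_integrable[OF assms]]) simp

lemma L2_inner_self: "L2_inner f f = of_real ((L2_norm f)\<^sup>2)"
  unfolding L2_inner_def L2_norm_sq by (simp add: complex_norm_square[symmetric] del: of_real_power)

lemma L2_norm_sq_lc:
  assumes "L2_fun f" "L2_fun g"
  shows "(L2_norm (lc a f b g))\<^sup>2 
    = (norm a)\<^sup>2 * (L2_norm f)\<^sup>2 + (norm b)\<^sup>2 * (L2_norm g)\<^sup>2 + 2 * Re (a * cnj b * L2_inner f g)"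
proof -
  let ?l = "lc a f b g"
  have "complex_of_real ((L2_norm ?l)\<^sup>2) = L2_inner ?l ?l" by (rule L2_inner_self[symmetric])
  also have "\<dots> = a * (cnj a * L2_inner f f + cnj b * L2_inner f g) + b * (cnj a * cnj (L2_inner f g) + cnj b * L2_inner g g)"
    using assms by (simp add: L2_inner_lc_left L2_inner_lc_right L2_fun_lc L2_inner_commute[of g f])
  also have "\<dots> = of_real ((norm a)\<^sup>2) * of_real ((L2_norm f)\<^sup>2) + of_real ((norm b)\<^sup>2) * of_real ((L2_norm g)\<^sup>2) 
      + (a * cnj b * L2_inner f g + cnj (a * cnj b * L2_inner f g))"
    unfolding L2_inner_self complex_norm_square by (simp add: algebra_simps)
  also have "\<dots> = of_real ((norm a)\<^sup>2 * (L2_norm f)\<^sup>2 + (norm b)\<^sup>2 * (L2_norm g)\<^sup>2 + 2 * Re (a * cnj b * L2_inner f g))"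
    unfolding complex_add_cnj by simp
  finally show ?thesis unfolding of_real_eq_iff .
qed

lemma L2_norm_scale: "L2_norm (\<lambda>x. a * f x) = norm a * L2_norm f"
  unfolding L2_norm_def by (simp add: norm_mult power_mult_distrib real_sqrt_mult)

lemma L2_Cauchy_Schwarz:
  assumes "L2_fun f" "L2_fun g"
  shows "norm (L2_inner f g) \<le> L2_norm f * L2_norm g"
proof -
  let ?F = "(L2_norm f)\<^sup>2" and ?G = "(L2_norm g)\<^sup>2" and ?z = "L2_inner f g"
  have "0 \<le> ?G\<^sup>2 * ?F + (norm ?z)\<^sup>2 * ?G - 2 * (?G * (norm ?z)\<^sup>2)"
  proof -
    have "Re (of_real ?G * cnj (- ?z) * ?z) = - (?G * (norm ?z)\<^sup>2)"
      by (simp only: mult.assoc complex_cnj_minus mult_minus_left mult.commute[of "cnj ?z"] complex_norm_square[symmetric])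
         (simp del: of_real_power)
    then show ?thesis
      using zero_le_power2[of "L2_norm (lc (of_real ?G) f (- ?z) g)"] 
      unfolding L2_norm_sq_lc[OF assms] norm_of_real norm_minus_cancel power2_abs by (simp del: of_real_power)
  qed
  then have 1: "0 \<le> ?G * (?F * ?G - (norm ?z)\<^sup>2)" by (simp add: power2_eq_square algebra_simps)
  show ?thesis
  proof (cases "?G = 0")
    case False
    then have "?G > 0" by simp
    with 1 have "(norm ?z)\<^sup>2 \<le> ?F * ?G" by (simp add: zero_le_mult_iff)
    then have "(norm ?z)\<^sup>2 \<le> (L2_norm f * L2_norm g)\<^sup>2" by (simp add: power_mult_distrib)
    then show ?thesis by (rule power2_le_imp_le) simp
  next
    case True
    then have "(LINT x|lborel. (norm (g x))\<^sup>2) = 0" by (simp add: L2_norm_sq)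
    then have "AE x in lborel. (norm (g x))\<^sup>2 = 0"
      using integral_nonneg_eq_0_iff_AE[OF L2_fun_integrable[OF assms(2)]] by simp
    then have "AE x in lborel. f x * cnj (g x) = 0" by eventually_elim simp
    then have "?z = 0" unfolding L2_inner_def by (rule integral_eq_zero_AE)
    then show ?thesis by simp
  qed
qed

lemma L2_norm_eq_0_imp_AE:
  assumes "L2_fun f" "L2_norm f = 0"
  shows "AE x in lborel. f x = 0"
proof -
  have "(LINT x|lborel. (norm (f x))\<^sup>2) = 0" using assms(2) by (simp add: L2_norm_sq[symmetric])
  then have "AE x in lborel. (norm (f x))\<^sup>2 = 0"
    using integral_nonneg_eq_0_iff_AE[OF L2_fun_integrable[OF assms(1)]] by simp
  then show ?thesis by eventually_elim simp
qed

lemma L2_norm_triangle: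
  assumes "L2_fun f" "L2_fun g"
  shows "L2_norm (lc 1 f 1 g) \<le> L2_norm f + L2_norm g"
proof (rule power2_le_imp_le)
  have "Re (L2_inner f g) \<le> L2_norm f * L2_norm g"
    using L2_Cauchy_Schwarz[OF assms] complex_Re_le_cmod order_trans by blast
  then show "(L2_norm (lc 1 f 1 g))\<^sup>2 \<le> (L2_norm f + L2_norm g)\<^sup>2"
    unfolding L2_norm_sq_lc[OF assms] by (simp add: power2_eq_square algebra_simps)
qed simp

lemma L2_fun_diff: "L2_fun f \<Longrightarrow> L2_fun g \<Longrightarrow> L2_fun (\<lambda>x. f x - g x)"
  using L2_fun_lc[of f g 1 "-1"] by simp

lemma L2_norm_diff_commute: "L2_norm (\<lambda>x. f x - g x) = L2_norm (\<lambda>x. g x - f x)"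
  unfolding L2_norm_def by (simp add: norm_minus_commute)

lemma L2_norm_triangle_diff2:
  assumes "L2_fun f" "L2_fun g"
  shows "L2_norm f \<le> L2_norm (\<lambda>x. f x - g x) + L2_norm g"
  using L2_norm_triangle[OF L2_fun_diff[OF assms] assms(2)] by simp

text \<open>
  A subsequence whose successive distances are at most \<open>(1/2)^k\<close> converges almost everywhere, and Fatou's
  lemma identifies its pointwise limit as the limit in $L^2$.
\<close>

lemma L2_complete:
  fixes f :: "nat \<Rightarrow> 'a::euclidean_space \<Rightarrow> complex"
  assumes f: "\<And>n. L2_fun (f n)"
    and C: "\<And>e. e > 0 \<Longrightarrow> \<exists>N. \<forall>n\<ge>N. \<forall>k\<ge>N. L2_norm (\<lambda>x. f n x - f k x) < e"
  shows "\<exists>g. L2_fun g \<and> (\<lambda>n. L2_norm (\<lambda>x. f n x - g x)) \<longlonglongrightarrow> 0"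
proof -
  have [measurable]: "f n \<in> borel_measurable borel" for n using f by (rule L2_fun_measurable)
  have nn: "(\<integral>\<^sup>+x. ennreal ((norm (f n x - f k x))\<^sup>2) \<partial>lborel) = ennreal ((L2_norm (\<lambda>x. f n x - f k x))\<^sup>2)" for n k
    by (rule L2_norm_sq_nn[OF L2_fun_diff[OF f f]])
  have "\<forall>k. \<exists>N. \<forall>n\<ge>N. \<forall>m\<ge>N. L2_norm (\<lambda>x. f n x - f m x) < (1/2)^k"
    using C by simp
  then obtain N where N: "\<And>k n m. n \<ge> N k \<Longrightarrow> m \<ge> N k \<Longrightarrow> L2_norm (\<lambda>x. f n x - f m x) < (1/2)^k"
    by metis
  define r where "r k = (\<Sum>i\<le>k. N i)" for k
  have r: "N k \<le> r k" "r k \<le> r (Suc k)" for k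
    unfolding r_def by (auto intro: member_le_sum)
  let ?d = "\<lambda>k x. norm (f (r (Suc k)) x - f (r k) x)"
  have d: "L2_norm (\<lambda>x. f (r (Suc k)) x - f (r k) x) \<le> (1/2)^k" for k
    using N[of k "r (Suc k)" "r k"] r[of k] by simp
  have half: "(2::real)^k * ((1/2)^k)\<^sup>2 = (1/2)^k" for k
    by (simp add: power2_eq_square power_mult_distrib[symmetric] mult.assoc[symmetric])
  have "(\<integral>\<^sup>+x. (\<Sum>k. ennreal (2^k * (?d k x)\<^sup>2)) \<partial>lborel) = (\<Sum>k. \<integral>\<^sup>+x. ennreal (2^k * (?d k x)\<^sup>2) \<partial>lborel)"
    by (rule nn_integral_suminf) simp
  also have "\<dots> = (\<Sum>k. ennreal (2^k * (L2_norm (\<lambda>x. f (r (Suc k)) x - f (r k) x))\<^sup>2))"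
    by (simp add: ennreal_mult nn_integral_cmult nn)
  also have "\<dots> \<le> (\<Sum>k. ennreal ((1/2)^k))"
  proof (intro suminf_le ennreal_leI)
    fix k
    have "2^k * (L2_norm (\<lambda>x. f (r (Suc k)) x - f (r k) x))\<^sup>2 \<le> 2^k * ((1/2)^k)\<^sup>2"
      using d[of k] by (intro mult_left_mono power_mono) auto
    then show "2^k * (L2_norm (\<lambda>x. f (r (Suc k)) x - f (r k) x))\<^sup>2 \<le> (1/2)^k" unfolding half .
  qed auto
  also have "\<dots> < \<infinity>"
    using summable_geometric[of "1/2::real"] by (subst suminf_ennreal2) auto
  finally have "(\<integral>\<^sup>+x. (\<Sum>k. ennreal (2^k * (?d k x)\<^sup>2)) \<partial>lborel) \<noteq> \<infinity>" by simp
  then have "AE x in lborel. (\<Sum>k. ennreal (2^k * (?d k x)\<^sup>2)) \<noteq> \<infinity>"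
    by (intro nn_integral_PInf_AE) auto
  then have conv: "AE x in lborel. convergent (\<lambda>k. f (r k) x)"
  proof eventually_elim
    case (elim x)
    then have s: "summable (\<lambda>k. 2^k * (?d k x)\<^sup>2)"
      by (intro summable_suminf_not_top) auto
    have "summable (\<lambda>k. ?d k x)"
    proof (rule summable_comparison_test')
      show "summable (\<lambda>k. (1/2)^k + 2^k * (?d k x)\<^sup>2)"
        by (intro summable_add s summable_geometric) simp
      show "norm (?d k x) \<le> (1/2)^k + 2^k * (?d k x)\<^sup>2" for k
      proof -
        \<comment> \<open>the weights \<open>2^k\<close> are summable against the squared distances, and completing the square trades them for \<open>(1/2)^k\<close>\<close>
        have "0 \<le> 2^k * (?d k x - (1/2)^k)\<^sup>2" by simp
        also have "\<dots> = 2^k * (?d k x)\<^sup>2 - 2 * (2^k * (1/2)^k) * ?d k x + 2^k * ((1/2)^k)\<^sup>2"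
          by (simp add: power2_eq_square algebra_simps)
        also have "\<dots> = 2^k * (?d k x)\<^sup>2 - 2 * ?d k x + (1/2)^k"
          unfolding half by (simp add: power_mult_distrib[symmetric])
        finally show ?thesis using norm_ge_zero[of "f (r (Suc k)) x - f (r k) x"]
          unfolding real_norm_def abs_norm_cancel by linarith
      qed
    qed
    then have "summable (\<lambda>k. f (r (Suc k)) x - f (r k) x)" by (rule summable_norm_cancel)
    then have "convergent (\<lambda>n. \<Sum>k<n. f (r (Suc k)) x - f (r k) x)" by (simp add: summable_iff_convergent)
    then have "convergent (\<lambda>n. f (r n) x - f (r 0) x)" using sum_lessThan_telescope[of "\<lambda>k. f (r k) x"] by simp
    then have "convergent (\<lambda>n. (f (r n) x - f (r 0) x) + f (r 0) x)"
      by (intro convergent_add convergent_const)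
    then show ?case by simp
  qed
  define g where "g x = lim (\<lambda>k. f (r k) x)" for x
  have [measurable]: "g \<in> borel_measurable borel"
    unfolding g_def[abs_def] by (rule borel_measurable_lim_metric) measurable
  have lim: "AE x in lborel. (\<lambda>k. f (r k) x) \<longlonglongrightarrow> g x"
    using conv unfolding g_def by eventually_elim (rule convergent_LIMSEQ_iff[THEN iffD1])
  have r_mono: "N k \<le> r j" if "k \<le> j" for k j
    using r(1)[of k] lift_Suc_mono_le[of r, OF r(2) that] by linarith
  have fatou: "(\<integral>\<^sup>+x. ennreal ((norm (f n x - g x))\<^sup>2) \<partial>lborel) \<le> ennreal (((1/2)^k)\<^sup>2)" if "n \<ge> N k" for n k
  proof -
    have "(\<integral>\<^sup>+x. ennreal ((norm (f n x - g x))\<^sup>2) \<partial>lborel) = (\<integral>\<^sup>+x. liminf (\<lambda>j. ennreal ((norm (f n x - f (r j) x))\<^sup>2)) \<partial>lborel)"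
    proof (rule nn_integral_cong_AE)
      show "AE x in lborel. ennreal ((norm (f n x - g x))\<^sup>2) = liminf (\<lambda>j. ennreal ((norm (f n x - f (r j) x))\<^sup>2))"
        using lim
      proof eventually_elim
        case (elim x)
        have "(\<lambda>j. ennreal ((norm (f n x - f (r j) x))\<^sup>2)) \<longlonglongrightarrow> ennreal ((norm (f n x - g x))\<^sup>2)"
          by (intro tendsto_ennrealI tendsto_intros elim)
        then show ?case by (intro lim_imp_Liminf[symmetric]) simp_all
      qed
    qed
    also have "\<dots> \<le> liminf (\<lambda>j. \<integral>\<^sup>+x. ennreal ((norm (f n x - f (r j) x))\<^sup>2) \<partial>lborel)"
      by (rule nn_integral_liminf) measurable
    also have "\<dots> \<le> ennreal (((1/2)^k)\<^sup>2)"
    proof (rule Liminf_le)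
      show "eventually (\<lambda>j. (\<integral>\<^sup>+x. ennreal ((norm (f n x - f (r j) x))\<^sup>2) \<partial>lborel) \<le> ennreal (((1/2)^k)\<^sup>2)) sequentially"
        using eventually_ge_at_top[of k]
      proof eventually_elim
        case (elim j)
        have "L2_norm (\<lambda>x. f n x - f (r j) x) < (1/2)^k"
          using N[OF that r_mono[OF elim]] .
        then show ?case unfolding nn by (intro ennreal_leI power_mono) auto
      qed
    qed simp
    finally show ?thesis .
  qed
  have intg: "L2_fun (\<lambda>x. f n x - g x)" if "n \<ge> N k" for n k
    unfolding L2_fun_def using order.strict_trans1[OF fatou[OF that] ennreal_less_top]
    by (intro conjI integrableI_bounded) auto
  have L2g: "L2_fun g"
    using L2_fun_diff[OF f[of "N 0"] intg[of 0 "N 0"]] by simp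
  have small: "L2_norm (\<lambda>x. f n x - g x) \<le> (1/2)^k" if "n \<ge> N k" for n k
  proof (rule power2_le_imp_le)
    have "ennreal ((L2_norm (\<lambda>x. f n x - g x))\<^sup>2) \<le> ennreal (((1/2)^k)\<^sup>2)"
      using fatou[OF that] unfolding L2_norm_sq_nn[OF intg[OF that]] .
    then show "(L2_norm (\<lambda>x. f n x - g x))\<^sup>2 \<le> ((1/2)^k)\<^sup>2" by simp
  qed simp
  have "(\<lambda>n. L2_norm (\<lambda>x. f n x - g x)) \<longlonglongrightarrow> 0"
  proof (rule LIMSEQ_I)
    fix e :: real assume "e > 0"
    then obtain k where "(1/2::real)^k < e" using real_arch_pow_inv[of e "1/2"] by auto
    then show "\<exists>N. \<forall>n\<ge>N. norm (L2_norm (\<lambda>x. f n x - g x) - 0) < e"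
      using small[of k] by (intro exI[of _ "N k"]) (auto intro: order.strict_trans1)
  qed
  with L2g show ?thesis by blast
qed

section \<open>Bounded functionals on a subspace\<close>

text \<open>
  Functionals on the subspace will be represented by vectors of its closure: there the representing vector is
  unique, so that it depends linearly on the functional.
\<close>

locale L2_subspace =
  fixes S :: "('a::euclidean_space \<Rightarrow> complex) \<Rightarrow> bool"
  assumes L2: "S f \<Longrightarrow> L2_fun f"
    and lc: "S f \<Longrightarrow> S g \<Longrightarrow> S (lc a f b g)"
    and zero: "S (\<lambda>_. 0)"
begin

definition in_closure :: "('a \<Rightarrow> complex) \<Rightarrow> bool" where
  "in_closure w \<longleftrightarrow> L2_fun w \<and> (\<exists>s. (\<forall>n. S (s n)) \<and> (\<lambda>n::nat. L2_norm (\<lambda>x. s n x - w x)) \<longlonglongrightarrow> 0)"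

lemma inner_tendsto:
  assumes "\<And>n. L2_fun (s n)" "L2_fun w" "L2_fun k" "(\<lambda>n::nat. L2_norm (\<lambda>x. s n x - w x)) \<longlonglongrightarrow> 0"
  shows "(\<lambda>n. L2_inner (s n) k) \<longlonglongrightarrow> L2_inner w k"
proof (rule Lim_null[THEN iffD2], rule Lim_null_comparison)
  show "eventually (\<lambda>n. norm (L2_inner (s n) k - L2_inner w k) \<le> L2_norm (\<lambda>x. s n x - w x) * L2_norm k) sequentially"
    using L2_Cauchy_Schwarz[OF L2_fun_diff[OF assms(1,2)] assms(3)] L2_inner_lc_left[OF assms(1,2,3), where a=1 and b="-1"] 
    by simp
  show "(\<lambda>n. L2_norm (\<lambda>x. s n x - w x) * L2_norm k) \<longlonglongrightarrow> 0"
    using tendsto_mult_right[OF assms(4), of "L2_norm k"] by simp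
qed

lemma norm_tendsto:
  assumes "\<And>n. L2_fun (s n)" "L2_fun w" "(\<lambda>n::nat. L2_norm (\<lambda>x. s n x - w x)) \<longlonglongrightarrow> 0"
  shows "(\<lambda>n. L2_norm (s n)) \<longlonglongrightarrow> L2_norm w"
proof (rule Lim_null[THEN iffD2], rule Lim_null_comparison[OF _ assms(3)])
  show "eventually (\<lambda>n. norm (L2_norm (s n) - L2_norm w) \<le> L2_norm (\<lambda>x. s n x - w x)) sequentially"
  proof (intro always_eventually allI)
    fix n
    show "norm (L2_norm (s n) - L2_norm w) \<le> L2_norm (\<lambda>x. s n x - w x)"
      using L2_norm_triangle_diff2[OF assms(1)[of n] assms(2)] L2_norm_triangle_diff2[OF assms(2) assms(1)[of n]]
        L2_norm_diff_commute[of w "s n"] by (simp add: abs_le_iff)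
  qed
qed

lemma in_closure_lc:
  assumes "in_closure u" "in_closure v"
  shows "in_closure (lc a u b v)"
proof -
  obtain s t where s: "\<And>n. S (s n)" "(\<lambda>n::nat. L2_norm (\<lambda>x. s n x - u x)) \<longlonglongrightarrow> 0"
    and t: "\<And>n. S (t n)" "(\<lambda>n::nat. L2_norm (\<lambda>x. t n x - v x)) \<longlonglongrightarrow> 0"
    and L2': "L2_fun u" "L2_fun v"
    using assms unfolding in_closure_def by auto
  have "(\<lambda>n. L2_norm (\<lambda>x. lc a (s n) b (t n) x - lc a u b v x)) \<longlonglongrightarrow> 0"
  proof (rule Lim_null_comparison)
    show "eventually (\<lambda>n. norm (L2_norm (\<lambda>x. lc a (s n) b (t n) x - lc a u b v x)) 
      \<le> norm a * L2_norm (\<lambda>x. s n x - u x) + norm b * L2_norm (\<lambda>x. t n x - v x)) sequentially"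
    proof (intro always_eventually allI)
      fix n
      have d: "L2_fun (\<lambda>x. a * (s n x - u x))" "L2_fun (\<lambda>x. b * (t n x - v x))"
        using L2_fun_lc[OF L2_fun_diff[OF L2[OF s(1)] L2'(1)] L2_fun_diff[OF L2[OF s(1)] L2'(1)], of a n 0]
          L2_fun_lc[OF L2_fun_diff[OF L2[OF t(1)] L2'(2)] L2_fun_diff[OF L2[OF t(1)] L2'(2)], of b n 0] by simp_all
      have "(\<lambda>x. lc a (s n) b (t n) x - lc a u b v x) = lc 1 (\<lambda>x. a * (s n x - u x)) 1 (\<lambda>x. b * (t n x - v x))"
        by (rule ext) (simp add: algebra_simps)
      then show "norm (L2_norm (\<lambda>x. lc a (s n) b (t n) x - lc a u b v x)) 
        \<le> norm a * L2_norm (\<lambda>x. s n x - u x) + norm b * L2_norm (\<lambda>x. t n x - v x)"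
        using L2_norm_triangle[OF d] unfolding L2_norm_scale by simp
    qed
    show "(\<lambda>n. norm a * L2_norm (\<lambda>x. s n x - u x) + norm b * L2_norm (\<lambda>x. t n x - v x)) \<longlonglongrightarrow> 0"
      using tendsto_add[OF tendsto_mult_left[OF s(2), of "norm a"] tendsto_mult_left[OF t(2), of "norm b"]] by simp
  qed
  then show ?thesis
    unfolding in_closure_def using L2_fun_lc[OF L2'] lc[OF s(1) t(1)]
    by (intro conjI exI[of _ "\<lambda>n. lc a (s n) b (t n)"]) auto
qed

lemma in_closure_eqI:
  assumes "in_closure u" "in_closure v" "\<And>s. S s \<Longrightarrow> L2_inner s u = L2_inner s v"
  shows "AE x in lborel. u x = v x"
proof -
  let ?d = "lc 1 u (-1) v"
  have d: "in_closure ?d" by (rule in_closure_lc[OF assms(1,2)])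
  then obtain s where s: "\<And>n. S (s n)" "(\<lambda>n::nat. L2_norm (\<lambda>x. s n x - ?d x)) \<longlonglongrightarrow> 0" and L: "L2_fun ?d"
    unfolding in_closure_def by auto
  have uv: "L2_fun u" "L2_fun v" using assms unfolding in_closure_def by auto
  have "L2_inner (s n) ?d = 0" for n
    using L2_inner_lc_right[OF uv L2[OF s(1)], of n 1 "-1"] assms(3)[OF s(1)] by simp
  moreover have "(\<lambda>n. L2_inner (s n) ?d) \<longlonglongrightarrow> L2_inner ?d ?d"
    by (rule inner_tendsto[OF L2[OF s(1)] L L s(2)])
  ultimately have "L2_inner ?d ?d = 0" by (simp add: LIMSEQ_const_iff)
  then have "L2_norm ?d = 0" unfolding L2_inner_self by simp
  from L2_norm_eq_0_imp_AE[OF L this] show ?thesis by eventually_elim simp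
qed

lemma quadratic_nonneg_imp_0:
  fixes D K :: real
  assumes "\<And>t. 0 \<le> 2 * t * D + t\<^sup>2 * K" and K: "0 \<le> K"
  shows "D = 0"
proof -
  \<comment> \<open>the minimiser of the quadratic would be \<open>- D / K\<close>; adding \<open>1\<close> avoids division by zero\<close>
  define q where "q = K + 1"
  have q: "q > 0" using K by (simp add: q_def)
  have "0 \<le> (2 * (- D / q) * D + (- D / q)\<^sup>2 * K) * q\<^sup>2"
    using assms(1)[of "- D / q"] by simp
  also have "\<dots> = - (D\<^sup>2 * (q + 1))"
    using q by (simp add: field_simps power2_eq_square) (simp add: q_def algebra_simps)
  finally have "D\<^sup>2 * (q + 1) \<le> 0" by simp
  then show ?thesis using q by (simp add: mult_le_0_iff)
qed

text \<open>
  The representing vector minimises \<open>\<parallel>s\<parallel>\<^sup>2 - 2 * Re (l s)\<close>: by the parallelogram identity a minimising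
  sequence in \<open>S\<close> is Cauchy, and the first variation at its limit is the representation.
\<close>

theorem Riesz:
  assumes lin: "\<And>f g a b. S f \<Longrightarrow> S g \<Longrightarrow> l (lc a f b g) = a * l f + b * l g"
    and bound: "\<And>f. S f \<Longrightarrow> norm (l f) \<le> C * L2_norm f" and C: "0 \<le> C"
  shows "\<exists>w. in_closure w \<and> (\<forall>s. S s \<longrightarrow> l s = L2_inner s w) \<and> L2_norm w \<le> C"
proof -
  define J where "J s = (L2_norm s)\<^sup>2 - 2 * Re (l s)" for s
  have Jge: "- C\<^sup>2 \<le> J s" if "S s" for s
  proof -
    have "Re (l s) \<le> C * L2_norm s" using complex_Re_le_cmod bound[OF that] order_trans by blast
    moreover have "0 \<le> (L2_norm s - C)\<^sup>2" by simp
    ultimately show ?thesis unfolding J_def by (simp add: power2_eq_square algebra_simps)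
  qed
  define m where "m = Inf (J ` Collect S)"
  have bdd: "bdd_below (J ` Collect S)" using Jge by (auto simp: bdd_below_def)
  have ne: "J ` Collect S \<noteq> {}" using zero by auto
  have mle: "m \<le> J s" if "S s" for s unfolding m_def by (rule cInf_lower[OF _ bdd]) (use that in auto)
  have "\<exists>s. S s \<and> J s < m + 1 / (real n + 1)" for n
    using cInf_lessD[OF ne, of "m + 1 / (real n + 1)"] unfolding m_def by auto
  then obtain s where s: "\<And>n. S (s n)" "\<And>n. J (s n) < m + 1 / (real n + 1)" by metis
  have par: "(L2_norm (\<lambda>x. f x - g x))\<^sup>2 = 2 * J f + 2 * J g - 4 * J (lc (1/2) f (1/2) g)" if "S f" "S g" for f g
  proof -
    have "(L2_norm (\<lambda>x. f x - g x))\<^sup>2 = (L2_norm f)\<^sup>2 + (L2_norm g)\<^sup>2 - 2 * Re (L2_inner f g)"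
      using L2_norm_sq_lc[OF L2[OF that(1)] L2[OF that(2)], of 1 "-1"] by simp
    then show ?thesis
      unfolding J_def L2_norm_sq_lc[OF L2[OF that(1)] L2[OF that(2)]] lin[OF that] 
      by (simp add: power2_eq_square)
  qed
  have "\<exists>N. \<forall>n\<ge>N. \<forall>k\<ge>N. L2_norm (\<lambda>x. s n x - s k x) < e" if "e > 0" for e
  proof -
    obtain N where "inverse (real (Suc N)) < e\<^sup>2 / 4"
      using reals_Archimedean[of "e\<^sup>2 / 4"] \<open>e > 0\<close> by auto
    then have N: "1 / (real N + 1) < e\<^sup>2 / 4" by (simp add: inverse_eq_divide add.commute)
    have le: "1 / (real n + 1) \<le> 1 / (real N + 1)" if "n \<ge> N" for n using that by (simp add: frac_le)
    have "L2_norm (\<lambda>x. s n x - s k x) < e" if "n \<ge> N" "k \<ge> N" for n k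
    proof (rule power2_less_imp_less)
      have "(L2_norm (\<lambda>x. s n x - s k x))\<^sup>2 < e\<^sup>2"
        unfolding par[OF s(1) s(1)] using s(2)[of n] s(2)[of k] le[OF that(1)] le[OF that(2)] N
          mle[OF lc[OF s(1) s(1), of "1/2" n "1/2" k]] by linarith
      then show "(L2_norm (\<lambda>x. s n x - s k x))\<^sup>2 < e\<^sup>2" .
    qed (use \<open>e > 0\<close> in simp)
    then show ?thesis by blast
  qed
  from L2_complete[OF L2[OF s(1)] this] obtain w where w: "L2_fun w" "(\<lambda>n. L2_norm (\<lambda>x. s n x - w x)) \<longlonglongrightarrow> 0" by blast
  have cl: "in_closure w" unfolding in_closure_def using w s by blast
  have Re_eq: "Re (l k) = Re (L2_inner w k)" if k: "S k" for k
  proof -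
    let ?D = "Re (L2_inner w k) - Re (l k)"
    have ge: "0 \<le> 2 * t * ?D + t\<^sup>2 * (L2_norm k)\<^sup>2" for t :: real
    proof (rule LIMSEQ_le_const)
      have "(\<lambda>n. 2 * t * (Re (L2_inner (s n) k) - Re (l k)) + t\<^sup>2 * (L2_norm k)\<^sup>2 + 1 / (real n + 1)) 
        \<longlonglongrightarrow> 2 * t * ?D + t\<^sup>2 * (L2_norm k)\<^sup>2 + 0"
        by (intro tendsto_intros inner_tendsto[OF L2[OF s(1)] w(1) L2[OF k] w(2)] 
            LIMSEQ_inverse_real_of_nat[unfolded inverse_eq_divide, unfolded of_nat_Suc add.commute[of 1]])
      then show "(\<lambda>n. 2 * t * (Re (L2_inner (s n) k) - Re (l k)) + t\<^sup>2 * (L2_norm k)\<^sup>2 + 1 / (real n + 1)) 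
        \<longlonglongrightarrow> 2 * t * ?D + t\<^sup>2 * (L2_norm k)\<^sup>2" by simp
      have "0 \<le> 2 * t * (Re (L2_inner (s n) k) - Re (l k)) + t\<^sup>2 * (L2_norm k)\<^sup>2 + 1 / (real n + 1)" for n
      proof -
        have "m \<le> J (lc 1 (s n) (of_real t) k)" by (rule mle[OF lc[OF s(1) k]])
        also have "\<dots> = J (s n) + 2 * t * (Re (L2_inner (s n) k) - Re (l k)) + t\<^sup>2 * (L2_norm k)\<^sup>2"
          unfolding J_def L2_norm_sq_lc[OF L2[OF s(1)] L2[OF k]] lin[OF s(1) k] by (simp add: algebra_simps)
        finally show ?thesis using s(2)[of n] by linarith
      qed
      then show "\<exists>N. \<forall>n\<ge>N. 0 \<le> 2 * t * (Re (L2_inner (s n) k) - Re (l k)) + t\<^sup>2 * (L2_norm k)\<^sup>2 + 1 / (real n + 1)"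
        by blast
    qed
    from quadratic_nonneg_imp_0[OF ge] have "?D = 0" by simp
    then show ?thesis by simp
  qed
  have eq: "l k = L2_inner k w" if k: "S k" for k
  proof (rule complex_eqI)
    show "Re (l k) = Re (L2_inner k w)" using Re_eq[OF k] L2_inner_commute[of w k] by simp
    \<comment> \<open>up to sign, the imaginary part is the real part at \<open>\<i> * k\<close>\<close>
    have ik: "lc \<i> k 0 k = (\<lambda>x. \<i> * k x)" by simp
    have "Re (l (lc \<i> k 0 k)) = Re (L2_inner w (lc \<i> k 0 k))" by (rule Re_eq[OF lc[OF k k]])
    then have "- Im (l k) = Im (L2_inner w k)"
      unfolding lin[OF k k] L2_inner_lc_right[OF L2[OF k] L2[OF k] w(1)] by simp
    then show "Im (l k) = Im (L2_inner k w)" using L2_inner_commute[of w k] by simp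
  qed
  have "(L2_norm w)\<^sup>2 \<le> C * L2_norm w"
  proof (rule LIMSEQ_le)
    have "(\<lambda>n. Re (L2_inner (s n) w)) \<longlonglongrightarrow> Re (L2_inner w w)"
      by (intro tendsto_intros inner_tendsto[OF L2[OF s(1)] w(1) w(1) w(2)])
    then show "(\<lambda>n. Re (l (s n))) \<longlonglongrightarrow> (L2_norm w)\<^sup>2" unfolding eq[OF s(1)] L2_inner_self by simp
    show "(\<lambda>n. C * L2_norm (s n)) \<longlonglongrightarrow> C * L2_norm w"
      by (intro tendsto_intros norm_tendsto[OF L2[OF s(1)] w])
    show "\<exists>N. \<forall>n\<ge>N. Re (l (s n)) \<le> C * L2_norm (s n)"
      using bound[OF s(1)] complex_Re_le_cmod order_trans by blast
  qed
  then have "L2_norm w \<le> C" using C L2_norm_nonneg[of w]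
    by (cases "L2_norm w = 0") (auto simp: power2_eq_square)
  with cl eq show ?thesis by blast
qed

lemma L2_fun_in_closure: "in_closure w \<Longrightarrow> L2_fun w"
  unfolding in_closure_def by simp

text \<open>
  For \<open>g\<close> in \<open>S\<close>, the form in its first argument is represented by some \<open>Q g\<close> in the closure. For an arbitrary square
  integrable \<open>f\<close>, the functional \<open>g \<mapsto> \<langle>Q g, f\<rangle>\<close> on \<open>S\<close> is again bounded by the same constant, and \<open>A f\<close> is the vector that
  represents it. Thus \<open>Q\<close> is the adjoint of \<open>A\<close> on \<open>S\<close>, and linearity of both comes from uniqueness.
\<close>

theorem sesquilinear_form_operator:
  assumes left: "\<And>f g k a b. S f \<Longrightarrow> S g \<Longrightarrow> S k \<Longrightarrow> B (lc a f b g) k = a * B f k + b * B g k"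
    and right: "\<And>f g k a b. S f \<Longrightarrow> S g \<Longrightarrow> S k \<Longrightarrow> B k (lc a f b g) = cnj a * B k f + cnj b * B k g"
    and bound: "\<And>f g. S f \<Longrightarrow> S g \<Longrightarrow> norm (B f g) \<le> C * L2_norm f * L2_norm g" and C: "0 \<le> C"
  shows "\<exists>A. bounded_L2_operator A \<and> (\<forall>f. L2_fun f \<longrightarrow> L2_norm (A f) \<le> C * L2_norm f) \<and>
    (\<forall>f g. S f \<longrightarrow> S g \<longrightarrow> L2_inner (A f) g = B f g)"
proof -
  have "\<exists>w. in_closure w \<and> (\<forall>f. S f \<longrightarrow> B f g = L2_inner f w) \<and> L2_norm w \<le> C * L2_norm g" if g: "S g" for g
  proof (rule Riesz)
    show "B (lc a f b k) g = a * B f g + b * B k g" if "S f" "S k" for f k a b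
      by (rule left[OF that g])
    show "norm (B f g) \<le> C * L2_norm g * L2_norm f" if "S f" for f
      using bound[OF that g] by (simp only: mult_ac)
    show "0 \<le> C * L2_norm g" using C by simp
  qed
  then obtain Q where Q: "\<And>g. S g \<Longrightarrow> in_closure (Q g)" "\<And>f g. S g \<Longrightarrow> S f \<Longrightarrow> B f g = L2_inner f (Q g)"
    "\<And>g. S g \<Longrightarrow> L2_norm (Q g) \<le> C * L2_norm g" by metis
  have QL2: "L2_fun (Q g)" if "S g" for g using L2_fun_in_closure[OF Q(1)[OF that]] .
  have Q_lc: "AE x in lborel. Q (lc a f b g) x = lc a (Q f) b (Q g) x" if "S f" "S g" for f g a b
  proof (rule in_closure_eqI)
    show "in_closure (Q (lc a f b g))" by (rule Q(1)[OF lc[OF that]])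
    show "in_closure (lc a (Q f) b (Q g))" by (rule in_closure_lc[OF Q(1)[OF that(1)] Q(1)[OF that(2)]])
    show "L2_inner s (Q (lc a f b g)) = L2_inner s (lc a (Q f) b (Q g))" if s: "S s" for s
      using \<open>S f\<close> \<open>S g\<close> s by (simp add: L2_inner_lc_right QL2 L2 Q(2)[symmetric] lc right)
  qed
  have inner_cong: "L2_inner f k = L2_inner g k" 
    if "AE x in lborel. f x = g x" "L2_fun f" "L2_fun g" "L2_fun k" for f g k :: "'a \<Rightarrow> complex"
    unfolding L2_inner_def
  proof (rule integral_cong_AE)
    show "AE x in lborel. f x * cnj (k x) = g x * cnj (k x)" using that(1) by eventually_elim simp
  qed (use L2_integrable_mult[OF that(2,4)] L2_integrable_mult[OF that(3,4)] in \<open>auto dest: borel_measurable_integrable\<close>)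
  have "\<exists>w. in_closure w \<and> (\<forall>s. S s \<longrightarrow> L2_inner (Q s) f = L2_inner s w) \<and> L2_norm w \<le> C * L2_norm f" if f: "L2_fun f" for f
  proof (rule Riesz)
    show "L2_inner (Q (lc a g b k)) f = a * L2_inner (Q g) f + b * L2_inner (Q k) f" if "S g" "S k" for g k a b
    proof -
      note q = QL2[OF that(1)] QL2[OF that(2)]
      have "L2_inner (Q (lc a g b k)) f = L2_inner (lc a (Q g) b (Q k)) f"
        by (rule inner_cong[OF Q_lc[OF that] QL2[OF lc[OF that]] L2_fun_lc[OF q] f])
      also have "\<dots> = a * L2_inner (Q g) f + b * L2_inner (Q k) f"
        by (rule L2_inner_lc_left[OF q f])
      finally show ?thesis .
    qed
    show "norm (L2_inner (Q s) f) \<le> C * L2_norm f * L2_norm s" if s: "S s" for s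
      using order_trans[OF L2_Cauchy_Schwarz[OF QL2[OF s] f] mult_right_mono[OF Q(3)[OF s], of "L2_norm f"]]
      by (simp add: mult_ac)
    show "0 \<le> C * L2_norm f" using C by simp
  qed
  then obtain A where A: "\<And>f. L2_fun f \<Longrightarrow> in_closure (A f)" "\<And>f s. L2_fun f \<Longrightarrow> S s \<Longrightarrow> L2_inner (Q s) f = L2_inner s (A f)"
    "\<And>f. L2_fun f \<Longrightarrow> L2_norm (A f) \<le> C * L2_norm f" by metis
  have AL2: "L2_fun (A f)" if "L2_fun f" for f using L2_fun_in_closure[OF A(1)[OF that]] .
  have "bounded_L2_operator A"
    unfolding bounded_L2_operator_def
  proof (intro conjI allI impI)
    show "L2_fun (A f)" if "L2_fun f" for f by (rule AL2[OF that])
    show "AE x in lborel. A f x = A g x" if "L2_fun f \<and> L2_fun g \<and> (AE x in lborel. f x = g x)" for f g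
    proof (rule in_closure_eqI)
      show "L2_inner s (A f) = L2_inner s (A g)" if s: "S s" for s
        using inner_cong[of f g "Q s"] \<open>L2_fun f \<and> L2_fun g \<and> (AE x in lborel. f x = g x)\<close> QL2[OF s] A(2)[OF _ s] 
          L2_inner_commute[of f "Q s"] L2_inner_commute[of g "Q s"] by simp
    qed (use that A(1) in auto)
    show "AE x in lborel. A (\<lambda>y. a * f y + b * g y) x = a * A f x + b * A g x" if "L2_fun f \<and> L2_fun g" for f g a b
    proof (rule in_closure_eqI)
      show "in_closure (A (lc a f b g))" using that by (intro A(1) L2_fun_lc) auto
      show "in_closure (lc a (A f) b (A g))" using that by (intro in_closure_lc A(1)) auto
      show "L2_inner s (A (lc a f b g)) = L2_inner s (lc a (A f) b (A g))" if s: "S s" for s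
        using \<open>L2_fun f \<and> L2_fun g\<close> s by (simp add: L2_inner_lc_right AL2 QL2 L2 A(2)[symmetric] L2_fun_lc)
    qed
    show "\<exists>C. \<forall>f. L2_fun f \<longrightarrow> L2_norm (A f) \<le> C * L2_norm f" using A(3) by blast
  qed
  moreover have "L2_inner (A f) g = B f g" if "S f" "S g" for f g
    using A(2)[OF L2[OF that(1)] that(2)] Q(2)[OF that(2,1)] L2_inner_commute[of f "Q g"] L2_inner_commute[of "A f" g] 
    by simp
  ultimately show ?thesis using A(3) by blast
qed

end

section \<open>Iterated partial derivatives\<close>

lemma has_iterated_partial_Nil_iff: "has_iterated_partial F [] G \<longleftrightarrow> G = F"
  by (auto intro: has_iterated_partial.intros elim: has_iterated_partial.cases)

lemma has_iterated_partial_Cons_iff: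
  "has_iterated_partial F (b # ds) G' \<longleftrightarrow> (\<exists>G. has_iterated_partial F ds G \<and> has_partial b G G')"
  unfolding has_partial_def
  by (auto intro: has_iterated_partial.intros elim: has_iterated_partial.cases)

lemma has_partial_unique: "has_partial b G G1 \<Longrightarrow> has_partial b G G2 \<Longrightarrow> G1 = G2"
  unfolding has_partial_def using vector_derivative_unique_at by blast

lemma has_iterated_partial_unique:
  "has_iterated_partial F ds G1 \<Longrightarrow> has_iterated_partial F ds G2 \<Longrightarrow> G1 = G2"
proof (induction ds arbitrary: G1 G2)
  case (Cons b ds)
  then show ?case unfolding has_iterated_partial_Cons_iff using has_partial_unique by metis
qed (simp add: has_iterated_partial_Nil_iff)

lemma has_iterated_partial_append_iff:
  "has_iterated_partial F (ds @ es) G \<longleftrightarrow> (\<exists>H. has_iterated_partial F es H \<and> has_iterated_partial H ds G)"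
proof (induction ds arbitrary: G)
  case (Cons b ds)
  then show ?case by (auto simp: has_iterated_partial_Cons_iff)
qed (simp add: has_iterated_partial_Nil_iff)

lemma has_partial_lc:
  assumes "has_partial d G G'" "has_partial d H H'"
  shows "has_partial d (lc a G b H) (lc a G' b H')"
  unfolding has_partial_def
proof
  fix p
  have "((\<lambda>t. G (p + t *\<^sub>R d)) has_vector_derivative G' p) (at 0)" "((\<lambda>t. H (p + t *\<^sub>R d)) has_vector_derivative H' p) (at 0)"
    using assms unfolding has_partial_def by auto
  then show "((\<lambda>t. a * G (p + t *\<^sub>R d) + b * H (p + t *\<^sub>R d)) has_vector_derivative a * G' p + b * H' p) (at 0)"
    by (intro has_vector_derivative_add has_vector_derivative_mult_right)
qed

lemma has_iterated_partial_lc: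
  "has_iterated_partial F ds G \<Longrightarrow> has_iterated_partial F' ds H \<Longrightarrow> has_iterated_partial (lc a F b F') ds (lc a G b H)"
proof (induction ds arbitrary: G H)
  case (Cons d ds)
  then show ?case unfolding has_iterated_partial_Cons_iff using has_partial_lc by metis
qed (simp add: has_iterated_partial_Nil_iff)

section \<open>Symbols with bounded second derivatives\<close>

lemma prod_Basis_pair:
  fixes f :: "(real^'n) \<times> (real^'n) \<Rightarrow> real"
  shows "(\<Prod>b\<in>Basis. f b) = (\<Prod>j\<in>UNIV. f (axis j 1, 0) * f (0, axis j 1))"
proof -
  have "(Basis :: ((real^'n) \<times> (real^'n)) set) = (\<lambda>j. (axis j 1, 0)) ` UNIV \<union> (\<lambda>j. (0, axis j 1)) ` UNIV"
    by (auto simp: Basis_prod_def Basis_vec_def)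
  moreover have "(\<Prod>b\<in>(\<lambda>j. (axis j 1, 0)) ` UNIV \<union> (\<lambda>j. (0, axis j 1)) ` UNIV. f b) 
    = (\<Prod>b\<in>(\<lambda>j. (axis j 1, 0)) ` UNIV. f b) * (\<Prod>b\<in>(\<lambda>j. (0, axis j 1)) ` UNIV. f b)"
    by (rule prod.union_disjoint) (auto simp: axis_eq_0_iff)
  moreover have "(\<Prod>b\<in>(\<lambda>j. (axis j 1, 0)) ` UNIV. f b) = (\<Prod>j\<in>UNIV. f (axis j 1, 0))"
    by (subst prod.reindex) (auto simp: inj_on_def axis_eq_axis)
  moreover have "(\<Prod>b\<in>(\<lambda>j. (0, axis j 1)) ` UNIV. f b) = (\<Prod>j\<in>UNIV. f (0, axis j 1))"
    by (subst prod.reindex) (auto simp: inj_on_def axis_eq_axis)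
  ultimately show ?thesis by (simp add: prod.distrib)
qed

text \<open>
  The function on the coordinate directions of phase space that assigns \<open>\<epsilon> j\<close> to both directions with
  index \<open>j\<close>; the formula extends it linearly to avoid a case distinction.
\<close>

definition coord_weight :: "('n::finite \<Rightarrow> real) \<Rightarrow> (real^'n) \<times> (real^'n) \<Rightarrow> real" where
  "coord_weight \<epsilon> p = (\<Sum>j\<in>UNIV. (fst p $ j + snd p $ j) * \<epsilon> j)"

lemma coord_weight_axis [simp]: "coord_weight \<epsilon> (axis j 1, 0) = \<epsilon> j" "coord_weight \<epsilon> (0, axis j 1) = \<epsilon> j"
  unfolding coord_weight_def by (simp_all add: axis_def if_distrib[of "\<lambda>x. x * _"] cong: if_cong)

text \<open>
  The product over the support of a multi-index becomes a product over all coordinate directions, since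
  exponents \<open>0\<close> contribute \<open>1\<close>; this form is multiplicative in the list of directions.
\<close>

lemma symbol_derivative_bounds_listD:
  fixes F :: "(real^'n) \<times> (real^'n) \<Rightarrow> complex"
  assumes F: "symbol_derivative_bounds m M \<epsilon> F" and ds: "set ds \<subseteq> Basis" "\<And>b. count_list ds b \<le> m"
  shows "\<exists>G. has_iterated_partial F ds G \<and> continuous_on UNIV G \<and> bounded (range G) \<and>
    (ds \<noteq> [] \<longrightarrow> (\<forall>p. norm (G p) \<le> M * (\<Prod>b\<in>Basis. coord_weight \<epsilon> b ^ count_list ds b)))"
proof -
  define \<alpha> \<beta> :: "'n \<Rightarrow> nat" where "\<alpha> j = count_list ds (axis j 1, 0)" and "\<beta> j = count_list ds (0, axis j 1)" for j
  have "(\<alpha>, \<beta>) \<in> multi_indices m" using ds(2) by (simp add: multi_indices_def \<alpha>_def \<beta>_def)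
  then obtain G where G: "has_multi_partial F \<alpha> \<beta> G" "continuous_on UNIV G" "bounded (range G)"
    "(\<alpha>, \<beta>) \<noteq> (\<lambda>_. 0, \<lambda>_. 0) \<Longrightarrow> (\<forall>x \<xi>. norm (G (x, \<xi>)) \<le> M * (\<Prod>j\<in>index_support \<alpha> \<beta>. \<epsilon> j ^ (\<alpha> j + \<beta> j)))"
    using F unfolding symbol_derivative_bounds_def by fast
  have "has_iterated_partial F ds G"
    using G(1) ds(1) unfolding has_multi_partial_def \<alpha>_def \<beta>_def by blast
  moreover have "norm (G p) \<le> M * (\<Prod>b\<in>Basis. coord_weight \<epsilon> b ^ count_list ds b)" if ne: "ds \<noteq> []" for p
  proof -
    obtain b where "b \<in> set ds" using ne by (cases ds) auto
    then have b: "b \<in> Basis" "count_list ds b \<noteq> 0" using ds(1) by (auto simp: count_list_0_iff)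
    then obtain j where "b = (axis j 1, 0) \<or> b = (0, axis j 1)" by (auto simp: Basis_prod_def Basis_vec_def)
    then have "\<alpha> j \<noteq> 0 \<or> \<beta> j \<noteq> 0" using b(2) by (auto simp: \<alpha>_def \<beta>_def)
    then have "(\<alpha>, \<beta>) \<noteq> (\<lambda>_. 0, \<lambda>_. 0)" by auto
    then have "norm (G p) \<le> M * (\<Prod>j\<in>index_support \<alpha> \<beta>. \<epsilon> j ^ (\<alpha> j + \<beta> j))"
      using G(4) by (cases p) auto
    also have "(\<Prod>j\<in>index_support \<alpha> \<beta>. \<epsilon> j ^ (\<alpha> j + \<beta> j)) = (\<Prod>j\<in>UNIV. \<epsilon> j ^ (\<alpha> j + \<beta> j))"
      by (rule prod.mono_neutral_left) (auto simp: index_support_def not_less_eq_eq)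
    also have "\<dots> = (\<Prod>b\<in>Basis. coord_weight \<epsilon> b ^ count_list ds b)"
      unfolding prod_Basis_pair by (simp add: \<alpha>_def \<beta>_def power_add)
    finally show ?thesis .
  qed
  ultimately show ?thesis using G(2,3) by blast
qed

lemma count_list_twice: "distinct es \<Longrightarrow> count_list (concat (map (\<lambda>b. [b, b]) es)) b = (if b \<in> set es then 2 else 0)"
  by (induction es) auto

text \<open>
  The directions in \<open>es\<close> have already been differentiated twice. The multi-indices that occur have entries \<open>0\<close> and \<open>2\<close>,
  and a single entry \<open>1\<close> for the first derivative in the current direction. Uniqueness of derivatives makes the
  functions obtained for different multi-indices successive derivatives of each other.
\<close>

lemma symbol_derivative_bounds_smooth_symbol:
  fixes F :: "(real^'n) \<times> (real^'n) \<Rightarrow> complex"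
  assumes F: "symbol_derivative_bounds 2 M \<epsilon> F" "continuous_on UNIV F" "\<And>x \<xi>. norm (F (x, \<xi>)) \<le> M"
  shows "distinct (bs @ es) \<Longrightarrow> set (bs @ es) \<subseteq> Basis \<Longrightarrow> has_iterated_partial F (concat (map (\<lambda>b. [b, b]) es)) G \<Longrightarrow>
    smooth_symbol (coord_weight \<epsilon>) bs (M * (\<Prod>b\<in>set es. (coord_weight \<epsilon> b)\<^sup>2)) G"
proof (induction bs arbitrary: es G)
  case Nil
  let ?ds = "concat (map (\<lambda>b. [b, b]) es)"
  show ?case
  proof (cases "es = []")
    case True
    then have "G = F" using Nil by (simp add: has_iterated_partial_Nil_iff)
    then show ?thesis using True F(2,3) by auto
  next
    case False
    have "set ?ds \<subseteq> Basis" "\<And>b. count_list ?ds b \<le> 2" using Nil by (auto simp: count_list_twice)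
    from symbol_derivative_bounds_listD[OF F(1) this] obtain G' where G': "has_iterated_partial F ?ds G'" "continuous_on UNIV G'"
      "?ds \<noteq> [] \<longrightarrow> (\<forall>p. norm (G' p) \<le> M * (\<Prod>b\<in>Basis. coord_weight \<epsilon> b ^ count_list ?ds b))" by blast
    have "(\<Prod>b\<in>Basis. coord_weight \<epsilon> b ^ count_list ?ds b) = (\<Prod>b\<in>Basis. if b \<in> set es then (coord_weight \<epsilon> b)\<^sup>2 else 1)"
      using Nil by (intro prod.cong) (auto simp: count_list_twice)
    also have "\<dots> = (\<Prod>b\<in>set es. (coord_weight \<epsilon> b)\<^sup>2)"
      using Nil by (simp add: prod.If_cases Int_absorb1)
    finally show ?thesis
      using G' has_iterated_partial_unique[OF G'(1) Nil(3)] False by (cases es) auto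
  qed
next
  case (Cons b bs)
  let ?ds = "concat (map (\<lambda>b. [b, b]) es)"
  have count: "count_list ?ds b = 0" "\<And>c. count_list ?ds c \<le> 2" "set ?ds \<subseteq> Basis" "b \<in> Basis"
    using Cons.prems by (auto simp: count_list_twice)
  have 1: "set (b # ?ds) \<subseteq> Basis" "\<And>c. count_list (b # ?ds) c \<le> 2"
    and 2: "set (b # b # ?ds) \<subseteq> Basis" "\<And>c. count_list (b # b # ?ds) c \<le> 2"
    using count by auto
  obtain G1 where G1: "has_iterated_partial F (b # ?ds) G1" "continuous_on UNIV G1" "bounded (range G1)"
    using symbol_derivative_bounds_listD[OF F(1) 1] by blast
  obtain G2 where G2: "has_iterated_partial F (b # b # ?ds) G2"
    using symbol_derivative_bounds_listD[OF F(1) 2] by blast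
  have p1: "has_partial b G G1"
    using G1(1) Cons.prems(3) has_iterated_partial_unique unfolding has_iterated_partial_Cons_iff by blast
  have p2: "has_partial b G1 G2"
    using G2 G1(1) has_iterated_partial_unique unfolding has_iterated_partial_Cons_iff[of F b "b # ?ds"] by blast
  have "smooth_symbol (coord_weight \<epsilon>) bs (M * (\<Prod>b\<in>set es. (coord_weight \<epsilon> b)\<^sup>2)) G"
    using Cons.prems by (intro Cons.IH) auto
  moreover have "smooth_symbol (coord_weight \<epsilon>) bs (M * (\<Prod>b\<in>set (b # es). (coord_weight \<epsilon> b)\<^sup>2)) G2"
    using Cons.prems G2 by (intro Cons.IH) auto
  moreover have "M * (\<Prod>b\<in>set (b # es). (coord_weight \<epsilon> b)\<^sup>2) = M * (\<Prod>b\<in>set es. (coord_weight \<epsilon> b)\<^sup>2) * (coord_weight \<epsilon> b)\<^sup>2"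
    using Cons.prems by simp
  ultimately show ?case unfolding smooth_symbol.simps using p1 p2 G1(2,3) by metis
qed

section \<open>Schwartz functions\<close>

lemma schwartz_continuous: "schwartz \<phi> \<Longrightarrow> continuous_on UNIV \<phi>"
  unfolding schwartz_def by (drule spec[of _ "[]"]) (auto simp: has_iterated_partial_Nil_iff)

lemma schwartz_bounded_power:
  assumes "schwartz \<phi>"
  obtains C where "\<And>x. norm x ^ k * norm (\<phi> x) \<le> C"
proof -
  have "bounded (range (\<lambda>x. norm x ^ k *\<^sub>R \<phi> x))"
    using assms unfolding schwartz_def by (auto dest!: spec[of _ "[]"] simp: has_iterated_partial_Nil_iff)
  then show ?thesis using that unfolding bounded_iff by auto
qed

lemma schwartz_partial:
  assumes "schwartz \<phi>" "b \<in> Basis"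
  obtains \<phi>' where "has_partial b \<phi> \<phi>'" "schwartz \<phi>'"
proof -
  have "\<exists>G. has_iterated_partial \<phi> [b] G"
    using assms(1)[unfolded schwartz_def, rule_format, of "[b]"] assms(2) by auto
  then obtain \<phi>' where p: "has_iterated_partial \<phi> [b] \<phi>'" by blast
  have "schwartz \<phi>'"
    unfolding schwartz_def
  proof (intro allI impI)
    fix ds :: "'a list" assume "set ds \<subseteq> Basis"
    then have "set (ds @ [b]) \<subseteq> Basis" using assms by auto
    then obtain G where G: "has_iterated_partial \<phi> (ds @ [b]) G" "continuous_on UNIV G" "\<forall>k::nat. bounded (range (\<lambda>x. norm x ^ k *\<^sub>R G x))"
      using assms(1) unfolding schwartz_def by blast
    then have "has_iterated_partial \<phi>' ds G"
      unfolding has_iterated_partial_append_iff using has_iterated_partial_unique[OF _ p] by blast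
    with G show "\<exists>G. has_iterated_partial \<phi>' ds G \<and> continuous_on UNIV G \<and> (\<forall>k::nat. bounded (range (\<lambda>x. norm x ^ k *\<^sub>R G x)))"
      by blast
  qed
  moreover have "has_partial b \<phi> \<phi>'" using p by (simp add: has_iterated_partial_Cons_iff has_iterated_partial_Nil_iff)
  ultimately show ?thesis using that by blast
qed

lemma schwartz_lc:
  assumes "schwartz \<phi>" "schwartz \<psi>"
  shows "schwartz (lc a \<phi> b \<psi>)"
  unfolding schwartz_def
proof (intro allI impI)
  fix ds :: "'a list" assume ds: "set ds \<subseteq> Basis"
  obtain G where G: "has_iterated_partial \<phi> ds G" "continuous_on UNIV G" "\<forall>k::nat. bounded (range (\<lambda>x. norm x ^ k *\<^sub>R G x))"
    using assms(1) ds unfolding schwartz_def by blast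
  obtain H where H: "has_iterated_partial \<psi> ds H" "continuous_on UNIV H" "\<forall>k::nat. bounded (range (\<lambda>x. norm x ^ k *\<^sub>R H x))"
    using assms(2) ds unfolding schwartz_def by blast
  have "bounded (range (\<lambda>x. norm x ^ k *\<^sub>R lc a G b H x))" for k
  proof -
    obtain C where C: "\<And>x. norm (norm x ^ k *\<^sub>R G x) \<le> C" using G(3)[rule_format, of k] unfolding bounded_iff by auto
    obtain D where D: "\<And>x. norm (norm x ^ k *\<^sub>R H x) \<le> D" using H(3)[rule_format, of k] unfolding bounded_iff by auto
    have "norm (norm x ^ k *\<^sub>R lc a G b H x) \<le> norm a * C + norm b * D" for x
    proof -
      have "norm x ^ k *\<^sub>R lc a G b H x = a * (norm x ^ k *\<^sub>R G x) + b * (norm x ^ k *\<^sub>R H x)"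
        by (simp add: scaleR_conv_of_real algebra_simps)
      also have "norm \<dots> \<le> norm (a * (norm x ^ k *\<^sub>R G x)) + norm (b * (norm x ^ k *\<^sub>R H x))" by (rule norm_triangle_ineq)
      also have "\<dots> \<le> norm a * C + norm b * D"
        unfolding norm_mult[of a] norm_mult[of b] by (intro add_mono mult_left_mono C D norm_ge_zero)
      finally show ?thesis .
    qed
    then show ?thesis unfolding bounded_iff by auto
  qed
  moreover have "continuous_on UNIV (lc a G b H)" by (intro continuous_intros G H)
  ultimately show "\<exists>G. has_iterated_partial (lc a \<phi> b \<psi>) ds G \<and> continuous_on UNIV G \<and> (\<forall>k::nat. bounded (range (\<lambda>x. norm x ^ k *\<^sub>R G x)))"
    using has_iterated_partial_lc[OF G(1) H(1)] by blast
qed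

lemma schwartz_zero: "schwartz (\<lambda>_. 0)"
proof -
  have "has_iterated_partial (\<lambda>_. 0) ds (\<lambda>_. 0)" for ds :: "'a list"
    by (induction ds) (auto simp: has_iterated_partial_Nil_iff has_iterated_partial_Cons_iff has_partial_def intro!: exI[of _ "\<lambda>_. 0"])
  then show ?thesis unfolding schwartz_def by (auto intro!: exI[of _ "\<lambda>_. 0"])
qed

text \<open>
  An integrable weight that is a product over the coordinates. It is what remains when a function is bounded after
  multiplication by \<open>1 + (x \<bullet> b)\<^sup>2\<close> for every coordinate direction \<open>b\<close>.
\<close>

definition cauchy_weight :: "'a::euclidean_space \<Rightarrow> real" where
  "cauchy_weight x = (\<Prod>b\<in>Basis. inverse (1 + (x \<bullet> b)\<^sup>2))"

lemma integrable_cauchy_weight: "integrable lborel cauchy_weight"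
proof -
  have "integrable lborel (\<lambda>x::real. inverse (1 + x\<^sup>2))"
    using integrable_inverse_1_plus_square by (simp add: set_integrable_def)
  then show ?thesis
    unfolding cauchy_weight_def[abs_def] using integrable_prod_Basis(1)[of "\<lambda>_ x. inverse (1 + x\<^sup>2)"] by blast
qed

lemma schwartz_bound:
  fixes \<phi> :: "'a::euclidean_space \<Rightarrow> complex"
  assumes "schwartz \<phi>"
  obtains C where "\<And>x. norm (\<phi> x) \<le> C * cauchy_weight x" "\<And>x. norm (\<phi> x) \<le> C"
proof -
  let ?N = "DIM('a)"
  obtain C0 where C0: "\<And>x. norm x ^ 0 * norm (\<phi> x) \<le> C0" using schwartz_bounded_power[OF assms, of 0] by blast
  obtain C1 where C1: "\<And>x. norm x ^ (2 * ?N) * norm (\<phi> x) \<le> C1" using schwartz_bounded_power[OF assms] by blast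
  define C where "C = 2 ^ ?N * (C0 + C1)"
  have C0': "0 \<le> C0" "0 \<le> C1"
    using order_trans[OF _ C0[of 0]] order_trans[OF _ C1[of 0]] by simp_all
  have "norm (\<phi> x) \<le> C * cauchy_weight x" for x
  proof -
    have "(\<Prod>b\<in>Basis. 1 + (x \<bullet> b)\<^sup>2) \<le> (\<Prod>b\<in>(Basis::'a set). 1 + (norm x)\<^sup>2)"
      using Basis_le_norm[of _ x] by (intro prod_mono) (auto simp: abs_le_square_iff[symmetric])
    also have "\<dots> \<le> (2 * max 1 ((norm x)\<^sup>2)) ^ ?N"
      unfolding prod_constant by (intro power_mono) auto
    also have "\<dots> \<le> 2 ^ ?N * (1 + norm x ^ (2 * ?N))"
      by (auto simp: power_mult_distrib max_def power_mult[symmetric])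
    finally have "(\<Prod>b\<in>Basis. 1 + (x \<bullet> b)\<^sup>2) * norm (\<phi> x) \<le> 2 ^ ?N * (1 + norm x ^ (2 * ?N)) * norm (\<phi> x)"
      by (rule mult_right_mono) simp
    also have "\<dots> = 2 ^ ?N * (norm (\<phi> x) + norm x ^ (2 * ?N) * norm (\<phi> x))" by (simp add: algebra_simps)
    also have "\<dots> \<le> C"
      unfolding C_def using C0[of x] C1[of x] by (intro mult_left_mono add_mono) auto
    finally have "(\<Prod>b\<in>Basis. 1 + (x \<bullet> b)\<^sup>2) * norm (\<phi> x) \<le> C" .
    moreover have "(\<Prod>b\<in>Basis. 1 + (x \<bullet> b)\<^sup>2) > 0" by (intro prod_pos) (simp add: add_pos_nonneg)
    ultimately show ?thesis
      by (simp add: cauchy_weight_def prod_inversef[unfolded o_def] divide_inverse[symmetric] pos_le_divide_eq mult.commute)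
  qed
  moreover have "norm (\<phi> x) \<le> C" for x
  proof -
    have "norm (\<phi> x) \<le> 1 * (C0 + C1)" using C0[of x] C0' by simp
    also have "\<dots> \<le> C" unfolding C_def using C0' by (intro mult_right_mono) auto
    finally show ?thesis .
  qed
  ultimately show ?thesis using that by blast
qed

lemma schwartz_measurable: "schwartz \<phi> \<Longrightarrow> \<phi> \<in> borel_measurable borel"
  by (intro borel_measurable_continuous_onI schwartz_continuous)

lemma schwartz_integrable:
  assumes "schwartz \<phi>"
  shows "integrable lborel \<phi>"
proof -
  obtain C where C: "\<And>x. norm (\<phi> x) \<le> C * cauchy_weight x" "\<And>x. norm (\<phi> x) \<le> C" using schwartz_bound[OF assms] by metis
  show ?thesis
    by (rule integrable_dominated[OF integrable_mult_right[OF integrable_cauchy_weight, of C]])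
       (use C(1) schwartz_measurable[OF assms] in \<open>auto intro!: always_eventually order_trans[OF _ abs_ge_self]\<close>)
qed

lemma schwartz_L2_fun:
  assumes "schwartz \<phi>"
  shows "L2_fun \<phi>"
  unfolding L2_fun_def
proof
  obtain C where C: "\<And>x. norm (\<phi> x) \<le> C * cauchy_weight x" "\<And>x. norm (\<phi> x) \<le> C" using schwartz_bound[OF assms] by metis
  show "\<phi> \<in> borel_measurable lborel" using schwartz_measurable[OF assms] by simp
  then have m: "(\<lambda>x. (norm (\<phi> x))\<^sup>2) \<in> borel_measurable lborel" by measurable
  have "0 \<le> C" using order_trans[OF norm_ge_zero C(2)] .
  then show "integrable lborel (\<lambda>x. (norm (\<phi> x))\<^sup>2)"
    by (intro integrable_dominated[OF integrable_mult_right[OF schwartz_integrable[OF assms], of "of_real C"] m])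
       (auto simp: norm_mult power2_eq_square intro!: mult_right_mono C)
qed

lemma L2_subspace_schwartz: "L2_subspace schwartz"
  by standard (auto intro: schwartz_L2_fun schwartz_lc schwartz_zero)

section \<open>The cross-Wigner function\<close>

lemma lborel_nn_Fubini:
  fixes f :: "'a::euclidean_space \<times> 'b::euclidean_space \<Rightarrow> ennreal"
  assumes "f \<in> borel_measurable borel"
  shows "(\<integral>\<^sup>+p. f p \<partial>lborel) = (\<integral>\<^sup>+x. \<integral>\<^sup>+y. f (x, y) \<partial>lborel \<partial>lborel)"
    and "(\<integral>\<^sup>+p. f p \<partial>lborel) = (\<integral>\<^sup>+y. \<integral>\<^sup>+x. f (x, y) \<partial>lborel \<partial>lborel)"
proof -
  have f: "f \<in> borel_measurable (lborel \<Otimes>\<^sub>M lborel)" using assms by (simp add: lborel_prod)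
  show "(\<integral>\<^sup>+p. f p \<partial>lborel) = (\<integral>\<^sup>+x. \<integral>\<^sup>+y. f (x, y) \<partial>lborel \<partial>lborel)"
    by (simp only: lborel.nn_integral_fst[OF f] lborel_prod)
  show "(\<integral>\<^sup>+p. f p \<partial>lborel) = (\<integral>\<^sup>+y. \<integral>\<^sup>+x. f (x, y) \<partial>lborel \<partial>lborel)"
    by (simp only: lborel_pair.nn_integral_snd[OF f] lborel_prod)
qed

text \<open>
  Centre and difference of the two variables \<open>(u, v)\<close> of the Weyl form; the map has determinant of absolute value \<open>1\<close>.
\<close>

definition midpoint_coords :: "'a::euclidean_space \<times> 'a \<Rightarrow> 'a \<times> 'a" where
  "midpoint_coords p = (fst p + (1/2) *\<^sub>R snd p, fst p - (1/2) *\<^sub>R snd p)"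

lemma continuous_on_midpoint_coords: "continuous_on UNIV midpoint_coords"
  unfolding midpoint_coords_def[abs_def] by (intro continuous_intros)

lemma measurable_midpoint_coords: "midpoint_coords \<in> borel_measurable borel"
  by (intro borel_measurable_continuous_onI continuous_on_midpoint_coords)

text \<open>
  Exchanging the order of integration twice, the map decomposes into two translations: first of the centre by
  \<open>s / 2\<close>, then of the difference by the other variable.
\<close>

lemma distr_midpoint_coords: "distr lborel borel midpoint_coords = (lborel :: ('a::euclidean_space \<times> 'a) measure)"
proof (rule measure_eqI)
  fix A :: "('a \<times> 'a) set" assume "A \<in> sets (distr lborel borel midpoint_coords)"
  then have A: "A \<in> sets borel" by simp
  let ?k = "indicator A :: 'a \<times> 'a \<Rightarrow> ennreal"
  have k: "?k \<in> borel_measurable borel" using A by simp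
  have k1: "(\<lambda>x. ?k (x + (1/2) *\<^sub>R s, x - (1/2) *\<^sub>R s)) \<in> borel_measurable borel" for s
    by (rule measurable_compose[OF _ k]) (intro borel_measurable_continuous_onI continuous_intros)
  have k2: "(\<lambda>s. ?k (s, x)) \<in> borel_measurable borel" for x
    by (rule measurable_compose[OF _ k]) (intro borel_measurable_continuous_onI continuous_intros)
  have k3: "(\<lambda>p. ?k (fst p + snd p, fst p)) \<in> borel_measurable borel"
    by (rule measurable_compose[OF _ k]) (intro borel_measurable_continuous_onI continuous_intros)
  have "emeasure (distr lborel borel midpoint_coords) A = (\<integral>\<^sup>+p. ?k p \<partial>distr lborel borel midpoint_coords)"
    using A by (simp add: nn_integral_indicator)
  also have "\<dots> = (\<integral>\<^sup>+p. ?k (midpoint_coords p) \<partial>lborel)"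
    using measurable_midpoint_coords k by (intro nn_integral_distr) auto
  also have "\<dots> = (\<integral>\<^sup>+s. \<integral>\<^sup>+x. ?k (x + (1/2) *\<^sub>R s, x - (1/2) *\<^sub>R s) \<partial>lborel \<partial>lborel)"
    by (subst lborel_nn_Fubini(2)) (use measurable_compose[OF measurable_midpoint_coords k] in \<open>simp_all add: midpoint_coords_def\<close>)
  also have "\<dots> = (\<integral>\<^sup>+s. \<integral>\<^sup>+x. ?k (x + s, x) \<partial>lborel \<partial>lborel)"
  proof (rule nn_integral_cong)
    fix s :: 'a
    have half: "x + (1/2) *\<^sub>R s + (1/2) *\<^sub>R s = x + s" for x by (simp add: add.assoc scaleR_add_left[symmetric])
    show "(\<integral>\<^sup>+x. ?k (x + (1/2) *\<^sub>R s, x - (1/2) *\<^sub>R s) \<partial>lborel) = (\<integral>\<^sup>+x. ?k (x + s, x) \<partial>lborel)"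
      using nn_integral_translate(1)[OF k1[of s], of "(1/2) *\<^sub>R s"] unfolding half add_diff_cancel_right' by (rule sym)
  qed
  also have "\<dots> = (\<integral>\<^sup>+x. \<integral>\<^sup>+s. ?k (x + s, x) \<partial>lborel \<partial>lborel)"
    using lborel_nn_Fubini[OF k3] by simp
  also have "\<dots> = (\<integral>\<^sup>+x. \<integral>\<^sup>+s. ?k (s, x) \<partial>lborel \<partial>lborel)"
  proof (rule nn_integral_cong)
    fix x :: 'a
    show "(\<integral>\<^sup>+s. ?k (x + s, x) \<partial>lborel) = (\<integral>\<^sup>+s. ?k (s, x) \<partial>lborel)"
      using nn_integral_translate(1)[OF k2[of x], of x] by (simp add: add.commute)
  qed
  also have "\<dots> = (\<integral>\<^sup>+p. ?k p \<partial>lborel)" by (rule lborel_nn_Fubini(2)[OF k, symmetric])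
  also have "\<dots> = emeasure lborel A" using A by (simp add: nn_integral_indicator)
  finally show "emeasure (distr lborel borel midpoint_coords) A = emeasure lborel A" .
qed simp

lemma midpoint_change_of_variables:
  fixes K :: "'a::euclidean_space \<times> 'a \<Rightarrow> complex"
  assumes "integrable lborel K"
  shows "integrable lborel (\<lambda>(x, s). K (x + (1/2) *\<^sub>R s, x - (1/2) *\<^sub>R s))"
    and "(LBINT p. K p) = (LBINT x. LBINT s. K (x + (1/2) *\<^sub>R s, x - (1/2) *\<^sub>R s))"
proof -
  have m: "midpoint_coords \<in> lborel \<rightarrow>\<^sub>M borel" "K \<in> borel_measurable borel"
    using measurable_midpoint_coords borel_measurable_integrable[OF assms] by simp_all
  have eq: "(\<lambda>p. K (midpoint_coords p)) = (\<lambda>(x, s). K (x + (1/2) *\<^sub>R s, x - (1/2) *\<^sub>R s))"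
    by (auto simp: midpoint_coords_def)
  have "integrable (distr lborel borel midpoint_coords) K" using assms by (simp only: distr_midpoint_coords)
  then have "integrable lborel (\<lambda>p. K (midpoint_coords p))" by (simp only: integrable_distr_eq[OF m])
  then show i: "integrable lborel (\<lambda>(x, s). K (x + (1/2) *\<^sub>R s, x - (1/2) *\<^sub>R s))" unfolding eq .
  have "(LBINT p. K p) = (\<integral>p. K p \<partial>distr lborel borel midpoint_coords)" by (simp only: distr_midpoint_coords)
  also have "\<dots> = (LBINT p. K (midpoint_coords p))" by (rule integral_distr[OF m])
  also have "\<dots> = (LBINT x. LBINT s. K (x + (1/2) *\<^sub>R s, x - (1/2) *\<^sub>R s))"
    unfolding eq by (rule lborel_Fubini(2)[OF i, symmetric])
  finally show "(LBINT p. K p) = (LBINT x. LBINT s. K (x + (1/2) *\<^sub>R s, x - (1/2) *\<^sub>R s))" .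
qed

definition cross :: "('a::euclidean_space \<Rightarrow> complex) \<Rightarrow> ('a \<Rightarrow> complex) \<Rightarrow> 'a \<Rightarrow> 'a \<Rightarrow> complex" where
  "cross \<phi> \<psi> x s = \<phi> (x - (1/2) *\<^sub>R s) * cnj (\<psi> (x + (1/2) *\<^sub>R s))"

text \<open>
  The cross-Wigner function without its customary constant, with frequency in units in which the phase is
  \<open>(s \<bullet> t) / h\<close>.
\<close>

definition wigner :: "real \<Rightarrow> ('a::euclidean_space \<Rightarrow> complex) \<Rightarrow> ('a \<Rightarrow> complex) \<Rightarrow> 'a \<Rightarrow> 'a \<Rightarrow> complex" where
  "wigner h \<phi> \<psi> x t = (LBINT s. exp (\<i> * of_real ((s \<bullet> t) / h)) * cross \<phi> \<psi> x s)"

abbreviation wigner_at :: "real \<Rightarrow> ('a::euclidean_space \<Rightarrow> complex) \<Rightarrow> ('a \<Rightarrow> complex) \<Rightarrow> 'a \<times> 'a \<Rightarrow> complex" where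
  "wigner_at h \<phi> \<psi> p \<equiv> (case p of (x, t) \<Rightarrow> wigner h \<phi> \<psi> x t)"

lemma integrable_tensor:
  assumes "schwartz \<phi>" "schwartz \<psi>"
  shows "integrable lborel (\<lambda>(u, v). \<phi> v * cnj (\<psi> u))"
proof -
  have "integrable lborel (\<lambda>(u, v). cnj (\<psi> u) * \<phi> v)"
    using schwartz_integrable[OF assms(1)] schwartz_integrable[OF assms(2)] by (intro integrable_lborel_pair_mult) auto
  then show ?thesis by (simp add: mult.commute)
qed

lemma integrable_cross_pair:
  assumes "schwartz \<phi>" "schwartz \<psi>"
  shows "integrable lborel (\<lambda>(x, s). cross \<phi> \<psi> x s)"
  using midpoint_change_of_variables(1)[OF integrable_tensor[OF assms]] by (simp add: cross_def)

lemma continuous_on_cross: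
  assumes "schwartz \<phi>" "schwartz \<psi>" "continuous_on S f" "continuous_on S g"
  shows "continuous_on S (\<lambda>p. cross \<phi> \<psi> (f p) (g p))"
proof -
  have "continuous_on S (\<lambda>p. \<phi> (f p - (1/2) *\<^sub>R g p))" "continuous_on S (\<lambda>p. \<psi> (f p + (1/2) *\<^sub>R g p))"
    by (rule continuous_on_compose2[OF schwartz_continuous[OF assms(1)]] continuous_on_compose2[OF schwartz_continuous[OF assms(2)]];
        (intro continuous_intros assms | simp))+
  then show ?thesis unfolding cross_def by (intro continuous_intros)
qed

lemma integrable_cross:
  fixes \<phi> \<psi> :: "'a::euclidean_space \<Rightarrow> complex"
  assumes "schwartz \<phi>" "schwartz \<psi>"
  shows "integrable lborel (cross \<phi> \<psi> x)"
proof -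
  have e: "cross \<phi> \<psi> x = (\<lambda>s. \<phi> (x + (-1/2) *\<^sub>R s) * cnj (\<psi> (x + (1/2) *\<^sub>R s)))"
    by (rule ext) (simp add: cross_def)
  obtain C where C: "\<And>x. norm (\<psi> x) \<le> C" using schwartz_bound[OF assms(2)] by metis
  have "continuous_on UNIV (\<lambda>s. \<psi> (x + (1/2) *\<^sub>R s))"
    by (rule continuous_on_compose2[OF schwartz_continuous[OF assms(2)]]) (intro continuous_intros, simp)
  then show ?thesis
    unfolding e using C
    by (intro integrable_bounded_mult[where C=C] integrable_affine schwartz_integrable assms continuous_intros) auto
qed

lemma integrable_exp_cross:
  assumes "schwartz \<phi>" "schwartz \<psi>"
  shows "integrable lborel (\<lambda>s. exp (\<i> * of_real ((s \<bullet> t) / h)) * cross \<phi> \<psi> x s)"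
proof -
  have "integrable lborel (\<lambda>s. cross \<phi> \<psi> x s * exp (\<i> * of_real ((s \<bullet> t) / h)))"
    by (rule integrable_bounded_mult[OF integrable_cross[OF assms], where C=1]) (auto simp: divide_inverse intro!: continuous_intros)
  then show ?thesis by (simp add: mult.commute)
qed

lemma has_partial_cross:
  assumes "has_partial b \<phi> \<phi>'" "has_partial b \<psi> \<psi>'"
  shows "has_partial b (cross \<phi> \<psi> x) (\<lambda>s. (1/2) * (cross \<phi> \<psi>' x s - cross \<phi>' \<psi> x s))"
  unfolding has_partial_def
proof
  fix p
  have 1: "((\<lambda>t. \<phi> (x - (1/2) *\<^sub>R (p + t *\<^sub>R b))) has_vector_derivative (-1/2) *\<^sub>R \<phi>' (x - (1/2) *\<^sub>R p)) (at 0)"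
    using has_partial_line[OF assms(1), of "x - (1/2) *\<^sub>R p" "-1/2" 0 UNIV] by (simp add: algebra_simps)
  have 2: "((\<lambda>t. \<psi> (x + (1/2) *\<^sub>R (p + t *\<^sub>R b))) has_vector_derivative (1/2) *\<^sub>R \<psi>' (x + (1/2) *\<^sub>R p)) (at 0)"
    using has_partial_line[OF assms(2), of "x + (1/2) *\<^sub>R p" "1/2" 0 UNIV] by (simp add: algebra_simps)
  show "((\<lambda>t. cross \<phi> \<psi> x (p + t *\<^sub>R b)) has_vector_derivative (1/2) * (cross \<phi> \<psi>' x p - cross \<phi>' \<psi> x p)) (at 0)"
    unfolding cross_def using has_vector_derivative_mult[OF 1 has_vector_derivative_cnj[OF 2]]
    by (simp add: scaleR_conv_of_real algebra_simps)
qed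

lemma exp_line:
  fixes c d :: complex
  shows "((\<lambda>r. exp (of_real r * c + d)) has_vector_derivative c * exp (of_real x * c + d)) (at x)"
  by (rule has_vector_derivative_real_field) (auto intro!: derivative_eq_intros)

text \<open>
  Multiplication by the frequency is a derivative in the difference variable, which falls on either \<open>\<phi>\<close> or \<open>\<psi>\<close>. The
  result is again a combination of Wigner functions of Schwartz functions, so that the step can be iterated.
\<close>

lemma wigner_times_frequency:
  fixes \<phi> \<psi> :: "'a::euclidean_space \<Rightarrow> complex"
  assumes S: "schwartz \<phi>" "schwartz \<psi>" "schwartz \<phi>'" "schwartz \<psi>'" and b: "b \<in> Basis"
    and p: "has_partial b \<phi> \<phi>'" "has_partial b \<psi> \<psi>'"
  shows "\<i> * of_real ((t \<bullet> b) / h) * wigner h \<phi> \<psi> x t = (1/2) * (wigner h \<phi>' \<psi> x t - wigner h \<phi> \<psi>' x t)"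
proof -
  let ?e = "\<lambda>s. exp (\<i> * of_real ((s \<bullet> t) / h))" and ?c = "\<i> * complex_of_real ((t \<bullet> b) / h)"
  have ce: "continuous_on UNIV ?e" by (auto simp: divide_inverse intro!: continuous_intros)
  let ?f' = "\<lambda>s. ?c * (?e s * cross \<phi> \<psi> x s) + (1/2) * (?e s * cross \<phi> \<psi>' x s - ?e s * cross \<phi>' \<psi> x s)"
  have "(LBINT s. ?f' s) = 0"
  proof (rule integral_partial_eq_0)
    show "has_partial b (\<lambda>s. ?e s * cross \<phi> \<psi> x s) ?f'"
      unfolding has_partial_def
    proof
      fix s
      have "((\<lambda>r. ?e (s + r *\<^sub>R b)) has_vector_derivative ?c * ?e s) (at 0)"
      proof -
        have "?e (s + r *\<^sub>R b) = exp (of_real r * ?c + \<i> * of_real ((s \<bullet> t) / h))" for r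
        proof -
          have "((s + r *\<^sub>R b) \<bullet> t) / h = r * ((t \<bullet> b) / h) + (s \<bullet> t) / h"
            by (simp add: inner_add_left inner_commute[of b] add_divide_distrib)
          then show ?thesis by (simp only: of_real_add of_real_mult distrib_left mult.left_commute)
        qed
        moreover have "((\<lambda>r. exp (of_real r * ?c + \<i> * of_real ((s \<bullet> t) / h))) has_vector_derivative ?c * exp (of_real 0 * ?c + \<i> * of_real ((s \<bullet> t) / h))) (at 0)"
          by (rule exp_line)
        ultimately show ?thesis by simp
      qed
      from has_vector_derivative_mult[OF this has_partial_cross[OF p, unfolded has_partial_def, rule_format]]
      show "((\<lambda>r. ?e (s + r *\<^sub>R b) * cross \<phi> \<psi> x (s + r *\<^sub>R b)) has_vector_derivative ?f' s) (at 0)"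
        by (simp add: algebra_simps)
    qed
    show "integrable lborel (\<lambda>s. ?e s * cross \<phi> \<psi> x s)" by (rule integrable_exp_cross[OF S(1,2)])
    show "integrable lborel ?f'"
      by (intro Bochner_Integration.integrable_add Bochner_Integration.integrable_diff integrable_mult_right integrable_exp_cross S)
    show "continuous_on UNIV ?f'"
      by (intro continuous_intros ce continuous_on_cross S)
  qed
  moreover have "(LBINT s. ?f' s) = ?c * wigner h \<phi> \<psi> x t + (1/2) * (wigner h \<phi> \<psi>' x t - wigner h \<phi>' \<psi> x t)"
    unfolding wigner_def
    by (simp only: Bochner_Integration.integral_add Bochner_Integration.integral_diff integral_mult_right_zero 
        integrable_mult_right Bochner_Integration.integrable_diff integrable_exp_cross S)
  ultimately show ?thesis by (simp add: algebra_simps)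
qed

lemma norm_wigner_le:
  "norm (wigner h \<phi> \<psi> x t) \<le> (LBINT s. norm (cross \<phi> \<psi> x s))"
proof -
  have "norm (wigner h \<phi> \<psi> x t) \<le> (LBINT s. norm (exp (\<i> * of_real ((s \<bullet> t) / h)) * cross \<phi> \<psi> x s))"
    unfolding wigner_def by (rule integral_norm_bound)
  then show ?thesis by (simp only: norm_mult norm_exp_i_times mult_1)
qed

lemma integrable_norm_cross:
  assumes "schwartz \<phi>" "schwartz \<psi>"
  shows "integrable lborel (\<lambda>x. LBINT s. norm (cross \<phi> \<psi> x s))"
proof -
  have "integrable (lborel \<Otimes>\<^sub>M lborel) (\<lambda>(x, s). cross \<phi> \<psi> x s)"
    using integrable_cross_pair[OF assms] by (simp add: lborel_prod)
  then have "integrable (lborel \<Otimes>\<^sub>M lborel) (\<lambda>p. norm (case p of (x, s) \<Rightarrow> cross \<phi> \<psi> x s))"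
    by (rule integrable_norm)
  from lborel_pair.integrable_fst'[OF this] show ?thesis by simp
qed

text \<open>
  Each coordinate uses \<open>wigner_times_frequency\<close> twice. The bound \<open>D\<close> does not depend on the frequency and is
  integrable in the position, because the integral of the absolute value of \<open>cross\<close> over both variables is the product of
  two $L^1$ norms.
\<close>

lemma wigner_frequency_decay:
  fixes \<phi> \<psi> :: "'a::euclidean_space \<Rightarrow> complex"
  shows "set bs \<subseteq> Basis \<Longrightarrow> schwartz \<phi> \<Longrightarrow> schwartz \<psi> \<Longrightarrow> h > 0 \<Longrightarrow>
    \<exists>D. integrable lborel D \<and> (\<forall>x t. prod_list (map (\<lambda>b. 1 + (t \<bullet> b)\<^sup>2) bs) * norm (wigner h \<phi> \<psi> x t) \<le> (D x :: real))"
proof (induction bs arbitrary: \<phi> \<psi>)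
  case Nil
  then show ?case using integrable_norm_cross norm_wigner_le
    by (intro exI[of _ "\<lambda>x. LBINT s. norm (cross \<phi> \<psi> x s)"]) auto
next
  case (Cons b bs)
  have b: "b \<in> Basis" and bs: "set bs \<subseteq> Basis" using Cons.prems by auto
  obtain \<phi>1 where \<phi>1: "has_partial b \<phi> \<phi>1" "schwartz \<phi>1" by (rule schwartz_partial[OF Cons.prems(2) b])
  obtain \<phi>2 where \<phi>2: "has_partial b \<phi>1 \<phi>2" "schwartz \<phi>2" by (rule schwartz_partial[OF \<phi>1(2) b])
  obtain \<psi>1 where \<psi>1: "has_partial b \<psi> \<psi>1" "schwartz \<psi>1" by (rule schwartz_partial[OF Cons.prems(3) b])
  obtain \<psi>2 where \<psi>2: "has_partial b \<psi>1 \<psi>2" "schwartz \<psi>2" by (rule schwartz_partial[OF \<psi>1(2) b])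
  let ?p = "\<lambda>t. prod_list (map (\<lambda>b. 1 + (t \<bullet> b)\<^sup>2) bs)"
  obtain D0 where D0: "integrable lborel D0" "\<And>x t. ?p t * norm (wigner h \<phi> \<psi> x t) \<le> D0 x"
    using Cons.IH[OF bs Cons.prems(2,3,4)] by blast
  obtain D1 where D1: "integrable lborel D1" "\<And>x t. ?p t * norm (wigner h \<phi>2 \<psi> x t) \<le> D1 x"
    using Cons.IH[OF bs \<phi>2(2) Cons.prems(3,4)] by blast
  obtain D2 where D2: "integrable lborel D2" "\<And>x t. ?p t * norm (wigner h \<phi>1 \<psi>1 x t) \<le> D2 x"
    using Cons.IH[OF bs \<phi>1(2) \<psi>1(2) Cons.prems(4)] by blast
  obtain D3 where D3: "integrable lborel D3" "\<And>x t. ?p t * norm (wigner h \<phi> \<psi>2 x t) \<le> D3 x"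
    using Cons.IH[OF bs Cons.prems(2) \<psi>2(2) Cons.prems(4)] by blast
  let ?D = "\<lambda>x. D0 x + h\<^sup>2 * (D1 x + 2 * D2 x + D3 x)"
  have "(1 + (t \<bullet> b)\<^sup>2) * ?p t * norm (wigner h \<phi> \<psi> x t) \<le> ?D x" for x t
  proof -
    have p: "0 \<le> ?p t" by (induction bs) auto
    let ?w = "wigner h \<phi> \<psi> x t" and ?w20 = "wigner h \<phi>2 \<psi> x t"
      and ?w11 = "wigner h \<phi>1 \<psi>1 x t" and ?w02 = "wigner h \<phi> \<psi>2 x t"
    let ?c = "\<i> * complex_of_real ((t \<bullet> b) / h)"
    have "?c * (?c * ?w) = (1/2) * (?c * wigner h \<phi>1 \<psi> x t - ?c * wigner h \<phi> \<psi>1 x t)"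
      unfolding wigner_times_frequency[OF Cons.prems(2,3) \<phi>1(2) \<psi>1(2) b \<phi>1(1) \<psi>1(1)] by (simp add: algebra_simps)
    also have "\<dots> = (1/4) * (?w20 - ?w11 - ?w11 + ?w02)"
      unfolding wigner_times_frequency[OF \<phi>1(2) Cons.prems(3) \<phi>2(2) \<psi>1(2) b \<phi>2(1) \<psi>1(1)]
        wigner_times_frequency[OF Cons.prems(2) \<psi>1(2) \<phi>1(2) \<psi>2(2) b \<phi>1(1) \<psi>2(1)] by (simp add: algebra_simps)
    finally have "?c * (?c * ?w) = (1/4) * (?w20 - ?w11 - ?w11 + ?w02)" .
    from arg_cong[OF this, of norm] have "norm (?c * (?c * ?w)) = norm ((1/4) * (?w20 - ?w11 - ?w11 + ?w02))" .
    also have "\<dots> \<le> norm (?w20) + norm (?w11) + norm (?w11) + norm (?w02)"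
    proof -
      have "norm ((1/4) * (w - v - v + u)) \<le> norm w + norm v + norm v + norm u" for u v w :: complex
      proof -
        have "norm (w - v - v + u) \<le> norm w + norm v + norm v + norm u"
          by (intro order_trans[OF norm_triangle_ineq] order_trans[OF norm_triangle_ineq4] add_mono order_refl)
        moreover have "norm ((1/4) * (w - v - v + u)) = norm (w - v - v + u) / 4" unfolding norm_mult by simp
        ultimately show ?thesis using norm_ge_zero[of u] norm_ge_zero[of v] norm_ge_zero[of w] by linarith
      qed
      then show ?thesis .
    qed
    finally have 1: "norm (?c * (?c * ?w)) \<le> norm (?w20) + 2 * norm (?w11) + norm (?w02)" by simp
    have "(t \<bullet> b)\<^sup>2 * norm (?w) = h\<^sup>2 * norm (?c * (?c * ?w))"
      using Cons.prems(4) by (simp add: norm_mult norm_divide power2_eq_square abs_mult[symmetric])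
    also have "\<dots> \<le> h\<^sup>2 * (norm (?w20) + 2 * norm (?w11) + norm (?w02))"
      by (intro mult_left_mono 1) simp
    finally have "?p t * ((t \<bullet> b)\<^sup>2 * norm (?w)) \<le> ?p t * (h\<^sup>2 * (norm (?w20) + 2 * norm (?w11) + norm (?w02)))"
      by (rule mult_left_mono[OF _ p])
    also have "\<dots> = h\<^sup>2 * (?p t * norm (?w20) + 2 * (?p t * norm (?w11)) + ?p t * norm (?w02))"
      by (simp add: algebra_simps)
    also have "\<dots> \<le> h\<^sup>2 * (D1 x + 2 * D2 x + D3 x)"
      by (intro mult_left_mono add_mono D1 D2 D3) auto
    finally have "?p t * ((t \<bullet> b)\<^sup>2 * norm (?w)) \<le> h\<^sup>2 * (D1 x + 2 * D2 x + D3 x)" .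
    then show ?thesis using D0(2)[of t x] by (simp add: algebra_simps)
  qed
  moreover have "integrable lborel ?D"
    by (intro Bochner_Integration.integrable_add integrable_mult_right D0 D1 D2 D3)
  ultimately show ?case by (intro exI[of _ ?D]) simp
qed

lemma integrable_wigner:
  fixes \<phi> \<psi> :: "'a::euclidean_space \<Rightarrow> complex"
  assumes S: "schwartz \<phi>" "schwartz \<psi>" and h: "h > 0"
  shows "integrable lborel (\<lambda>(x, t). wigner h \<phi> \<psi> x t)"
proof -
  obtain bs :: "'a list" where bs: "set bs = Basis" "distinct bs" using finite_distinct_list[OF finite_Basis] by blast
  obtain D where D: "integrable lborel D" "\<And>x t. prod_list (map (\<lambda>b. 1 + (t \<bullet> b)\<^sup>2) bs) * norm (wigner h \<phi> \<psi> x t) \<le> D x"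
    using wigner_frequency_decay[of bs] bs S h by blast
  have bound: "norm (wigner h \<phi> \<psi> x t) \<le> D x * cauchy_weight t" for x t
  proof -
    have P: "prod_list (map (\<lambda>b. 1 + (t \<bullet> b)\<^sup>2) bs) = (\<Prod>b\<in>Basis. 1 + (t \<bullet> b)\<^sup>2)"
      using prod.distinct_set_conv_list[OF bs(2), of "\<lambda>b. 1 + (t \<bullet> b)\<^sup>2"] bs(1) by simp
    have pos: "(\<Prod>b\<in>Basis. 1 + (t \<bullet> b)\<^sup>2) > 0" by (intro prod_pos) (simp add: add_pos_nonneg)
    show ?thesis using D(2)[of t x] pos unfolding P
      by (simp add: cauchy_weight_def prod_inversef[unfolded o_def] divide_inverse[symmetric] pos_le_divide_eq mult.commute)
  qed
  show ?thesis
  proof (rule integrable_dominated)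
    show "integrable lborel (\<lambda>(x, t). complex_of_real (D x) * complex_of_real (cauchy_weight t))"
      by (intro integrable_lborel_pair_mult integrable_of_real D integrable_cauchy_weight)
    have "(\<lambda>q::('a \<times> 'a) \<times> 'a. exp (\<i> * of_real ((snd q \<bullet> snd (fst q)) / h)) * cross \<phi> \<psi> (fst (fst q)) (snd q)) \<in> borel_measurable borel"
      unfolding divide_inverse by (intro borel_measurable_continuous_onI continuous_intros continuous_on_cross S)
    then have "(\<lambda>(p, s). exp (\<i> * of_real ((s \<bullet> snd p) / h)) * cross \<phi> \<psi> (fst p) s) \<in> borel_measurable (borel \<Otimes>\<^sub>M lborel)"
      by (simp add: split_beta' borel_measurable_pair_lborel)
    then have "(\<lambda>(x, t). wigner h \<phi> \<psi> x t) \<in> borel_measurable borel"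
      unfolding wigner_def split_beta'
      by (rule lborel.borel_measurable_lebesgue_integral[unfolded split_beta'])
    then show "(\<lambda>(x, t). wigner h \<phi> \<psi> x t) \<in> borel_measurable lborel" by simp
    show "AE p in lborel. norm (wigner_at h \<phi> \<psi> p) \<le> norm (case p of (x, t) \<Rightarrow> complex_of_real (D x) * complex_of_real (cauchy_weight t))"
      using bound by (intro always_eventually) (auto simp: norm_mult abs_mult[symmetric] intro: order_trans[OF _ abs_ge_self])
  qed
qed

section \<open>The Weyl form as a pairing with the Wigner function\<close>

text \<open>
  After passing to centre and difference, the inner integral of the Weyl form at frequency \<open>t\<close> is the integral of
  \<open>F (x, t)\<close> against the Wigner function over the positions \<open>x\<close>. Integrability in \<open>t\<close> is thus inherited from that of the
  Wigner function, for any bounded continuous \<open>F\<close>.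
\<close>

lemma has_weyl_form_wigner:
  fixes F :: "(real^'n) \<times> (real^'n) \<Rightarrow> complex"
  assumes S: "schwartz \<phi>" "schwartz \<psi>" and h: "h > 0"
    and F: "continuous_on UNIV F" "\<And>p. norm (F p) \<le> M"
  shows "has_weyl_form h F \<phi> \<psi> (of_real (1 / (2 * pi * h) ^ CARD('n)) * (LBINT p. F p * (wigner_at h \<phi> \<psi> p)))"
proof -
  let ?K = "\<lambda>t. weyl_integrand h F \<phi> \<psi> t"
  have int: "integrable lborel (?K t)" for t
  proof -
    have c: "continuous_on UNIV (\<lambda>p::(real^'n) \<times> (real^'n). F ((1/2) *\<^sub>R (fst p + snd p), t))"
      by (rule continuous_on_compose2[OF F(1)]) (intro continuous_intros, simp)
    have "integrable lborel (\<lambda>p. (case p of (u, v) \<Rightarrow> \<phi> v * cnj (\<psi> u)) * 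
      (exp (\<i> * of_real (((fst p - snd p) \<bullet> t) / h)) * F ((1/2) *\<^sub>R (fst p + snd p), t)))"
    proof (rule integrable_bounded_mult[OF integrable_tensor[OF S]])
      show "continuous_on UNIV (\<lambda>p. exp (\<i> * complex_of_real (((fst p - snd p) \<bullet> t) / h)) * F ((1/2) *\<^sub>R (fst p + snd p), t))"
        unfolding divide_inverse[of _ h] by (intro continuous_on_mult[OF _ c] continuous_intros)
      show "norm (exp (\<i> * complex_of_real (((fst p - snd p) \<bullet> t) / h)) * F ((1/2) *\<^sub>R (fst p + snd p), t)) \<le> M" for p
        unfolding norm_mult norm_exp_i_times mult_1 by (rule F(2))
    qed
    then show ?thesis by (simp add: weyl_integrand_def split_beta' mult_ac)
  qed
  have val: "(LBINT p. ?K t p) = (LBINT x. F (x, t) * wigner h \<phi> \<psi> x t)" for t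
  proof -
    have "(LBINT p. ?K t p) = (LBINT x. LBINT s. ?K t (x + (1/2) *\<^sub>R s, x - (1/2) *\<^sub>R s))"
      by (rule midpoint_change_of_variables(2)[OF int])
    also have "\<dots> = (LBINT x. LBINT s. F (x, t) * (exp (\<i> * of_real ((s \<bullet> t) / h)) * cross \<phi> \<psi> x s))"
    proof -
      have "x + (1/2) *\<^sub>R s - (x - (1/2) *\<^sub>R s) = s" "(1/2) *\<^sub>R (x + (1/2) *\<^sub>R s + (x - (1/2) *\<^sub>R s)) = x" for x s :: "real^'n"
        by (simp_all add: scaleR_add_left[symmetric] scaleR_2[symmetric])
      then show ?thesis by (simp add: weyl_integrand_def cross_def mult_ac)
    qed
    also have "\<dots> = (LBINT x. F (x, t) * wigner h \<phi> \<psi> x t)"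
      unfolding wigner_def integral_mult_right_zero ..
    finally show ?thesis .
  qed
  have "integrable lborel (\<lambda>p. (wigner_at h \<phi> \<psi> p) * F p)"
    by (rule integrable_bounded_mult[OF integrable_wigner[OF S h] F])
  then have i: "integrable lborel (\<lambda>(x, t). F (x, t) * wigner h \<phi> \<psi> x t)"
    by (simp add: split_beta' mult.commute)
  have "(LBINT t. LBINT x. F (x, t) * wigner h \<phi> \<psi> x t) = (LBINT p. F p * (wigner_at h \<phi> \<psi> p))"
    unfolding lborel_Fubini(1)[OF i, symmetric] lborel_Fubini(2)[OF i] by (simp add: split_beta')
  then show ?thesis
    unfolding has_weyl_form_def val using int lborel_Fubini(4)[OF i] by simp
qed

section \<open>A Bessel inequality for the Gaussian-windowed Fourier transform\<close>

lemma exp_eq_gauss: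
  fixes z :: "'a::euclidean_space"
  assumes "\<sigma> > 0"
  shows "exp (- (norm z)\<^sup>2 / (2 * \<sigma>\<^sup>2)) = sqrt (2 * pi * \<sigma>\<^sup>2) ^ DIM('a) * gauss \<sigma> z"
  using assms by (simp add: gauss_eq power_one_over)

lemma gauss_le:
  fixes z :: "'a::euclidean_space"
  shows "gauss \<sigma> z \<le> (1 / sqrt (2 * pi * \<sigma>\<^sup>2)) ^ DIM('a)"
  unfolding gauss_eq by (rule mult_left_le) (auto intro!: divide_nonpos_nonneg)

definition fourier :: "real \<Rightarrow> ('a::euclidean_space \<Rightarrow> complex) \<Rightarrow> 'a \<Rightarrow> complex" where
  "fourier h f \<xi> = (LBINT v. exp (- \<i> * of_real ((v \<bullet> \<xi>) / h)) * f v)"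

lemma continuous_on_exp_inner:
  fixes f g :: "'b::topological_space \<Rightarrow> 'a::euclidean_space"
  assumes "continuous_on S f" "continuous_on S g"
  shows "continuous_on S (\<lambda>p. exp (c * complex_of_real ((f p \<bullet> g p) / h)))"
  unfolding divide_inverse[of _ h] by (intro continuous_intros assms)

lemma integrable_exp_mult:
  fixes f :: "'a::euclidean_space \<Rightarrow> complex"
  assumes "integrable lborel f"
  shows "integrable lborel (\<lambda>v. exp (- \<i> * of_real ((v \<bullet> \<xi>) / h)) * f v)"
proof -
  have "integrable lborel (\<lambda>v. f v * exp (- \<i> * of_real ((v \<bullet> \<xi>) / h)))"
    by (rule integrable_bounded_mult[OF assms continuous_on_exp_inner, where C=1]) (auto intro: continuous_intros)
  then show ?thesis by (simp add: mult.commute)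
qed

lemma borel_measurable_fourier:
  assumes "(\<lambda>p. f (fst p) (snd p)) \<in> borel_measurable borel"
  shows "(\<lambda>p. fourier h (f (fst p)) (snd p)) \<in> borel_measurable (borel :: ('b::euclidean_space \<times> 'a::euclidean_space) measure)"
proof -
  have "(\<lambda>q::('b \<times> 'a) \<times> 'a. f (fst (fst q)) (snd q)) \<in> borel_measurable borel"
    using measurable_compose[OF borel_measurable_continuous_onI assms, of "\<lambda>q::('b \<times> 'a) \<times> 'a. (fst (fst q), snd q)"]
    by (simp add: continuous_intros)
  moreover have "(\<lambda>q::('b \<times> 'a) \<times> 'a. exp (- \<i> * of_real ((snd q \<bullet> snd (fst q)) / h))) \<in> borel_measurable borel"
    by (intro borel_measurable_continuous_onI continuous_on_exp_inner continuous_intros)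
  ultimately have "(\<lambda>q::('b \<times> 'a) \<times> 'a. exp (- \<i> * of_real ((snd q \<bullet> snd (fst q)) / h)) * f (fst (fst q)) (snd q)) \<in> borel_measurable borel"
    by (rule borel_measurable_times[rotated])
  then have "(\<lambda>(p, v). exp (- \<i> * of_real ((v \<bullet> snd p) / h)) * f (fst p) v) \<in> borel_measurable (borel \<Otimes>\<^sub>M lborel)"
    by (simp add: split_beta' borel_measurable_pair_lborel)
  then show ?thesis
    unfolding fourier_def by (rule lborel.borel_measurable_lebesgue_integral)
qed

text \<open>
  Schur's test for a convolution kernel of integral \<open>1\<close>: the product of two values is at most half
  the sum of their squares, and either square integrates to the same value.
\<close>

lemma gauss_schur:
  fixes f :: "'a::euclidean_space \<Rightarrow> complex"
  assumes L2: "L2_fun f" and s: "s > 0"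
  shows "(\<integral>\<^sup>+p. ennreal (gauss s (fst p - snd p) * norm (f (fst p) * cnj (f (snd p)))) \<partial>lborel) \<le> ennreal ((L2_norm f)\<^sup>2)"
proof -
  have m[measurable]: "f \<in> borel_measurable borel" by (rule L2_fun_measurable[OF L2])
  let ?T = "\<lambda>p. f (fst p) * cnj (f (snd p))" and ?g = "\<lambda>p::'a \<times> 'a. gauss s (fst p - snd p)"
  have conv1: "(\<integral>\<^sup>+u. \<integral>\<^sup>+v. ennreal (gauss s (u - v)) * ennreal ((norm (f u))\<^sup>2) \<partial>lborel \<partial>lborel) = ennreal ((L2_norm f)\<^sup>2)"
    using nn_integral_translate(3)[of "\<lambda>w::'a. ennreal (gauss s w)"] s
    by (simp add: nn_integral_multc nn_integral_gauss L2_norm_sq_nn[OF L2])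
  have conv2: "(\<integral>\<^sup>+v. \<integral>\<^sup>+u. ennreal (gauss s (u - v)) * ennreal ((norm (f v))\<^sup>2) \<partial>lborel \<partial>lborel) = ennreal ((L2_norm f)\<^sup>2)"
    using nn_integral_translate(2)[of "\<lambda>w::'a. ennreal (gauss s w)"] s
    by (simp add: nn_integral_multc nn_integral_gauss L2_norm_sq_nn[OF L2])
  have mg: "(\<lambda>p::'a \<times> 'a. ennreal (?g p)) \<in> borel_measurable borel"
    by (intro measurable_compose[OF _ measurable_ennreal] borel_measurable_continuous_onI continuous_intros)
  have mf: "(\<lambda>p::'a \<times> 'a. ennreal ((norm (f (fst p)))\<^sup>2)) \<in> borel_measurable borel"
    "(\<lambda>p::'a \<times> 'a. ennreal ((norm (f (snd p)))\<^sup>2)) \<in> borel_measurable borel"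
    unfolding borel_prod[symmetric] by measurable
  let ?A = "\<lambda>p. ennreal (?g p) * ennreal ((norm (f (fst p)))\<^sup>2)"
  let ?B = "\<lambda>p. ennreal (?g p) * ennreal ((norm (f (snd p)))\<^sup>2)"
  have mA: "?A \<in> borel_measurable borel" "?B \<in> borel_measurable borel"
    by (intro borel_measurable_times_ennreal mg mf)+
  have "(\<integral>\<^sup>+p. ennreal (?g p * norm (?T p)) \<partial>lborel) \<le> (\<integral>\<^sup>+p. ennreal (1/2) * (?A p + ?B p) \<partial>lborel)"
  proof (rule nn_integral_mono)
    fix p :: "'a \<times> 'a"
    have "norm (?T p) \<le> (1/2) * ((norm (f (fst p)))\<^sup>2 + (norm (f (snd p)))\<^sup>2)"
      using zero_le_power2[of "norm (f (fst p)) - norm (f (snd p))"] by (simp add: norm_mult power2_eq_square algebra_simps)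
    then have "?g p * norm (?T p) \<le> ?g p * ((1/2) * ((norm (f (fst p)))\<^sup>2 + (norm (f (snd p)))\<^sup>2))"
      by (intro mult_left_mono) auto
    also have "\<dots> = (1/2) * (?g p * (norm (f (fst p)))\<^sup>2 + ?g p * (norm (f (snd p)))\<^sup>2)"
      by (simp add: algebra_simps)
    finally have "ennreal (?g p * norm (?T p)) \<le> ennreal ((1/2) * (?g p * (norm (f (fst p)))\<^sup>2 + ?g p * (norm (f (snd p)))\<^sup>2))"
      by (rule ennreal_leI)
    also have "\<dots> = ennreal (1/2) * (?A p + ?B p)"
      by (simp only: ennreal_mult' ennreal_plus ennreal_mult'' gauss_nonneg zero_le_power2 mult_nonneg_nonneg)
    finally show "ennreal (?g p * norm (?T p)) \<le> ennreal (1/2) * (?A p + ?B p)" .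
  qed
  also have "\<dots> = ennreal (1/2) * ((\<integral>\<^sup>+p. ?A p \<partial>lborel) + (\<integral>\<^sup>+p. ?B p \<partial>lborel))"
    using mA by (simp add: nn_integral_cmult nn_integral_add)
  also have "(\<integral>\<^sup>+p. ?A p \<partial>lborel) = ennreal ((L2_norm f)\<^sup>2)"
    unfolding lborel_nn_Fubini(1)[OF mA(1)] using conv1 by simp
  also have "(\<integral>\<^sup>+p. ?B p \<partial>lborel) = ennreal ((L2_norm f)\<^sup>2)"
    unfolding lborel_nn_Fubini(2)[OF mA(2)] using conv2 by simp
  also have "ennreal (1/2) * (ennreal ((L2_norm f)\<^sup>2) + ennreal ((L2_norm f)\<^sup>2)) = ennreal ((L2_norm f)\<^sup>2)"
  proof -
    have "ennreal (1/2) * (ennreal a + ennreal a) = ennreal a" if "0 \<le> a" for a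
    proof -
      have "ennreal a + ennreal a = ennreal (a + a)" using that by (intro ennreal_plus[symmetric])
      moreover have "ennreal (1/2) * ennreal (a + a) = ennreal ((1/2) * (a + a))" using that by (intro ennreal_mult[symmetric]) auto
      ultimately show ?thesis by simp
    qed
    then show ?thesis by simp
  qed
  finally show ?thesis .
qed

text \<open>
  With the Gaussian factor, the square of the transform may be integrated over the frequency first. This produces a
  Gaussian kernel in \<open>u - v\<close> of width \<open>h / \<sigma>\<close>, to which Schur's test applies. The constants of the two
  Gaussians multiply to \<open>(2 * pi * h)\<close> to the power of the dimension, whatever \<open>\<sigma>\<close> is.
\<close>

lemma fourier_damped_le:
  fixes f :: "'a::euclidean_space \<Rightarrow> complex"
  assumes f: "integrable lborel f" and L2: "L2_fun f" and h: "h > 0" and \<sigma>: "\<sigma> > 0"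
  shows "(\<integral>\<^sup>+\<xi>. ennreal ((norm (fourier h f \<xi>))\<^sup>2 * exp (- (norm \<xi>)\<^sup>2 / (2 * \<sigma>\<^sup>2))) \<partial>lborel) \<le> ennreal ((2 * pi * h) ^ DIM('a) * (L2_norm f)\<^sup>2)"
proof -
  have m[measurable]: "f \<in> borel_measurable borel" using f by auto
  let ?T = "\<lambda>p. f (fst p) * cnj (f (snd p))"
  have T: "integrable lborel ?T"
    using integrable_lborel_pair_mult[OF f, of "\<lambda>v. cnj (f v)"] f by (simp add: split_beta')
  \<comment> \<open>the width of the Fourier transform of the damping factor\<close>
  define s where "s = h / \<sigma>"
  have s: "s > 0" using h \<sigma> by (simp add: s_def)
  let ?c = "\<lambda>s. sqrt (2 * pi * s\<^sup>2) ^ DIM('a)"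
  let ?K = "\<lambda>\<xi> p. exp (\<i> * of_real (((1 / h) *\<^sub>R (snd p - fst p)) \<bullet> \<xi>)) :: complex"
  let ?g = "\<lambda>p::'a \<times> 'a. gauss s (fst p - snd p)" and ?N = "\<lambda>\<xi>. (norm (fourier h f \<xi>))\<^sup>2"
    and ?G = "\<lambda>\<xi>::'a. complex_of_real (gauss \<sigma> \<xi>)"
  have ff: "fourier h f \<xi> * cnj (fourier h f \<xi>) = (LBINT p. ?K \<xi> p * ?T p)" for \<xi>
  proof -
    let ?e = "\<lambda>v. exp (- \<i> * of_real ((v \<bullet> \<xi>) / h)) * f v"
    have i: "integrable lborel ?e" "integrable lborel (\<lambda>v. cnj (?e v))"
      by (intro integrable_exp_mult f integrable_bounded_linear[OF bounded_linear_cnj])+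
    have "fourier h f \<xi> * cnj (fourier h f \<xi>) = (LBINT u. LBINT v. ?e u * cnj (?e v))"
      unfolding fourier_def Bochner_Integration.integral_cnj[symmetric] integral_mult_right_zero integral_mult_left_zero ..
    also have "\<dots> = (LBINT p. (case p of (u, v) \<Rightarrow> ?e u * cnj (?e v)))"
      by (rule lborel_Fubini(2)[OF integrable_lborel_pair_mult[OF i]])
    also have "\<dots> = (LBINT p. ?K \<xi> p * ?T p)"
      by (intro integral_eqI)
         (auto simp: exp_cnj exp_add[symmetric] inner_diff_left diff_divide_distrib mult_ac algebra_simps mult_exp_exp)
    finally show ?thesis .
  qed
  have int: "integrable lborel (\<lambda>(\<xi>, p). ?K \<xi> p * ?G \<xi> * ?T p)"
    by (rule lborel_Fubini_bounded[OF integrable_of_real_gauss[OF \<sigma>] T, where C=1])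
       (use h in \<open>auto simp: split_beta' intro!: borel_measurable_continuous_onI continuous_intros\<close>)
  have "(LBINT \<xi>. complex_of_real (gauss \<sigma> \<xi> * ?N \<xi>))
    = (LBINT \<xi>. LBINT p. ?K \<xi> p * ?G \<xi> * ?T p)"
  proof (rule integral_eqI)
    fix \<xi> :: 'a
    have "complex_of_real (gauss \<sigma> \<xi> * ?N \<xi>) = ?G \<xi> * (LBINT p. ?K \<xi> p * ?T p)"
      unfolding of_real_mult complex_norm_square ff ..
    also have "\<dots> = (LBINT p. ?G \<xi> * (?K \<xi> p * ?T p))" by (rule integral_mult_right_zero[symmetric])
    finally show "complex_of_real (gauss \<sigma> \<xi> * ?N \<xi>) = (LBINT p. ?K \<xi> p * ?G \<xi> * ?T p)"
      by (simp only: mult_ac)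
  qed
  also have "\<dots> = (LBINT p. LBINT \<xi>. ?K \<xi> p * ?G \<xi> * ?T p)"
    by (rule lborel_Fubini(1)[OF int])
  also have "\<dots> = (LBINT p. of_real (?c s * ?g p) * ?T p)"
  proof (rule integral_eqI)
    fix p :: "'a \<times> 'a"
    have "(LBINT \<xi>. ?K \<xi> p * ?G \<xi> * ?T p) = (LBINT \<xi>. ?G \<xi> * ?K \<xi> p) * ?T p"
      unfolding integral_mult_left_zero by (simp only: mult.commute)
    also have "(LBINT \<xi>. ?G \<xi> * ?K \<xi> p) = exp (- of_real (\<sigma>\<^sup>2 * (norm ((1 / h) *\<^sub>R (snd p - fst p)))\<^sup>2 / 2))"
      by (rule gauss_char(2)[OF \<sigma>])
    also have "\<dots> = of_real (exp (- (norm (fst p - snd p))\<^sup>2 / (2 * s\<^sup>2)))"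
    proof -
      have "\<sigma>\<^sup>2 * (norm ((1 / h) *\<^sub>R (snd p - fst p)))\<^sup>2 / 2 = (norm (fst p - snd p))\<^sup>2 / (2 * s\<^sup>2)"
      proof -
        have "norm ((1 / h) *\<^sub>R (snd p - fst p)) = norm (fst p - snd p) / h"
          unfolding norm_scaleR norm_minus_commute[of "snd p"] using h by simp
        then show ?thesis using h \<sigma> by (simp only: s_def power_divide) (simp add: field_simps)
      qed
      then show ?thesis by (simp only: exp_of_real[symmetric] of_real_minus[symmetric] minus_divide_left[symmetric])
    qed
    also have "\<dots> = of_real (?c s * ?g p)"
      unfolding exp_eq_gauss[OF s] ..
    finally show "(LBINT \<xi>. ?K \<xi> p * ?G \<xi> * ?T p) = of_real (?c s * ?g p) * ?T p" .
  qed
  finally have eq: "complex_of_real (LBINT \<xi>. gauss \<sigma> \<xi> * ?N \<xi>) = (LBINT p. of_real (?c s * ?g p) * ?T p)"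
    by (simp only: integral_complex_of_real)
  have "norm (complex_of_real (LBINT \<xi>. gauss \<sigma> \<xi> * ?N \<xi>)) \<le> ?c s * (L2_norm f)\<^sup>2"
  proof -
    have "ennreal (norm (LBINT p. of_real (?c s * ?g p) * ?T p)) 
      \<le> (\<integral>\<^sup>+p. ennreal (norm (of_real (?c s * ?g p) * ?T p)) \<partial>lborel)"
    proof (rule integral_norm_bound_ennreal)
      have "integrable lborel (\<lambda>p. ?T p * of_real (?c s * ?g p))"
      proof (rule integrable_bounded_mult[OF T])
        show "continuous_on UNIV (\<lambda>p::'a \<times> 'a. complex_of_real (?c s * ?g p))"
          by (intro continuous_intros)
        show "norm (complex_of_real (?c s * ?g p)) \<le> ?c s * (1 / sqrt (2 * pi * s\<^sup>2)) ^ DIM('a)" for p :: "'a \<times> 'a"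
        proof -
          have "norm (complex_of_real (?c s * ?g p)) = ?c s * ?g p"
            unfolding norm_of_real by (rule abs_of_nonneg) (intro mult_nonneg_nonneg, simp_all)
          also have "\<dots> \<le> ?c s * (1 / sqrt (2 * pi * s\<^sup>2)) ^ DIM('a)"
            by (intro mult_left_mono gauss_le) simp
          finally show ?thesis .
        qed
      qed
      then show "integrable lborel (\<lambda>p. of_real (?c s * ?g p) * ?T p)" by (simp add: mult.commute)
    qed
    also have "\<dots> = (\<integral>\<^sup>+p. ennreal (?c s) * ennreal (?g p * norm (?T p)) \<partial>lborel)"
    proof (rule nn_integral_cong)
      fix p :: "'a \<times> 'a"
      have c: "0 \<le> ?c s" by simp
      show "ennreal (norm (of_real (?c s * ?g p) * ?T p)) = ennreal (?c s) * ennreal (?g p * norm (?T p))"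
        by (simp only: norm_mult[of "of_real _"] norm_of_real abs_mult abs_of_nonneg[OF c] abs_of_nonneg[OF gauss_nonneg] 
            mult.assoc[of "?c s"] ennreal_mult'[OF c, symmetric])
    qed
    also have "\<dots> = ennreal (?c s) * (\<integral>\<^sup>+p. ennreal (?g p * norm (?T p)) \<partial>lborel)"
    proof (rule nn_integral_cmult)
      have "(\<lambda>p::'a \<times> 'a. ?g p) \<in> borel_measurable borel"
        by (intro borel_measurable_continuous_onI continuous_intros)
      then show "(\<lambda>p. ennreal (?g p * norm (?T p))) \<in> borel_measurable lborel"
        using borel_measurable_integrable[OF T] by simp
    qed
    also have "\<dots> \<le> ennreal (?c s) * ennreal ((L2_norm f)\<^sup>2)" by (rule mult_left_mono[OF gauss_schur[OF L2 s]]) simp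
    also have "\<dots> = ennreal (?c s * (L2_norm f)\<^sup>2)" by (simp add: ennreal_mult')
    finally show ?thesis unfolding eq by (rule ennreal_le_iff[THEN iffD1, rotated]) simp
  qed
  then have real_bound: "(LBINT \<xi>. gauss \<sigma> \<xi> * ?N \<xi>) \<le> ?c s * (L2_norm f)\<^sup>2"
    by (simp only: norm_of_real abs_le_iff)
  have ig: "integrable lborel (\<lambda>\<xi>. gauss \<sigma> \<xi> * ?N \<xi>)"
  proof -
    have "integrable lborel (\<lambda>\<xi>. LBINT p. ?K \<xi> p * ?G \<xi> * ?T p)"
      by (rule lborel_Fubini(3)[OF int])
    moreover have "(LBINT p. ?K \<xi> p * ?G \<xi> * ?T p) = complex_of_real (gauss \<sigma> \<xi> * ?N \<xi>)" for \<xi>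
    proof -
      have "(LBINT p. ?K \<xi> p * ?G \<xi> * ?T p) = (LBINT p. ?G \<xi> * (?K \<xi> p * ?T p))"
        by (simp only: mult_ac)
      also have "\<dots> = ?G \<xi> * (LBINT p. ?K \<xi> p * ?T p)" by (rule integral_mult_right_zero)
      finally show ?thesis unfolding of_real_mult complex_norm_square ff .
    qed
    ultimately have "integrable lborel (\<lambda>\<xi>. complex_of_real (gauss \<sigma> \<xi> * ?N \<xi>))" by simp
    then show ?thesis by (simp only: complex_of_real_integrable_eq)
  qed
  have "(\<integral>\<^sup>+\<xi>. ennreal (?N \<xi> * exp (- (norm \<xi>)\<^sup>2 / (2 * \<sigma>\<^sup>2))) \<partial>lborel)
    = (\<integral>\<^sup>+\<xi>. ennreal (?c \<sigma> * (gauss \<sigma> \<xi> * ?N \<xi>)) \<partial>lborel)"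
    unfolding exp_eq_gauss[OF \<sigma>] by (simp only: mult_ac)
  also have "\<dots> = ennreal (LBINT \<xi>. ?c \<sigma> * (gauss \<sigma> \<xi> * ?N \<xi>))"
    by (rule nn_integral_eq_integral) (auto intro!: integrable_mult_right ig)
  also have "\<dots> \<le> ennreal (?c \<sigma> * (?c s * (L2_norm f)\<^sup>2))"
    unfolding integral_mult_right_zero by (intro ennreal_leI mult_left_mono real_bound) simp
  also have "?c \<sigma> * (?c s * (L2_norm f)\<^sup>2) = (2 * pi * h) ^ DIM('a) * (L2_norm f)\<^sup>2"
  proof -
    have "sqrt (2 * pi * \<sigma>\<^sup>2) * sqrt (2 * pi * s\<^sup>2) = sqrt ((2 * pi * h)\<^sup>2)"
      unfolding real_sqrt_mult[symmetric] using h \<sigma> by (simp add: s_def power2_eq_square field_simps)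
    also have "\<dots> = 2 * pi * h" using h by (intro real_sqrt_unique) simp_all
    finally show ?thesis unfolding mult.assoc[symmetric] power_mult_distrib[symmetric] by simp
  qed
  finally show ?thesis .
qed

text \<open>
  The damping is removed by Fatou's lemma as \<open>\<sigma>\<close> tends to infinity; its bound does not depend on \<open>\<sigma>\<close>.
\<close>

lemma fourier_Bessel:
  fixes f :: "'a::euclidean_space \<Rightarrow> complex"
  assumes f: "integrable lborel f" and L2: "L2_fun f" and h: "h > 0"
  shows "(\<integral>\<^sup>+\<xi>. ennreal ((norm (fourier h f \<xi>))\<^sup>2) \<partial>lborel) \<le> ennreal ((2 * pi * h) ^ DIM('a) * (L2_norm f)\<^sup>2)"
proof -
  have "(\<lambda>p::'a \<times> 'a. f (snd p)) \<in> borel_measurable borel"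
    using f unfolding borel_prod[symmetric] by measurable
  then have "(\<lambda>p::'a \<times> 'a. fourier h f (snd p)) \<in> borel_measurable borel"
    by (rule borel_measurable_fourier)
  then have m: "fourier h f \<in> borel_measurable borel"
  proof -
    assume a: "(\<lambda>p::'a \<times> 'a. fourier h f (snd p)) \<in> borel_measurable borel"
    have "(\<lambda>\<xi>::'a. (0::'a, \<xi>)) \<in> borel_measurable borel"
      by (intro borel_measurable_continuous_onI continuous_intros)
    from measurable_compose[OF this a] show ?thesis by simp
  qed
  let ?d = "\<lambda>k \<xi>. ennreal ((norm (fourier h f \<xi>))\<^sup>2 * exp (- (norm \<xi>)\<^sup>2 / (2 * (real (Suc k))\<^sup>2)))"
  have "(\<integral>\<^sup>+\<xi>. ennreal ((norm (fourier h f \<xi>))\<^sup>2) \<partial>lborel) = (\<integral>\<^sup>+\<xi>. liminf (\<lambda>k. ?d k \<xi>) \<partial>lborel)"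
  proof (rule nn_integral_cong)
    fix \<xi> :: 'a
    have "(\<lambda>k. - (norm \<xi>)\<^sup>2 / 2 * (inverse (real (Suc k)))\<^sup>2) \<longlonglongrightarrow> - (norm \<xi>)\<^sup>2 / 2 * 0\<^sup>2"
      by (intro tendsto_intros LIMSEQ_inverse_real_of_nat)
    moreover have "- (norm \<xi>)\<^sup>2 / 2 * (inverse (real (Suc k)))\<^sup>2 = - (norm \<xi>)\<^sup>2 / (2 * (real (Suc k))\<^sup>2)" for k
      by (simp only: inverse_eq_divide power_divide power_one times_divide_times_eq mult_1_right)
    ultimately have "(\<lambda>k. - (norm \<xi>)\<^sup>2 / (2 * (real (Suc k))\<^sup>2)) \<longlonglongrightarrow> 0"
      by (simp only: power_zero_numeral mult_zero_right)
    then have "(\<lambda>k. ?d k \<xi>) \<longlonglongrightarrow> ennreal ((norm (fourier h f \<xi>))\<^sup>2 * exp 0)"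
      by (intro tendsto_ennrealI tendsto_intros)
    then show "ennreal ((norm (fourier h f \<xi>))\<^sup>2) = liminf (\<lambda>k. ?d k \<xi>)"
      by (intro lim_imp_Liminf[symmetric]) simp_all
  qed
  also have "\<dots> \<le> liminf (\<lambda>k. \<integral>\<^sup>+\<xi>. ?d k \<xi> \<partial>lborel)"
    by (rule nn_integral_liminf) (use m in measurable)
  also have "\<dots> \<le> ennreal ((2 * pi * h) ^ DIM('a) * (L2_norm f)\<^sup>2)"
  proof (rule Liminf_le)
    show "eventually (\<lambda>k. (\<integral>\<^sup>+\<xi>. ?d k \<xi> \<partial>lborel) \<le> ennreal ((2 * pi * h) ^ DIM('a) * (L2_norm f)\<^sup>2)) sequentially"
      by (intro always_eventually allI fourier_damped_le[OF f L2 h]) simp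
  qed simp
  finally show ?thesis .
qed

section \<open>Averages of the Wigner function\<close>

text \<open>
  The Fourier transform with a Gaussian window centred at the position, also known as FBI or Bargmann transform: up to
  normalisation, the inner product with a coherent state.
\<close>

definition fbi :: "real \<Rightarrow> ('a::euclidean_space \<Rightarrow> complex) \<Rightarrow> 'a \<times> 'a \<Rightarrow> complex" where
  "fbi h \<phi> p = fourier h (\<lambda>v. of_real (exp (- (norm (v - fst p))\<^sup>2 / (2 * h))) * \<phi> v) (snd p)"

lemma fbi_L2:
  fixes \<phi> :: "'a::euclidean_space \<Rightarrow> complex"
  assumes S: "schwartz \<phi>" and h: "h > 0"
  shows "L2_fun (fbi h \<phi>)"
    and "(L2_norm (fbi h \<phi>))\<^sup>2 \<le> (2 * pi * h) ^ DIM('a) * (sqrt (pi * h) ^ DIM('a) * (L2_norm \<phi>)\<^sup>2)"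
proof -
  let ?w = "\<lambda>x v. complex_of_real (exp (- (norm (v - x))\<^sup>2 / (2 * h)))"
  let ?B = "sqrt (pi * h) ^ DIM('a)"
  have cw: "continuous_on UNIV (\<lambda>p::'a \<times> 'a. ?w (fst p) (snd p))" "continuous_on UNIV (?w x)" for x
    unfolding divide_inverse[of _ "2 * h"] by (intro continuous_intros)+
  have w1: "norm (?w x v) \<le> 1" for x v :: 'a using h by (simp add: divide_nonpos_nonneg)
  have c\<phi>: "continuous_on UNIV \<phi>" by (rule schwartz_continuous[OF S])
  have mfbi: "fbi h \<phi> \<in> borel_measurable borel"
    unfolding fbi_def[abs_def]
    by (rule borel_measurable_fourier, intro borel_measurable_continuous_onI continuous_on_mult cw continuous_on_compose2[OF c\<phi>])
       (auto intro: continuous_intros)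
  define s where "s = sqrt (h / 2)"
  have s: "s > 0" "2 * s\<^sup>2 = h" using h by (simp_all add: s_def)
  have ew: "exp (- (norm z)\<^sup>2 / h) = ?B * gauss s z" for z :: 'a
    using exp_eq_gauss[OF s(1), of z] s(2) by (simp add: mult.commute[of 2 pi] mult.assoc)
  have sq: "(norm (?w x v * \<phi> v))\<^sup>2 = ?B * gauss s (v - x) * (norm (\<phi> v))\<^sup>2" for x v
  proof -
    have "(exp (- (norm (v - x))\<^sup>2 / (2 * h)))\<^sup>2 = exp (- (norm (v - x))\<^sup>2 / h)"
      using h by (simp add: power2_eq_square mult_exp_exp field_simps)
    then show ?thesis unfolding norm_mult power_mult_distrib ew[symmetric] by simp
  qed
  have i: "integrable lborel (\<lambda>v. ?w x v * \<phi> v)" for x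
    using integrable_bounded_mult[OF schwartz_integrable[OF S] cw(2) w1, of x] by (simp add: mult.commute)
  have L: "L2_fun (\<lambda>v. ?w x v * \<phi> v)" for x
    unfolding L2_fun_def
  proof
    show m: "(\<lambda>v. ?w x v * \<phi> v) \<in> borel_measurable lborel" using borel_measurable_integrable[OF i] .
    show "integrable lborel (\<lambda>v. (norm (?w x v * \<phi> v))\<^sup>2)"
    proof (rule integrable_dominated[OF L2_fun_integrable[OF schwartz_L2_fun[OF S]]])
      show "(\<lambda>v. (norm (?w x v * \<phi> v))\<^sup>2) \<in> borel_measurable lborel" using m by measurable
      have "norm (?w x v * \<phi> v) \<le> norm (\<phi> v)" for v
        unfolding norm_mult using w1[of v x] by (intro mult_left_le_one_le) auto
      then show "AE v in lborel. norm ((norm (?w x v * \<phi> v))\<^sup>2) \<le> norm ((norm (\<phi> v))\<^sup>2)"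
        by (intro always_eventually allI) (simp add: power_mono)
    qed
  qed
  have mfbi2: "(\<lambda>p. ennreal ((norm (fbi h \<phi> p))\<^sup>2)) \<in> borel_measurable borel" using mfbi by measurable
  let ?k = "\<lambda>x v. ennreal (?B * gauss s (v - x) * (norm (\<phi> v))\<^sup>2)"
  have mk: "(\<lambda>p::'a \<times> 'a. ennreal (?B * gauss s (snd p - fst p) * (norm (\<phi> (snd p)))\<^sup>2)) \<in> borel_measurable borel"
    by (intro measurable_compose[OF _ measurable_ennreal] borel_measurable_continuous_onI continuous_intros continuous_on_compose2[OF c\<phi>]) auto
  have "(\<integral>\<^sup>+p. ennreal ((norm (fbi h \<phi> p))\<^sup>2) \<partial>lborel) = (\<integral>\<^sup>+x. \<integral>\<^sup>+\<xi>. ennreal ((norm (fbi h \<phi> (x, \<xi>)))\<^sup>2) \<partial>lborel \<partial>lborel)"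
    by (rule lborel_nn_Fubini(1)[OF mfbi2])
  also have "\<dots> \<le> (\<integral>\<^sup>+x. ennreal ((2 * pi * h) ^ DIM('a)) * (\<integral>\<^sup>+v. ?k x v \<partial>lborel) \<partial>lborel)"
  proof (rule nn_integral_mono)
    fix x :: 'a
    have "(\<integral>\<^sup>+\<xi>. ennreal ((norm (fbi h \<phi> (x, \<xi>)))\<^sup>2) \<partial>lborel) \<le> ennreal ((2 * pi * h) ^ DIM('a) * (L2_norm (\<lambda>v. ?w x v * \<phi> v))\<^sup>2)"
      unfolding fbi_def fst_conv snd_conv by (rule fourier_Bessel[OF i L h])
    also have "\<dots> = ennreal ((2 * pi * h) ^ DIM('a)) * ennreal ((L2_norm (\<lambda>v. ?w x v * \<phi> v))\<^sup>2)"
      using h by (intro ennreal_mult) auto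
    also have "ennreal ((L2_norm (\<lambda>v. ?w x v * \<phi> v))\<^sup>2) = (\<integral>\<^sup>+v. ennreal ((norm (?w x v * \<phi> v))\<^sup>2) \<partial>lborel)"
      by (rule L2_norm_sq_nn[OF L, symmetric])
    finally show "(\<integral>\<^sup>+\<xi>. ennreal ((norm (fbi h \<phi> (x, \<xi>)))\<^sup>2) \<partial>lborel)
      \<le> ennreal ((2 * pi * h) ^ DIM('a)) * (\<integral>\<^sup>+v. ?k x v \<partial>lborel)"
      unfolding sq .
  qed
  also have "\<dots> = ennreal ((2 * pi * h) ^ DIM('a)) * (\<integral>\<^sup>+x. \<integral>\<^sup>+v. ?k x v \<partial>lborel \<partial>lborel)"
  proof (rule nn_integral_cmult)
    have "(\<lambda>(x, v). ?k x v) \<in> borel_measurable (borel \<Otimes>\<^sub>M lborel)"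
      using mk by (simp add: borel_measurable_pair_lborel split_beta')
    from lborel.borel_measurable_nn_integral[OF this]
    show "(\<lambda>x. \<integral>\<^sup>+v. ?k x v \<partial>lborel) \<in> borel_measurable lborel" by simp
  qed
  also have "(\<integral>\<^sup>+x. \<integral>\<^sup>+v. ?k x v \<partial>lborel \<partial>lborel)
    = (\<integral>\<^sup>+v. \<integral>\<^sup>+x. ?k x v \<partial>lborel \<partial>lborel)"
    using lborel_nn_Fubini[OF mk] by simp
  also have "\<dots> = (\<integral>\<^sup>+v. ennreal ?B * ennreal ((norm (\<phi> v))\<^sup>2) \<partial>lborel)"
  proof (rule nn_integral_cong)
    fix v :: 'a
    have mg: "(\<lambda>x::'a. ennreal (gauss s x)) \<in> borel_measurable borel" by measurable
    have mg': "(\<lambda>x::'a. ennreal (gauss s (v - x))) \<in> borel_measurable lborel" by measurable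
    have "(\<integral>\<^sup>+x. ?k x v \<partial>lborel) = (\<integral>\<^sup>+x. (ennreal ?B * ennreal ((norm (\<phi> v))\<^sup>2)) * ennreal (gauss s (v - x)) \<partial>lborel)"
      using h by (intro nn_integral_cong) (simp add: ennreal_mult'[symmetric] mult_ac)
    also have "\<dots> = (ennreal ?B * ennreal ((norm (\<phi> v))\<^sup>2)) * (\<integral>\<^sup>+x. ennreal (gauss s (v - x)) \<partial>lborel)"
      by (rule nn_integral_cmult[OF mg'])
    also have "(\<integral>\<^sup>+x. ennreal (gauss s (v - x)) \<partial>lborel) = 1"
      using nn_integral_translate(3)[OF mg, of v] nn_integral_gauss[OF s(1), where 'a='a] by simp
    finally show "(\<integral>\<^sup>+x. ?k x v \<partial>lborel) = ennreal ?B * ennreal ((norm (\<phi> v))\<^sup>2)" by simp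
  qed
  also have "\<dots> = ennreal ?B * ennreal ((L2_norm \<phi>)\<^sup>2)"
    unfolding L2_norm_sq_nn[OF schwartz_L2_fun[OF S], symmetric]
  proof (rule nn_integral_cmult)
    show "(\<lambda>v. ennreal ((norm (\<phi> v))\<^sup>2)) \<in> borel_measurable lborel"
      using schwartz_measurable[OF S] by measurable
  qed
  also have "ennreal ((2 * pi * h) ^ DIM('a)) * (ennreal ?B * ennreal ((L2_norm \<phi>)\<^sup>2)) = ennreal ((2 * pi * h) ^ DIM('a) * (?B * (L2_norm \<phi>)\<^sup>2))"
    using h by (simp add: ennreal_mult'[symmetric])
  finally have le: "(\<integral>\<^sup>+p. ennreal ((norm (fbi h \<phi> p))\<^sup>2) \<partial>lborel) \<le> ennreal ((2 * pi * h) ^ DIM('a) * (?B * (L2_norm \<phi>)\<^sup>2))" .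
  show L2: "L2_fun (fbi h \<phi>)"
    unfolding L2_fun_def
  proof
    show "fbi h \<phi> \<in> borel_measurable lborel" using mfbi by simp
    then have m2: "(\<lambda>p. (norm (fbi h \<phi> p))\<^sup>2) \<in> borel_measurable lborel" by measurable
    show "integrable lborel (\<lambda>p. (norm (fbi h \<phi> p))\<^sup>2)"
      using order.strict_trans1[OF le ennreal_less_top] by (intro integrableI_bounded m2) simp
  qed
  have "ennreal ((L2_norm (fbi h \<phi>))\<^sup>2) \<le> ennreal ((2 * pi * h) ^ DIM('a) * (?B * (L2_norm \<phi>)\<^sup>2))"
    using le unfolding L2_norm_sq_nn[OF L2] .
  then show "(L2_norm (fbi h \<phi>))\<^sup>2 \<le> (2 * pi * h) ^ DIM('a) * (?B * (L2_norm \<phi>)\<^sup>2)"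
    by (rule ennreal_le_iff[THEN iffD1, rotated]) (use h in simp)
qed

lemma gauss_Pair: "gauss \<sigma> (z, \<zeta>) = gauss \<sigma> z * gauss \<sigma> \<zeta>"
  unfolding gauss_eq norm_Pair by (simp add: power_add exp_add[symmetric] add_divide_distrib diff_divide_distrib)

text \<open>
  Integrating the frequency part of the Gaussian first gives a Gaussian in \<open>\<eta> - s' / h\<close>, where \<open>s'\<close> is the difference
  variable. Together with the Gaussian in the position it is, by the parallelogram identity, a product of two
  windows in the original variables \<open>u\<close> and \<open>v\<close>, because the common standard deviation is exactly
  \<open>sqrt (h / 2)\<close>. The modulation \<open>(y, \<eta>)\<close> moves the two windows apart.
\<close>

lemma wigner_gauss_average:
  fixes \<phi> \<psi> :: "'a::euclidean_space \<Rightarrow> complex"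
  assumes S: "schwartz \<phi>" "schwartz \<psi>" and h: "h > 0" and s: "s = sqrt (h / 2)"
  shows "(LBINT w. of_real (gauss s w) * exp (\<i> * of_real ((y, \<eta>) \<bullet> w)) * wigner h \<phi> \<psi> (x - fst w) (\<xi> - snd w))
    = of_real ((1 / sqrt (pi * h)) ^ DIM('a)) * exp (\<i> * of_real (y \<bullet> x)) *
      (fbi h \<phi> (x - (h/2) *\<^sub>R \<eta>, \<xi> + (h/2) *\<^sub>R y) * cnj (fbi h \<psi> (x + (h/2) *\<^sub>R \<eta>, \<xi> - (h/2) *\<^sub>R y)))"
proof -
  have s0: "s > 0" and s2: "2 * s\<^sup>2 = h" using h s by simp_all
  have gP: "gauss s w = gauss s (fst w) * gauss s (snd w)" for w :: "'a \<times> 'a"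
    using gauss_Pair[of s "fst w" "snd w"] by simp
  let ?g = "\<lambda>z::'a. complex_of_real (gauss s z)"
  let ?E = "\<lambda>a::'a. \<lambda>b. exp (\<i> * complex_of_real (a \<bullet> b))"
  let ?W = "\<lambda>p. case p of (x, t) \<Rightarrow> wigner h \<phi> \<psi> x t"
  have iW: "integrable lborel (\<lambda>w. ?W ((x, \<xi>) - w))" by (rule integrable_translate(3)[OF integrable_wigner[OF S h]])
  have "integrable lborel (\<lambda>w. ?W ((x, \<xi>) - w) * (of_real (gauss s w) * exp (\<i> * of_real ((y, \<eta>) \<bullet> w))))"
  proof (rule integrable_bounded_mult[OF iW])
    show "continuous_on UNIV (\<lambda>w. complex_of_real (gauss s w) * exp (\<i> * complex_of_real ((y, \<eta>) \<bullet> w)))"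
      by (intro continuous_intros)
    show "norm (complex_of_real (gauss s w) * exp (\<i> * complex_of_real ((y, \<eta>) \<bullet> w))) \<le> (1 / sqrt (2 * pi * s\<^sup>2)) ^ DIM('a \<times> 'a)" for w :: "'a \<times> 'a"
      unfolding norm_mult norm_exp_i_times norm_of_real using gauss_le[of s w] by simp
  qed
  then have i1: "integrable lborel (\<lambda>(z, \<zeta>). ?g z * ?E y z * (?g \<zeta> * ?E \<eta> \<zeta> * wigner h \<phi> \<psi> (x - z) (\<xi> - \<zeta>)))"
    by (simp add: split_beta' gP inner_prod_def distrib_left exp_add mult_ac)
  have S1: "(LBINT w. of_real (gauss s w) * exp (\<i> * of_real ((y, \<eta>) \<bullet> w)) * wigner h \<phi> \<psi> (x - fst w) (\<xi> - snd w))
    = (LBINT z. ?g z * ?E y z * (LBINT \<zeta>. ?g \<zeta> * ?E \<eta> \<zeta> * wigner h \<phi> \<psi> (x - z) (\<xi> - \<zeta>)))"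
    unfolding integral_mult_right_zero[symmetric] lborel_Fubini(2)[OF i1]
    by (intro integral_eqI)
       (simp add: split_beta' gP inner_prod_def distrib_left exp_add mult_ac)
  let ?e = "\<lambda>s'::'a. of_real (exp (- (h / 4) * (norm (\<eta> - (1 / h) *\<^sub>R s'))\<^sup>2)) * exp (\<i> * of_real ((s' \<bullet> \<xi>) / h)) :: complex"
  have freq: "(LBINT \<zeta>. ?g \<zeta> * ?E \<eta> \<zeta> * wigner h \<phi> \<psi> x' (\<xi> - \<zeta>)) = (LBINT s'. ?e s' * cross \<phi> \<psi> x' s')" for x'
  proof -
    let ?K = "\<lambda>\<zeta> s'::'a. ?E (\<eta> - (1 / h) *\<^sub>R s') \<zeta> * exp (\<i> * of_real ((s' \<bullet> \<xi>) / h))"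
    have K: "?E \<eta> \<zeta> * exp (\<i> * of_real ((s' \<bullet> (\<xi> - \<zeta>)) / h)) = ?K \<zeta> s'" for \<zeta> s' :: 'a
    proof -
      have "\<eta> \<bullet> \<zeta> + (s' \<bullet> (\<xi> - \<zeta>)) / h = (\<eta> - (1 / h) *\<^sub>R s') \<bullet> \<zeta> + (s' \<bullet> \<xi>) / h"
        by (simp add: inner_diff_left inner_diff_right diff_divide_distrib)
      then show ?thesis by (simp only: exp_add[symmetric] distrib_left[symmetric] of_real_add[symmetric])
    qed
    have i2: "integrable lborel (\<lambda>(\<zeta>, s'). ?K \<zeta> s' * ?g \<zeta> * cross \<phi> \<psi> x' s')"
    proof (rule lborel_Fubini_bounded[OF integrable_of_real_gauss[OF s0] integrable_cross[OF S]])
      have "continuous_on UNIV (\<lambda>p::'a \<times> 'a. ?K (fst p) (snd p))"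
        by (intro continuous_intros continuous_on_exp_inner)
      then show "(\<lambda>(\<zeta>, s'). ?K \<zeta> s') \<in> borel_measurable borel"
        unfolding split_beta' by (rule borel_measurable_continuous_onI)
      show "norm (?K \<zeta> s') \<le> 1" for \<zeta> s' unfolding norm_mult norm_exp_i_times by simp
    qed
    have "(LBINT \<zeta>. ?g \<zeta> * ?E \<eta> \<zeta> * wigner h \<phi> \<psi> x' (\<xi> - \<zeta>)) = (LBINT \<zeta>. LBINT s'. ?K \<zeta> s' * ?g \<zeta> * cross \<phi> \<psi> x' s')"
      unfolding wigner_def integral_mult_right_zero[symmetric] K[symmetric] by (simp only: mult_ac)
    also have "\<dots> = (LBINT s'. LBINT \<zeta>. ?K \<zeta> s' * ?g \<zeta> * cross \<phi> \<psi> x' s')" by (rule lborel_Fubini(1)[OF i2])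
    also have "\<dots> = (LBINT s'. ?e s' * cross \<phi> \<psi> x' s')"
    proof (rule integral_eqI)
      fix s' :: 'a
      have "(LBINT \<zeta>. ?K \<zeta> s' * ?g \<zeta> * cross \<phi> \<psi> x' s') 
        = (LBINT \<zeta>. ?g \<zeta> * ?E (\<eta> - (1 / h) *\<^sub>R s') \<zeta>) * (exp (\<i> * of_real ((s' \<bullet> \<xi>) / h)) * cross \<phi> \<psi> x' s')"
        unfolding integral_mult_left_zero[symmetric] by (simp only: mult_ac)
      also have "(LBINT \<zeta>. ?g \<zeta> * ?E (\<eta> - (1 / h) *\<^sub>R s') \<zeta>) = exp (- of_real (s\<^sup>2 * (norm (\<eta> - (1 / h) *\<^sub>R s'))\<^sup>2 / 2))"
        by (rule gauss_char(2)[OF s0])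
      also have "\<dots> = of_real (exp (- (h / 4) * (norm (\<eta> - (1 / h) *\<^sub>R s'))\<^sup>2))"
      proof -
        have "s\<^sup>2 * a / 2 = (h / 4) * a" for a using s2 by simp
        then show ?thesis by (simp only: exp_of_real[symmetric] of_real_minus[symmetric] mult_minus_left)
      qed
      finally show "(LBINT \<zeta>. ?K \<zeta> s' * ?g \<zeta> * cross \<phi> \<psi> x' s') = ?e s' * cross \<phi> \<psi> x' s'"
        by (simp only: mult.assoc)
    qed
    finally show ?thesis .
  qed
  \<comment> \<open>the two points of phase space at which the windowed transforms are evaluated\<close>
  let ?x1 = "x - (h/2) *\<^sub>R \<eta>" and ?x2 = "x + (h/2) *\<^sub>R \<eta>" and ?\<xi>1 = "\<xi> + (h/2) *\<^sub>R y" and ?\<xi>2 = "\<xi> - (h/2) *\<^sub>R y"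
  let ?w = "\<lambda>x v::'a. complex_of_real (exp (- (norm (v - x))\<^sup>2 / (2 * h)))"
  let ?A = "\<lambda>v. exp (- \<i> * of_real ((v \<bullet> ?\<xi>1) / h)) * (?w ?x1 v * \<phi> v)"
  let ?B = "\<lambda>u. exp (- \<i> * of_real ((u \<bullet> ?\<xi>2) / h)) * (?w ?x2 u * \<psi> u)"
  let ?c = "(1 / sqrt (pi * h)) ^ DIM('a)"
  let ?C = "of_real ?c * ?E y x"
  have win: "integrable lborel (\<lambda>v. ?w a v * \<theta> v)" if "schwartz \<theta>" for \<theta> a
  proof -
    have "continuous_on UNIV (?w a)" unfolding divide_inverse[of _ "2 * h"] by (intro continuous_intros)
    moreover have "norm (?w a v) \<le> 1" for v using h by (simp add: divide_nonpos_nonneg)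
    ultimately have "integrable lborel (\<lambda>v. \<theta> v * ?w a v)" by (rule integrable_bounded_mult[OF schwartz_integrable[OF that]])
    then show ?thesis by (simp add: mult.commute)
  qed
  have iA: "integrable lborel ?A" and iB: "integrable lborel (\<lambda>u. cnj (?B u))"
    by (intro integrable_exp_mult win S integrable_bounded_linear[OF bounded_linear_cnj])+
  let ?T = "\<lambda>p. case p of (u, v) \<Rightarrow> ?C * (cnj (?B u) * ?A v)"
  have iT: "integrable lborel ?T"
  proof -
    have "integrable lborel (\<lambda>p. ?C * (case p of (u, v) \<Rightarrow> cnj (?B u) * ?A v))"
      by (intro integrable_mult_right integrable_lborel_pair_mult iA iB)
    then show ?thesis by (simp only: prod.case_distrib[of "\<lambda>z. ?C * z"])
  qed
  have key: "?T (x' + (1/2) *\<^sub>R s', x' - (1/2) *\<^sub>R s') = ?g (x - x') * ?E y (x - x') * (?e s' * cross \<phi> \<psi> x' s')" for x' s'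
  proof -
    let ?u = "x' + (1/2) *\<^sub>R s'" and ?v = "x' - (1/2) *\<^sub>R s'"
    let ?d = "x - x'" and ?f = "(h/2) *\<^sub>R (\<eta> - (1 / h) *\<^sub>R s')"
    have alg: "- a / (2 * h) + - b / (2 * h) = - c / h + - (h / 4) * e" if "a + b = 2 * c + 2 * (h\<^sup>2 / 4 * e)" for a b c e :: real
    proof -
      have "- a / (2 * h) + - b / (2 * h) = - (a + b) / (2 * h)" by (simp add: add_divide_distrib diff_divide_distrib)
      then show ?thesis unfolding that using h by (simp add: field_simps power2_eq_square)
    qed
    have f: "?f = (h/2) *\<^sub>R \<eta> - (1/2) *\<^sub>R s'" using h by (simp add: scaleR_diff_right)
    \<comment> \<open>both window arguments are combinations of the same two vectors\<close>
    have v: "?v - ?x1 = - (?d - ?f)" and u: "?u - ?x2 = - (?d + ?f)"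
      unfolding f by (simp_all add: algebra_simps)
    have "(norm (?v - ?x1))\<^sup>2 + (norm (?u - ?x2))\<^sup>2 = 2 * (norm ?d)\<^sup>2 + 2 * (norm ?f)\<^sup>2"
      unfolding v u norm_minus_cancel power2_norm_eq_inner by (simp add: inner_add_left inner_add_right inner_diff_left inner_diff_right inner_commute)
    also have "(norm ?f)\<^sup>2 = h\<^sup>2 / 4 * (norm (\<eta> - (1 / h) *\<^sub>R s'))\<^sup>2"
      by (simp only: norm_scaleR power_mult_distrib power2_abs) (simp add: power_divide)
    finally have "- (norm (?v - ?x1))\<^sup>2 / (2 * h) + - (norm (?u - ?x2))\<^sup>2 / (2 * h) = - (norm ?d)\<^sup>2 / h + - (h / 4) * (norm (\<eta> - (1 / h) *\<^sub>R s'))\<^sup>2"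
      by (rule alg)
    then have "exp (- (norm (?v - ?x1))\<^sup>2 / (2 * h)) * exp (- (norm (?u - ?x2))\<^sup>2 / (2 * h)) = exp (- (norm ?d)\<^sup>2 / h) * exp (- (h / 4) * (norm (\<eta> - (1 / h) *\<^sub>R s'))\<^sup>2)"
      by (simp only: exp_add[symmetric])
    moreover have "?c * exp (- (norm ?d)\<^sup>2 / h) = gauss s ?d"
      unfolding gauss_eq using s2 by (simp add: mult.commute[of 2 pi] mult.assoc)
    ultimately have "?c * (exp (- (norm (?v - ?x1))\<^sup>2 / (2 * h)) * exp (- (norm (?u - ?x2))\<^sup>2 / (2 * h))) 
      = gauss s ?d * exp (- (h / 4) * (norm (\<eta> - (1 / h) *\<^sub>R s'))\<^sup>2)"
      by (simp only: mult.assoc[symmetric])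
    then have 1: "of_real ?c * (?w ?x1 ?v * ?w ?x2 ?u) = ?g ?d * of_real (exp (- (h / 4) * (norm (\<eta> - (1 / h) *\<^sub>R s'))\<^sup>2))"
      by (simp only: of_real_mult[symmetric])
    have ph1: "exp (\<i> * of_real a) * (exp (- \<i> * of_real b) * cnj (exp (- \<i> * of_real c))) = exp (\<i> * of_real (a + - b + c))" for a b c
      by (simp add: exp_cnj mult_exp_exp algebra_simps)
    have ph2: "exp (\<i> * of_real (a + b)) = exp (\<i> * of_real a) * exp (\<i> * of_real b)" for a b
      by (simp add: exp_add distrib_left)
    have "y \<bullet> x + - ((?v \<bullet> ?\<xi>1) / h) + (?u \<bullet> ?\<xi>2) / h = y \<bullet> (x - x') + (s' \<bullet> \<xi>) / h"
      using h by (simp add: inner_add_left inner_add_right inner_diff_left inner_diff_right inner_commute[of y] field_simps)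
    then have 2: "?E y x * (exp (- \<i> * of_real ((?v \<bullet> ?\<xi>1) / h)) * cnj (exp (- \<i> * of_real ((?u \<bullet> ?\<xi>2) / h)))) = ?E y (x - x') * exp (\<i> * of_real ((s' \<bullet> \<xi>) / h))"
      by (simp only: ph1 ph2)
    have "?T (?u, ?v) = (of_real ?c * (?w ?x1 ?v * ?w ?x2 ?u)) * (?E y x * (exp (- \<i> * of_real ((?v \<bullet> ?\<xi>1) / h)) * cnj (exp (- \<i> * of_real ((?u \<bullet> ?\<xi>2) / h))))) * cross \<phi> \<psi> x' s'"
      by (simp only: prod.case complex_cnj_mult complex_cnj_complex_of_real cross_def mult_ac)
    then show ?thesis unfolding 1 2 by (simp only: mult_ac)
  qed
  let ?P = "\<lambda>x'. LBINT s'. ?T (x' + (1/2) *\<^sub>R s', x' - (1/2) *\<^sub>R s')"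
  have iP: "integrable lborel ?P"
    by (rule lborel_Fubini(3)[OF midpoint_change_of_variables(1)[OF iT]])
  have "(LBINT z. ?g z * ?E y z * (LBINT \<zeta>. ?g \<zeta> * ?E \<eta> \<zeta> * wigner h \<phi> \<psi> (x - z) (\<xi> - \<zeta>))) = (LBINT z. ?P (x - z))"
    unfolding key freq integral_mult_right_zero by (simp only: diff_diff_eq2 add_diff_cancel_left')
  also have "\<dots> = (LBINT x'. ?P x')" by (rule integral_translate(3)[OF iP])
  also have "\<dots> = (LBINT p. ?T p)" by (rule midpoint_change_of_variables(2)[OF iT, symmetric])
  also have "\<dots> = (LBINT u. LBINT v. ?C * (cnj (?B u) * ?A v))" by (rule lborel_Fubini(2)[OF iT, symmetric])
  also have "\<dots> = ?C * ((LBINT u. cnj (?B u)) * (LBINT v. ?A v))"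
    unfolding integral_mult_right_zero integral_mult_left_zero ..
  also have "(LBINT u. cnj (?B u)) = cnj (fbi h \<psi> (?x2, ?\<xi>2))"
    unfolding fbi_def fourier_def fst_conv snd_conv by (rule Bochner_Integration.integral_cnj)
  also have "(LBINT v. ?A v) = fbi h \<phi> (?x1, ?\<xi>1)"
    unfolding fbi_def fourier_def fst_conv snd_conv ..
  finally show ?thesis unfolding S1 by (simp only: mult.commute[of "cnj _"])
qed

lemma L2_translate:
  fixes f :: "'a::euclidean_space \<Rightarrow> complex"
  assumes "L2_fun f"
  shows "L2_fun (\<lambda>x. f (x + a))" "L2_norm (\<lambda>x. f (x + a)) = L2_norm f"
proof -
  have "f \<in> borel_measurable borel" using assms by (rule L2_fun_measurable)
  then have "(\<lambda>x. f (x + a)) \<in> borel_measurable lborel" by simp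
  then show "L2_fun (\<lambda>x. f (x + a))"
    unfolding L2_fun_def using integrable_translate(1)[OF L2_fun_integrable[OF assms], of a] by simp
  show "L2_norm (\<lambda>x. f (x + a)) = L2_norm f"
    unfolding L2_norm_def using integral_translate(1)[OF L2_fun_integrable[OF assms], of a] by simp
qed

lemma integral_norm_mult_le:
  fixes f g :: "'a::euclidean_space \<Rightarrow> complex"
  assumes "L2_fun f" "L2_fun g"
  shows "integrable lborel (\<lambda>x. norm (f x) * norm (g x))" "(LBINT x. norm (f x) * norm (g x)) \<le> L2_norm f * L2_norm g"
proof -
  let ?n = "\<lambda>f x. complex_of_real (norm (f x))"
  have m: "f \<in> borel_measurable borel" "g \<in> borel_measurable borel" using assms by (auto intro: L2_fun_measurable)
  have n: "L2_fun (?n f)" "L2_fun (?n g)"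
    using assms m unfolding L2_fun_def by simp_all
  have "integrable lborel (\<lambda>x. complex_of_real (norm (f x) * norm (g x)))"
    using L2_integrable_mult[OF n] by simp
  then show "integrable lborel (\<lambda>x. norm (f x) * norm (g x))" by (simp only: complex_of_real_integrable_eq)
  have "L2_inner (?n f) (?n g) = complex_of_real (LBINT x. norm (f x) * norm (g x))"
    unfolding L2_inner_def by (simp add: integral_complex_of_real[symmetric] del: integral_complex_of_real)
  then have "\<bar>LBINT x. norm (f x) * norm (g x)\<bar> \<le> L2_norm (?n f) * L2_norm (?n g)"
    using L2_Cauchy_Schwarz[OF n] by simp
  moreover have "L2_norm (?n f) = L2_norm f" "L2_norm (?n g) = L2_norm g" unfolding L2_norm_def by simp_all
  ultimately show "(LBINT x. norm (f x) * norm (g x)) \<le> L2_norm f * L2_norm g" by simp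
qed

text \<open>
  The average is moved from \<open>G\<close> to the Wigner function, where it yields a product of two windowed transforms. Their
  translations do not change the norms, so that \<open>Y\<close> disappears from the bound.
\<close>

lemma modulated_average_wigner_bound:
  fixes \<phi> \<psi> :: "'a::euclidean_space \<Rightarrow> complex"
  assumes S: "schwartz \<phi>" "schwartz \<psi>" and h: "h > 0"
    and G: "continuous_on UNIV G" "\<And>p. norm (G p) \<le> N"
  shows "norm (LBINT p. modulated_average (sqrt (h / 2)) Y G p * (wigner_at h \<phi> \<psi> p))
    \<le> N * ((2 * pi * h) ^ DIM('a) * L2_norm \<phi> * L2_norm \<psi>)"
proof -
  define s where "s = sqrt (h / 2)"
  have s0: "s > 0" using h by (simp add: s_def)
  obtain y \<eta> where Y: "Y = (y, \<eta>)" by (cases Y)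
  let ?W = "\<lambda>p. case p of (x, t) \<Rightarrow> wigner h \<phi> \<psi> x t"
  let ?k = "\<lambda>w::'a \<times> 'a. complex_of_real (gauss s w) * exp (\<i> * of_real (Y \<bullet> w))"
  have iW: "integrable lborel ?W" by (rule integrable_wigner[OF S h])
  have mW: "?W \<in> borel_measurable borel" using borel_measurable_integrable[OF iW] by simp
  have ig: "integrable lborel (\<lambda>w::'a \<times> 'a. complex_of_real (gauss s w))" by (rule integrable_of_real_gauss[OF s0])
  have N: "0 \<le> N" using order_trans[OF norm_ge_zero G(2)] .
  have i1: "integrable lborel (\<lambda>(p, w). (exp (\<i> * of_real (Y \<bullet> w)) * G (p + w)) * ?W p * complex_of_real (gauss s w))"
  proof (rule lborel_Fubini_bounded[OF iW ig])
    have "continuous_on UNIV (\<lambda>q::('a \<times> 'a) \<times> ('a \<times> 'a). G (fst q + snd q))"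
      by (rule continuous_on_compose2[OF G(1)]) (intro continuous_intros, simp)
    then have "continuous_on UNIV (\<lambda>q::('a \<times> 'a) \<times> ('a \<times> 'a). exp (\<i> * complex_of_real (Y \<bullet> snd q)) * G (fst q + snd q))"
      by (intro continuous_intros)
    then show "(\<lambda>(p, w). exp (\<i> * complex_of_real (Y \<bullet> w)) * G (p + w)) \<in> borel_measurable borel"
      unfolding split_beta' by (rule borel_measurable_continuous_onI)
    show "norm (exp (\<i> * complex_of_real (Y \<bullet> w)) * G (p + w)) \<le> N" for p w
      unfolding norm_mult norm_exp_i_times mult_1 by (rule G(2))
  qed
  have i2: "integrable lborel (\<lambda>(w, p). ?k w * (G p * ?W (p - w)))"
  proof (rule integrable_lborel_pairI)
    have "(\<lambda>q::('a \<times> 'a) \<times> ('a \<times> 'a). ?k (fst q) * G (snd q)) \<in> borel_measurable borel"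
      by (intro borel_measurable_continuous_onI continuous_intros continuous_on_compose2[OF G(1)]) auto
    moreover have "(\<lambda>q::('a \<times> 'a) \<times> ('a \<times> 'a). ?W (snd q - fst q)) \<in> borel_measurable borel"
      by (rule measurable_compose[OF _ mW]) (intro borel_measurable_continuous_onI continuous_intros)
    ultimately have "(\<lambda>q. (?k (fst q) * G (snd q)) * ?W (snd q - fst q)) \<in> borel_measurable borel"
      by (rule borel_measurable_times)
    then show "(\<lambda>(w, p). ?k w * (G p * ?W (p - w))) \<in> borel_measurable borel"
      unfolding split_beta' by (simp only: mult.assoc)
    have "(\<integral>\<^sup>+w. \<integral>\<^sup>+p. ennreal (norm (?k w * (G p * ?W (p - w)))) \<partial>lborel \<partial>lborel)
      \<le> (\<integral>\<^sup>+w. ennreal (gauss s (w :: 'a \<times> 'a)) * (ennreal N * (\<integral>\<^sup>+p. ennreal (norm (?W p)) \<partial>lborel)) \<partial>lborel)"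
    proof (rule nn_integral_mono)
      fix w :: "'a \<times> 'a"
      have mn: "(\<lambda>p. ennreal (norm (?W p))) \<in> borel_measurable borel"
        using measurable_compose[OF mW borel_measurable_norm] by (rule measurable_compose[OF _ measurable_ennreal])
      have mn': "(\<lambda>p. ennreal (norm (?W (p - w)))) \<in> borel_measurable lborel"
        using measurable_compose[OF _ mn, of "\<lambda>p. p - w" borel] by simp
      have "(\<integral>\<^sup>+p. ennreal (norm (?k w * (G p * ?W (p - w)))) \<partial>lborel) \<le> (\<integral>\<^sup>+p. (ennreal (gauss s w) * ennreal N) * ennreal (norm (?W (p - w))) \<partial>lborel)"
      proof (rule nn_integral_mono)
        fix p
        have "norm (?k w * (G p * ?W (p - w))) = gauss s w * (norm (G p) * norm (?W (p - w)))"
          unfolding norm_mult norm_exp_i_times norm_of_real by simp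
        also have "\<dots> \<le> gauss s w * (N * norm (?W (p - w)))" by (intro mult_left_mono mult_right_mono G(2)) auto
        finally have "norm (?k w * (G p * ?W (p - w))) \<le> gauss s w * N * norm (?W (p - w))" by (simp only: mult.assoc)
        then show "ennreal (norm (?k w * (G p * ?W (p - w)))) \<le> (ennreal (gauss s w) * ennreal N) * ennreal (norm (?W (p - w)))"
          using N by (simp only: ennreal_mult'[symmetric] gauss_nonneg mult_nonneg_nonneg ennreal_leI)
      qed
      also have "\<dots> = (ennreal (gauss s w) * ennreal N) * (\<integral>\<^sup>+p. ennreal (norm (?W (p - w))) \<partial>lborel)"
        by (rule nn_integral_cmult[OF mn'])
      also have "(\<integral>\<^sup>+p. ennreal (norm (?W (p - w))) \<partial>lborel) = (\<integral>\<^sup>+p. ennreal (norm (?W p)) \<partial>lborel)"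
        by (rule nn_integral_translate(2)[OF mn])
      finally show "(\<integral>\<^sup>+p. ennreal (norm (?k w * (G p * ?W (p - w)))) \<partial>lborel) \<le> ennreal (gauss s w) * (ennreal N * (\<integral>\<^sup>+p. ennreal (norm (?W p)) \<partial>lborel))"
        by (simp only: mult.assoc)
    qed
    also have "\<dots> = ennreal N * (\<integral>\<^sup>+p. ennreal (norm (?W p)) \<partial>lborel)"
      using nn_integral_gauss[OF s0, where 'a="'a \<times> 'a"] by (simp add: nn_integral_multc)
    also have "\<dots> < \<infinity>"
      using iW unfolding integrable_iff_bounded by (simp add: ennreal_mult_less_top)
    finally show "(\<integral>\<^sup>+w. \<integral>\<^sup>+p. ennreal (norm (?k w * (G p * ?W (p - w)))) \<partial>lborel \<partial>lborel) < \<infinity>" .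
  qed
  let ?S = "\<lambda>p. LBINT w. ?k w * ?W (p - w)"
  have "(LBINT p. modulated_average s Y G p * ?W p) = (LBINT p. LBINT w. (exp (\<i> * of_real (Y \<bullet> w)) * G (p + w)) * ?W p * complex_of_real (gauss s w))"
    unfolding modulated_average_def integral_mult_left_zero[symmetric] by (simp only: mult_ac)
  also have "\<dots> = (LBINT w. LBINT p. (exp (\<i> * of_real (Y \<bullet> w)) * G (p + w)) * ?W p * complex_of_real (gauss s w))"
    by (rule lborel_Fubini(1)[OF i1])
  also have "\<dots> = (LBINT w. LBINT p. ?k w * (G p * ?W (p - w)))"
  proof (rule integral_eqI)
    fix w :: "'a \<times> 'a"
    have "integrable lborel (\<lambda>p. ?W (p - w) * G p)"
      by (rule integrable_bounded_mult[OF integrable_translate(2)[OF iW] G])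
    from integral_translate(1)[OF this, of w]
    have "(LBINT p. ?W p * G (p + w)) = (LBINT p. ?W (p - w) * G p)" by (simp only: add_diff_cancel_right')
    then have "?k w * (LBINT p. ?W p * G (p + w)) = ?k w * (LBINT p. ?W (p - w) * G p)" by (rule arg_cong)
    then show "(LBINT p. (exp (\<i> * of_real (Y \<bullet> w)) * G (p + w)) * ?W p * complex_of_real (gauss s w)) = (LBINT p. ?k w * (G p * ?W (p - w)))"
      unfolding integral_mult_right_zero[symmetric] by (simp only: mult_ac)
  qed
  also have "\<dots> = (LBINT p. LBINT w. ?k w * (G p * ?W (p - w)))" by (rule lborel_Fubini(1)[OF i2])
  also have "\<dots> = (LBINT p. G p * ?S p)"
    unfolding integral_mult_right_zero[symmetric] by (simp only: mult_ac)
  finally have eq: "(LBINT p. modulated_average s Y G p * ?W p) = (LBINT p. G p * ?S p)" .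
  let ?V1 = "\<lambda>p. fbi h \<phi> (p + (- (h/2) *\<^sub>R \<eta>, (h/2) *\<^sub>R y))" and ?V2 = "\<lambda>p. fbi h \<psi> (p + ((h/2) *\<^sub>R \<eta>, - (h/2) *\<^sub>R y))"
  let ?c = "(1 / sqrt (pi * h)) ^ DIM('a)"
  have c: "0 \<le> ?c" using h by simp
  have normS: "norm (?S p) = ?c * (norm (?V1 p) * norm (?V2 p))" for p
  proof (cases p)
    case (Pair x \<xi>)
    have "?S p = of_real ?c * exp (\<i> * of_real (y \<bullet> x)) * (?V1 p * cnj (?V2 p))"
      using wigner_gauss_average[OF S h s_def, of y \<eta> x \<xi>] unfolding Y Pair by (simp add: split_beta')
    then show ?thesis using c by (simp only: norm_mult norm_exp_i_times norm_of_real complex_mod_cnj abs_of_nonneg mult_1_right)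
  qed
  note V1 = L2_translate[OF fbi_L2(1)[OF S(1) h]] and V2 = L2_translate[OF fbi_L2(1)[OF S(2) h]]
  note V12 = integral_norm_mult_le[OF V1(1) V2(1)]
  have "norm (LBINT p. G p * ?S p) \<le> (LBINT p. norm (G p * ?S p))" by (rule integral_norm_bound)
  also have "\<dots> \<le> (LBINT p. N * (?c * (norm (?V1 p) * norm (?V2 p))))"
  proof (rule integral_mono_AE')
    show "integrable lborel (\<lambda>p. N * (?c * (norm (?V1 p) * norm (?V2 p))))" by (intro integrable_mult_right V12(1))
    show "AE p in lborel. norm (G p * ?S p) \<le> N * (?c * (norm (?V1 p) * norm (?V2 p)))"
      unfolding norm_mult[of "G _"] normS using c by (intro always_eventually allI mult_right_mono G(2) mult_nonneg_nonneg) auto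
    show "AE p in lborel. 0 \<le> N * (?c * (norm (?V1 p) * norm (?V2 p)))"
      using c N by (intro always_eventually allI mult_nonneg_nonneg) auto
  qed
  also have "\<dots> = N * (?c * (LBINT p. norm (?V1 p) * norm (?V2 p)))" by (simp only: integral_mult_right_zero)
  also have "\<dots> \<le> N * (?c * (L2_norm (fbi h \<phi>) * L2_norm (fbi h \<psi>)))"
    using V12(2) c N unfolding V1(2) V2(2) by (intro mult_left_mono) auto
  also have "\<dots> \<le> N * ((2 * pi * h) ^ DIM('a) * L2_norm \<phi> * L2_norm \<psi>)"
  proof (intro mult_left_mono N)
    let ?a = "(2 * pi * h) ^ DIM('a)" and ?b = "sqrt (pi * h) ^ DIM('a)"
    have ab: "0 \<le> ?a" "0 \<le> ?b" "0 \<le> ?a * ?b" using h by simp_all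
    have le: "L2_norm (fbi h \<theta>) \<le> sqrt (?a * ?b) * L2_norm \<theta>" if "schwartz \<theta>" for \<theta> :: "'a \<Rightarrow> complex"
    proof (rule power2_le_imp_le)
      show "(L2_norm (fbi h \<theta>))\<^sup>2 \<le> (sqrt (?a * ?b) * L2_norm \<theta>)\<^sup>2"
        using fbi_L2(2)[OF that h] unfolding power_mult_distrib[of "sqrt (?a * ?b)"] real_sqrt_pow2[OF ab(3)] mult.assoc[of ?a] .
      show "0 \<le> sqrt (?a * ?b) * L2_norm \<theta>" using ab by simp
    qed
    have "L2_norm (fbi h \<phi>) * L2_norm (fbi h \<psi>) \<le> (sqrt (?a * ?b) * L2_norm \<phi>) * (sqrt (?a * ?b) * L2_norm \<psi>)"
      using ab by (intro mult_mono le S) auto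
    also have "\<dots> = (sqrt (?a * ?b))\<^sup>2 * (L2_norm \<phi> * L2_norm \<psi>)" by (simp only: power2_eq_square mult_ac)
    also have "\<dots> = ?a * ?b * (L2_norm \<phi> * L2_norm \<psi>)" by (simp only: real_sqrt_pow2[OF ab(3)])
    finally have "?c * (L2_norm (fbi h \<phi>) * L2_norm (fbi h \<psi>)) \<le> ?c * (?a * ?b * (L2_norm \<phi> * L2_norm \<psi>))"
      by (rule mult_left_mono[OF _ c])
    also have "\<dots> = (?c * ?b) * (?a * L2_norm \<phi> * L2_norm \<psi>)" by (simp only: mult_ac)
    also have "?c * ?b = 1" using h unfolding power_mult_distrib[symmetric] by simp
    finally show "?c * (L2_norm (fbi h \<phi>) * L2_norm (fbi h \<psi>)) \<le> ?a * L2_norm \<phi> * L2_norm \<psi>" by simp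
  qed
  finally show ?thesis unfolding s_def[symmetric] eq .
qed

section \<open>The Weyl operator and its norm\<close>

text \<open>
  The square comes from the two coordinate directions, position and frequency, that share the index \<open>j\<close>.
\<close>

lemma weyl_form_bound:
  fixes F :: "(real^'n) \<times> (real^'n) \<Rightarrow> complex"
  assumes F: "symbol_derivative_bounds 2 M \<epsilon> F" "continuous_on UNIV F" "\<And>x \<xi>. norm (F (x, \<xi>)) \<le> M"
    and S: "schwartz \<phi>" "schwartz \<psi>" and h: "h > 0"
  shows "norm (of_real (1 / (2 * pi * h) ^ CARD('n)) * (LBINT p. F p * (wigner_at h \<phi> \<psi> p)))
    \<le> M * (\<Prod>j\<in>UNIV. (1 + h * (\<epsilon> j)\<^sup>2 / 2)\<^sup>2) * L2_norm \<phi> * L2_norm \<psi>"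
proof -
  obtain bs :: "((real^'n) \<times> (real^'n)) list" where bs: "distinct bs" "set bs = Basis"
    using finite_distinct_list[OF finite_Basis] by blast
  have sF: "smooth_symbol (coord_weight \<epsilon>) bs M F"
    using symbol_derivative_bounds_smooth_symbol[OF F, of bs "[]" F] bs by (simp add: has_iterated_partial_Nil_iff)
  let ?P = "(2 * pi * h) ^ CARD('n) * L2_norm \<phi> * L2_norm \<psi>"
  have s: "sqrt (h / 2) > 0" "(sqrt (h / 2))\<^sup>2 = h / 2" using h by simp_all
  have "norm (LBINT p. F p * (wigner_at h \<phi> \<psi> p)) 
    \<le> M * ?P * (\<Prod>b\<in>Basis. 1 + (sqrt (h / 2))\<^sup>2 * (coord_weight \<epsilon> b)\<^sup>2)"
  proof (rule pairing_bound[OF s(1) integrable_wigner[OF S h] _ _ bs sF])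
    show "0 \<le> ?P" using h by simp
    show "norm (LBINT p. modulated_average (sqrt (h / 2)) y G p * (wigner_at h \<phi> \<psi> p)) \<le> N * ?P"
      if "continuous_on UNIV G" "\<And>p. norm (G p) \<le> N" for G N y
      using modulated_average_wigner_bound[OF S h that, of y] by simp
  qed
  also have "(\<Prod>b\<in>Basis. 1 + (sqrt (h / 2))\<^sup>2 * (coord_weight \<epsilon> b)\<^sup>2) = (\<Prod>j\<in>UNIV. (1 + h * (\<epsilon> j)\<^sup>2 / 2)\<^sup>2)"
    unfolding prod_Basis_pair s(2) coord_weight_axis by (simp add: power2_eq_square)
  finally have "norm (LBINT p. F p * (wigner_at h \<phi> \<psi> p)) 
    \<le> M * ?P * (\<Prod>j\<in>UNIV. (1 + h * (\<epsilon> j)\<^sup>2 / 2)\<^sup>2)" .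
  then have "1 / (2 * pi * h) ^ CARD('n) * norm (LBINT p. F p * (wigner_at h \<phi> \<psi> p))
    \<le> 1 / (2 * pi * h) ^ CARD('n) * (M * ?P * (\<Prod>j\<in>UNIV. (1 + h * (\<epsilon> j)\<^sup>2 / 2)\<^sup>2))"
    using h by (intro mult_left_mono) simp_all
  also have "\<dots> = M * (\<Prod>j\<in>UNIV. (1 + h * (\<epsilon> j)\<^sup>2 / 2)\<^sup>2) * L2_norm \<phi> * L2_norm \<psi>"
    using h by (simp add: field_simps)
  finally show ?thesis unfolding norm_mult norm_of_real using h by simp
qed

lemma cross_lc:
  "cross (lc a \<phi> b \<phi>') \<psi> x s = a * cross \<phi> \<psi> x s + b * cross \<phi>' \<psi> x s"
  "cross \<phi> (lc a \<psi> b \<psi>') x s = cnj a * cross \<phi> \<psi> x s + cnj b * cross \<phi> \<psi>' x s"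
  unfolding cross_def by (simp_all add: algebra_simps)

lemma wigner_lc:
  assumes "schwartz \<phi>" "schwartz \<phi>'" "schwartz \<psi>"
  shows "wigner h (lc a \<phi> b \<phi>') \<psi> x t = a * wigner h \<phi> \<psi> x t + b * wigner h \<phi>' \<psi> x t"
    and "wigner h \<psi> (lc a \<phi> b \<phi>') x t = cnj a * wigner h \<psi> \<phi> x t + cnj b * wigner h \<psi> \<phi>' x t"
proof -
  show "wigner h (lc a \<phi> b \<phi>') \<psi> x t = a * wigner h \<phi> \<psi> x t + b * wigner h \<phi>' \<psi> x t"
    unfolding wigner_def cross_lc by (intro integral_mult_lc integrable_exp_cross assms)
  show "wigner h \<psi> (lc a \<phi> b \<phi>') x t = cnj a * wigner h \<psi> \<phi> x t + cnj b * wigner h \<psi> \<phi>' x t"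
    unfolding wigner_def cross_lc by (intro integral_mult_lc integrable_exp_cross assms)
qed

lemma wigner_pairing_lc:
  fixes F :: "'a::euclidean_space \<times> 'a \<Rightarrow> complex" and c :: complex
  assumes S: "schwartz \<phi>" "schwartz \<phi>'" "schwartz \<psi>" and h: "h > 0"
    and F: "continuous_on UNIV F" "\<And>p. norm (F p) \<le> M"
  defines "B \<equiv> (\<lambda>\<phi> \<psi>. c * (LBINT p. F p * (wigner_at h \<phi> \<psi> p)))"
  shows "B (lc a \<phi> b \<phi>') \<psi> = a * B \<phi> \<psi> + b * B \<phi>' \<psi>"
    and "B \<psi> (lc a \<phi> b \<phi>') = cnj a * B \<psi> \<phi> + cnj b * B \<psi> \<phi>'"
proof -
  have i: "integrable lborel (\<lambda>p. F p * (case p of (x, t) \<Rightarrow> wigner h f g x t))" if "schwartz f" "schwartz g" for f g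
    using integrable_bounded_mult[OF integrable_wigner[OF that h] F] by (simp add: mult.commute)
  show "B (lc a \<phi> b \<phi>') \<psi> = a * B \<phi> \<psi> + b * B \<phi>' \<psi>"
    using integral_mult_lc[OF i[OF S(1,3)] i[OF S(2,3)], of a b]
    unfolding B_def split_beta' wigner_lc[OF S] by (simp add: algebra_simps)
  show "B \<psi> (lc a \<phi> b \<phi>') = cnj a * B \<psi> \<phi> + cnj b * B \<psi> \<phi>'"
    using integral_mult_lc[OF i[OF S(3,1)] i[OF S(3,2)], of "cnj a" "cnj b"]
    unfolding B_def split_beta' wigner_lc[OF S] by (simp add: algebra_simps)
qed

theorem weyl_operator_exists:
  fixes F :: "(real^'n) \<times> (real^'n) \<Rightarrow> complex"
  assumes F: "symbol_derivative_bounds 2 M \<epsilon> F" "continuous_on UNIV F" "\<And>x \<xi>. norm (F (x, \<xi>)) \<le> M" and h: "h > 0"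
  shows "\<exists>A. is_bounded_weyl_operator h F A \<and> L2_opnorm A \<le> M * (\<Prod>j\<in>UNIV. (1 + h * (\<epsilon> j)\<^sup>2 / 2)\<^sup>2)"
proof -
  interpret L2_subspace "schwartz :: (real^'n \<Rightarrow> complex) \<Rightarrow> bool" by (rule L2_subspace_schwartz)
  let ?C = "M * (\<Prod>j\<in>UNIV. (1 + h * (\<epsilon> j)\<^sup>2 / 2)\<^sup>2)"
  have F': "norm (F p) \<le> M" for p using F(3) by (cases p) auto
  have M: "0 \<le> M" using order_trans[OF norm_ge_zero F'] .
  then have C: "0 \<le> ?C" by (intro mult_nonneg_nonneg prod_nonneg) auto
  define B where "B \<phi> \<psi> = of_real (1 / (2 * pi * h) ^ CARD('n)) * (LBINT p. F p * (wigner_at h \<phi> \<psi> p))" for \<phi> \<psi>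
  have "\<exists>A. bounded_L2_operator A \<and> (\<forall>f. L2_fun f \<longrightarrow> L2_norm (A f) \<le> ?C * L2_norm f) \<and>
    (\<forall>f g. schwartz f \<longrightarrow> schwartz g \<longrightarrow> L2_inner (A f) g = B f g)"
  proof (rule sesquilinear_form_operator[OF _ _ _ C])
    show "B (lc a f b g) k = a * B f k + b * B g k" if "schwartz f" "schwartz g" "schwartz k" for f g k a b
      unfolding B_def by (rule wigner_pairing_lc(1)[OF that h F(2) F'])
    show "B k (lc a f b g) = cnj a * B k f + cnj b * B k g" if "schwartz f" "schwartz g" "schwartz k" for f g k a b
      unfolding B_def by (rule wigner_pairing_lc(2)[OF that h F(2) F'])
    show "norm (B f g) \<le> ?C * L2_norm f * L2_norm g" if "schwartz f" "schwartz g" for f g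
      unfolding B_def by (rule weyl_form_bound[OF F that h])
  qed
  then obtain A where A: "bounded_L2_operator A" "\<And>f. L2_fun f \<Longrightarrow> L2_norm (A f) \<le> ?C * L2_norm f"
    "\<And>f g. schwartz f \<Longrightarrow> schwartz g \<Longrightarrow> L2_inner (A f) g = B f g" by blast
  have "is_bounded_weyl_operator h F A"
    unfolding is_bounded_weyl_operator_def
  proof (intro conjI allI impI A(1))
    fix \<phi> \<psi> :: "real^'n \<Rightarrow> complex" assume "schwartz \<phi> \<and> schwartz \<psi>"
    then show "has_weyl_form h F \<phi> \<psi> (L2_inner (A \<phi>) \<psi>)"
      using has_weyl_form_wigner[OF _ _ h F(2) F'] A(3) unfolding B_def by simp
  qed
  moreover have "L2_opnorm A \<le> ?C"
    unfolding L2_opnorm_def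
  proof (rule cSup_least)
    have "L2_fun (\<lambda>_. 0 :: complex)" "L2_norm (\<lambda>_. 0) \<le> 1" unfolding L2_fun_def L2_norm_def by simp_all
    then show "{L2_norm (A f) |f. L2_fun f \<and> L2_norm f \<le> 1} \<noteq> {}" by blast
    fix r assume "r \<in> {L2_norm (A f) |f. L2_fun f \<and> L2_norm f \<le> 1}"
    then obtain f where f: "r = L2_norm (A f)" "L2_fun f" "L2_norm f \<le> 1" by blast
    have "r \<le> ?C * L2_norm f" unfolding f(1) by (rule A(2)[OF f(2)])
    also have "\<dots> \<le> ?C" using mult_left_mono[OF f(3) C] by simp
    finally show "r \<le> ?C" .
  qed
  ultimately show ?thesis by blast
qed

text \<open>
  After expanding the square, the powers \<open>e\<^sup>2\<close> and \<open>e^4\<close> are at most \<open>K * e\<close>, and \<open>h\<close> and \<open>h\<^sup>2\<close> are at most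
  \<open>sqrt h\<close>.
\<close>

lemma factor_le_sqrt:
  fixes e h K :: real
  assumes e: "0 \<le> e" and h: "0 < h" "h \<le> 1" and K: "max 1 (e ^ 3) \<le> K"
  shows "(1 + h * e\<^sup>2 / 2)\<^sup>2 \<le> 1 + 225 * pi * K * sqrt h * e"
proof -
  have sh: "h \<le> sqrt h" "h\<^sup>2 \<le> sqrt h"
  proof -
    show "h \<le> sqrt h" using h by (intro real_le_rsqrt) (simp add: power2_eq_square mult_left_le)
    moreover have "h\<^sup>2 \<le> h" using h by (simp add: power2_eq_square mult_left_le)
    ultimately show "h\<^sup>2 \<le> sqrt h" by simp
  qed
  have "e \<le> K" "e ^ 3 \<le> K" "0 \<le> K"
  proof -
    show "e ^ 3 \<le> K" "0 \<le> K" using K by simp_all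
    show "e \<le> K"
    proof (cases "e \<le> 1")
      case False
      then have "e ^ 1 \<le> e ^ 3" by (intro power_increasing) auto
      then show ?thesis using \<open>e ^ 3 \<le> K\<close> by simp
    qed (use K in simp)
  qed
  then have "h * (e * e) \<le> sqrt h * (K * e)" "h\<^sup>2 * (e ^ 3 * e) \<le> sqrt h * (K * e)"
    using e h sh by (intro mult_mono mult_right_mono; simp)+
  moreover have "(1 + h * e\<^sup>2 / 2)\<^sup>2 = 1 + h * (e * e) + h\<^sup>2 * (e ^ 3 * e) / 4"
    by (simp add: power2_eq_square power3_eq_cube algebra_simps)
  moreover have "0 \<le> sqrt h * (K * e)" using \<open>0 \<le> K\<close> e h by simp
  ultimately have "(1 + h * e\<^sup>2 / 2)\<^sup>2 \<le> 1 + 2 * (sqrt h * (K * e))" by linarith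
  also have "\<dots> \<le> 1 + (225 * pi) * (sqrt h * (K * e))"
    using \<open>0 \<le> K\<close> e h pi_gt3 by (intro add_left_mono mult_right_mono) auto
  finally show ?thesis by (simp add: mult_ac)
qed

lemma factor_le_linear:
  fixes e h K :: real
  assumes e: "0 \<le> e" and h: "0 < h" "h \<le> 1" and K: "max 1 (e ^ 6) \<le> K"
  shows "(1 + h * e\<^sup>2 / 2)\<^sup>2 \<le> 1 + 225 * pi * K * h * e\<^sup>2"
proof -
  have "h\<^sup>2 \<le> h" using h by (simp add: power2_eq_square mult_left_le)
  have "1 \<le> K" "e\<^sup>2 \<le> K"
  proof -
    show "1 \<le> K" using K by simp
    show "e\<^sup>2 \<le> K"
    proof (cases "e \<le> 1")
      case True
      then have "e\<^sup>2 \<le> 1" using e by (intro power_le_one)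
      then show ?thesis using K by simp
    next
      case False
      then have "e\<^sup>2 \<le> e ^ 6" by (intro power_increasing) auto
      then show ?thesis using K by simp
    qed
  qed
  then have "h * (1 * e\<^sup>2) \<le> h * (K * e\<^sup>2)" "h\<^sup>2 * (e\<^sup>2 * e\<^sup>2) \<le> h * (K * e\<^sup>2)"
    using e h \<open>h\<^sup>2 \<le> h\<close> by (intro mult_mono mult_right_mono mult_left_mono; simp)+
  moreover have "(1 + h * e\<^sup>2 / 2)\<^sup>2 = 1 + h * (1 * e\<^sup>2) + h\<^sup>2 * (e\<^sup>2 * e\<^sup>2) / 4"
    by (simp add: power2_eq_square algebra_simps)
  moreover have nn: "0 \<le> h * (K * e\<^sup>2)" using \<open>1 \<le> K\<close> h by simp
  ultimately have "(1 + h * e\<^sup>2 / 2)\<^sup>2 \<le> 1 + 2 * (h * (K * e\<^sup>2))" by linarith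
  also have "\<dots> \<le> 1 + (225 * pi) * (h * (K * e\<^sup>2))"
    using nn pi_gt3 by (intro add_left_mono mult_right_mono) auto
  finally show ?thesis by (simp add: mult_ac)
qed

theorem theorem1p1:
  fixes F :: "(real^'n) \<times> (real^'n) \<Rightarrow> complex"
    and M h :: real
    and \<epsilon> :: "'n \<Rightarrow> real"
  assumes "continuous_on UNIV F"
    and "M > 0"
    and "\<And>j. \<epsilon> j \<ge> 0"
    and "\<And>x \<xi>. norm (F (x, \<xi>)) \<le> M"
    and "symbol_derivative_bounds 2 M \<epsilon> F"
    and "h > 0"
  shows "\<exists>A. is_bounded_weyl_operator h F A \<and>
    (h \<le> 1 \<longrightarrow>
      L2_opnorm A \<le>
        M * (\<Prod>j\<in>UNIV. 1 + 225 * pi * (SUP j. max 1 (\<epsilon> j ^ 3)) * sqrt h * \<epsilon> j)) \<and>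
    (h \<le> 1 \<and> symbol_derivative_bounds 4 M \<epsilon> F \<longrightarrow>
      L2_opnorm A \<le>
        M * (\<Prod>j\<in>UNIV. 1 + 225 * pi * (SUP j. max 1 (\<epsilon> j ^ 6)) * h * (\<epsilon> j)\<^sup>2))"
proof -
  obtain A where A: "is_bounded_weyl_operator h F A" "L2_opnorm A \<le> M * (\<Prod>j\<in>UNIV. (1 + h * (\<epsilon> j)\<^sup>2 / 2)\<^sup>2)"
    using weyl_operator_exists[OF assms(5,1,4,6)] by blast
  have K: "max 1 (\<epsilon> j ^ k) \<le> (SUP j. max 1 (\<epsilon> j ^ k))" for j k
    by (rule cSUP_upper) (auto intro: bdd_above_finite)
  have "L2_opnorm A \<le> M * (\<Prod>j\<in>UNIV. 1 + 225 * pi * (SUP j. max 1 (\<epsilon> j ^ 3)) * sqrt h * \<epsilon> j)" if "h \<le> 1"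
    using assms(2,3,6) that
    by (intro order_trans[OF A(2)] mult_left_mono prod_mono conjI factor_le_sqrt K) auto
  moreover have "L2_opnorm A \<le> M * (\<Prod>j\<in>UNIV. 1 + 225 * pi * (SUP j. max 1 (\<epsilon> j ^ 6)) * h * (\<epsilon> j)\<^sup>2)" if "h \<le> 1"
    using assms(2,3,6) that
    by (intro order_trans[OF A(2)] mult_left_mono prod_mono conjI factor_le_linear K) auto
  ultimately show ?thesis using A(1) by blast
qed

end
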